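(* Assume the second moment condition $\int_0^\infty x^2\,\mu(\mathrm{d}x)<\infty$. Then $0<\lambda_0\le\lambda_c\le\lambda_1<\infty$. Under the stronger assumption $\int_0^\infty x^2\log x\,\mu(\mathrm{d}x)<\infty$ we also have $\lambda_0\le\lambda_c^\star\le\lambda_1$.
   Context: Poisson Boolean percolation: $\mu$ is a probability measure on $\mathbb{R}_+=[0,\infty)$. For $\lambda\ge 0$, $\mathbb{P}_\lambda$ is the law of a Poisson point process $\omega$ on $\mathbb{R}^2\times\mathbb{R}_+$ with intensity measure $\lambda\,\mathrm{d}x\,\mu(\mathrm{d}z)$. The occupied set is $\mathcal{O}=\bigcup_{(x,z)\in\omega}B(x,z)$, where $B(x,z)$ is the closed Euclidean disc with center $x$ and radius $z$; the vacant set is $\mathcal{V}=\mathbb{R}^2\setminus\mathcal{O}$. For $r,h>0$, $\mathrm{Cross}(r,h)$ is the event that there is a path contained in $\mathcal{O}\cap([0,r]\times[0,h])$ connecting $\{0\}\times[0,h]$ to $\{r\}\times[0,h]$. For $\mathcal{C}\in\{\mathcal{O},\mathcal{V}\}$, $[0\overset{\mathcal{C}}{\longleftrightarrow}\infty]$ is the event that for every $r\ge1$ there is a path in $\mathcal{C}$ from $0$ to distance $r$. Define $\lambda_c:=\sup\{\lambda\ge0:\mathbb{P}_\lambda[0\overset{\mathcal{O}}{\longleftrightarrow}\infty]=0\}$, $\lambda_c^\star:=\inf\{\lambda\ge0:\mathbb{P}_\lambda[0\overset{\mathcal{V}}{\longleftrightarrow}\infty]=0\}$, $\lambda_0:=\sup\{\lambda\ge0:\lim_{r\to\infty}\mathbb{P}_\lambda[\mathrm{Cross}(r,3r)]=0\}$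 and $\lambda_1:=\inf\{\lambda\ge0:\lim_{r\to\infty}\mathbb{P}_\lambda[\mathrm{Cross}(3r,r)]=1\}$.
   Formalization: The bound λ₁ < ∞ is claimed only when μ is not the point mass at 0; for μ = δ₀ the occupied set is almost surely countable, no crossing occurs, and λ₁ = ∞, so the printed bound fails there. *)

theory Defs
  imports "HOL-Probability.Probability"
begin

text \<open>
  A configuration of points of a measurable space \<open>E\<close> is a countable subset of \<open>E\<close>; the
  configurations carry the sigma-algebra generated by the counts \<open>\<omega> \<mapsto> #(\<omega> \<inter> A)\<close>.
  Sets rather than multisets suffice because the intensities used below have no atoms, so that the
  process has almost surely no multiple points.
\<close>

definition configurations :: "'a measure \<Rightarrow> 'a set set" where
  "configurations E = {\<omega>. \<omega> \<subseteq> space E \<and> countable \<omega>}"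

definition config_algebra :: "'a measure \<Rightarrow> 'a set measure" where
  "config_algebra E = sigma (configurations E)
     {{\<omega> \<in> configurations E. finite (\<omega> \<inter> A) \<and> card (\<omega> \<inter> A) = k} | A k. A \<in> sets E}"

text \<open>
  The finiteness condition is needed because \<open>card\<close> of an infinite set is \<open>0\<close>. In the independence
  clause it can be omitted, as the first clause makes the counts almost surely finite. Finite
  families of disjoint sets are covered by padding with empty sets.
\<close>

definition poisson_process_law :: "'a measure \<Rightarrow> 'a set measure \<Rightarrow> bool" where
  "poisson_process_law \<Lambda> P \<longleftrightarrow>
     prob_space P \<and> sets P = sets (config_algebra \<Lambda>) \<and>
     (\<forall>A\<in>sets \<Lambda>. emeasure \<Lambda> A < \<infinity> \<longrightarrow>
        (\<forall>k::nat. measure P {\<omega> \<in> space P. finite (\<omega> \<inter> A) \<and> card (\<omega> \<inter> A) = k} =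
           measure \<Lambda> A ^ k / fact k * exp (- measure \<Lambda> A))) \<and>
     (\<forall>A :: nat \<Rightarrow> 'a set.
        (\<forall>i. A i \<in> sets \<Lambda> \<and> emeasure \<Lambda> (A i) < \<infinity>) \<longrightarrow> disjoint_family A \<longrightarrow>
        prob_space.indep_vars P (\<lambda>_. count_space UNIV) (\<lambda>i \<omega>. card (\<omega> \<inter> A i)) UNIV)"

type_synonym config = "((real \<times> real) \<times> real) set"

definition boolean_intensity :: "real measure \<Rightarrow> real \<Rightarrow> ((real \<times> real) \<times> real) measure" where
  "boolean_intensity \<mu> \<rho> = scale_measure (ennreal \<rho>) (lborel \<Otimes>\<^sub>M \<mu>)"

definition occupied :: "config \<Rightarrow> (real \<times> real) set" where
  "occupied \<omega> = (\<Union>(x, z)\<in>\<omega>. cball x z)"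

definition vacant :: "config \<Rightarrow> (real \<times> real) set" where
  "vacant \<omega> = - occupied \<omega>"

definition Cross :: "real \<Rightarrow> real \<Rightarrow> config \<Rightarrow> bool" where
  "Cross r h \<omega> \<longleftrightarrow> (\<exists>\<gamma>. path \<gamma> \<and> path_image \<gamma> \<subseteq> occupied \<omega> \<inter> ({0..r} \<times> {0..h}) \<and>
     pathstart \<gamma> \<in> {0} \<times> {0..h} \<and> pathfinish \<gamma> \<in> {r} \<times> {0..h})"

definition origin_to_infinity :: "(real \<times> real) set \<Rightarrow> bool" where
  "origin_to_infinity C \<longleftrightarrow> (\<forall>r\<ge>1::real. \<exists>\<gamma>. path \<gamma> \<and> path_image \<gamma> \<subseteq> C \<and>
     pathstart \<gamma> = 0 \<and> dist 0 (pathfinish \<gamma>) = r)"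

text \<open>
  Probabilities are taken in the completion: the path events above are determined by finitely many
  discs only almost surely, so they need not lie in the sigma-algebra generated by the counts.
\<close>

definition event_prob :: "'a measure \<Rightarrow> ('a \<Rightarrow> bool) \<Rightarrow> real" where
  "event_prob P Q = measure (completion P) {\<omega> \<in> space P. Q \<omega>}"

text \<open>The critical parameters take values in \<open>[0, \<infinity>]\<close>, with \<open>inf \<emptyset> = \<infinity>\<close>.\<close>

definition lambda_c :: "(real \<Rightarrow> config measure) \<Rightarrow> ennreal" where
  "lambda_c P = Sup (ennreal `
     {\<rho>. \<rho> \<ge> 0 \<and> event_prob (P \<rho>) (\<lambda>\<omega>. origin_to_infinity (occupied \<omega>)) = 0})"

definition lambda_c_star :: "(real \<Rightarrow> config measure) \<Rightarrow> ennreal" where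
  "lambda_c_star P = Inf (ennreal `
     {\<rho>. \<rho> \<ge> 0 \<and> event_prob (P \<rho>) (\<lambda>\<omega>. origin_to_infinity (vacant \<omega>)) = 0})"

definition lambda_0 :: "(real \<Rightarrow> config measure) \<Rightarrow> ennreal" where
  "lambda_0 P = Sup (ennreal `
     {\<rho>. \<rho> \<ge> 0 \<and> ((\<lambda>r. event_prob (P \<rho>) (Cross r (3 * r))) \<longlongrightarrow> 0) at_top})"

definition lambda_1 :: "(real \<Rightarrow> config measure) \<Rightarrow> ennreal" where
  "lambda_1 P = Inf (ennreal `
     {\<rho>. \<rho> \<ge> 0 \<and> ((\<lambda>r. event_prob (P \<rho>) (Cross (3 * r) r)) \<longlongrightarrow> 1) at_top})"

end

(*
  Under the second moment condition almost every configuration is locally finite, and a law on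
  locally finite configurations is determined by its void probabilities; translation invariance,
  monotonicity in the intensity (superposition) and independence of disjoint regions (resampling)
  all follow from this uniqueness.

  Discs of radius at most r/4 act independently at distance r, and a box of size r meets a larger
  disc with probability at most a constant times the integral of z^2 over z > r/4.  Hence the
  probability p(r) of crossing [0,r] x [0,3r] satisfies p(3r) <= C p(r)^2 + o(1), which gives
  lambda_0 > 0; four crossings surround the origin, which gives lambda_0 <= lambda_c.  For discs of
  radius at most s, gluing crossings gives f(3r) <= 49 f(r)^2 for r >= 4s, where f is the
  probability of not crossing [0,3r] x [0,r] the long way.  Once f is small at a single scale, crossings of
  alternating orientation exist at all scales 3^k r with positive probability and form an unbounded
  cluster; this needs only p = 1 - o(1), not a rate, because s may depend on the starting scale.
  Under the logarithmic moment condition the error terms are summable along r = 3^k, and planar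
  duality (Janiszewski's theorem) turns the absence of occupied crossings into an unbounded vacant
  cluster.
*)

theory Submission
  imports Defs
begin

section \<open>Planar crossings\<close>

text \<open>Radii are unbounded, so distant regions are never independent and every independence
  step first cuts the radii. For occupied crossings the cut is harmless: dropping discs only
  destroys crossings, so one fixed cut serves all larger scales without error. For vacant crossings
  dropping discs helps, so the cut must grow with the scale and its error is paid every time. The
  errors are second moment tails beyond 3^k/4; summed over k they weigh a radius z by z^2 times the
  number of scales below 4z, and this count is the logarithm. A second obstacle is measurability,
  since path events range over uncountably many paths. For locally finite configurations, a
  connection in a compact convex set that exists for all slightly enlarged radii also exists for the
  radii themselves, which reduces it to countably many conditions. Finally, the multiscale
  construction yields an unbounded component somewhere, not at the origin; translations by a
  countable dense set bring it there.\<close>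

text \<open>Cut the path at the first time it reaches level \<open>b\<close>, then at the last
  earlier time at which its level is at most \<open>a\<close>; in between it cannot leave the
  slab.\<close>

lemma path_component_slab:
  fixes \<phi> :: "'a::real_normed_vector \<Rightarrow> real"
  assumes pq: "path_component S p q" and cont: "continuous_on S \<phi>"
    and ab: "\<phi> p \<le> a" "a \<le> b" "b \<le> \<phi> q"
  shows "\<exists>p' q'. \<phi> p' = a \<and> \<phi> q' = b \<and> path_component S p p' \<and>
    path_component (S \<inter> {x. a \<le> \<phi> x \<and> \<phi> x \<le> b}) p' q'"
proof -
  obtain g where g: "path g" "path_image g \<subseteq> S" "pathstart g = p" "pathfinish g = q"
    using pq unfolding path_component_def by auto
  define f where "f = \<phi> \<circ> g"
  have contf: "continuous_on {0..1} f"
    using g cont unfolding f_def path_def path_image_def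
    by (intro continuous_on_compose) (auto intro: continuous_on_subset)
  have f01: "f 0 \<le> a" "b \<le> f 1"
    using g ab by (auto simp: f_def pathstart_def pathfinish_def)
  let ?B = "{t\<in>{0..1}. b \<le> f t}"
  have "closed ?B"
    using continuous_closed_preimage[OF contf, of "{b..}"] by (simp add: vimage_def Int_def)
  then have "compact ?B"
    by (auto simp: compact_eq_bounded_closed intro: bounded_subset[OF bounded_closed_interval])
  moreover have "?B \<noteq> {}" using f01 by force
  ultimately obtain v where v: "v \<in> ?B" "\<And>t. t \<in> ?B \<Longrightarrow> v \<le> t"
    by (meson compact_attains_inf)
  obtain x where x: "0 \<le> x" "x \<le> v" "f x = b"
    using IVT'[of f 0 b v] f01 ab v continuous_on_subset[OF contf, of "{0..v}"] by auto
  with v have fv: "f v = b" by force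
  have v01: "0 \<le> v" "v \<le> 1" using v by auto
  have contv: "continuous_on {0..v} f"
    using contf v01 by (auto intro: continuous_on_subset)
  let ?A = "{t\<in>{0..v}. f t \<le> a}"
  have "closed ?A"
    using continuous_closed_preimage[OF contv, of "{..a}"] by (simp add: vimage_def Int_def)
  then have "compact ?A"
    by (auto simp: compact_eq_bounded_closed intro: bounded_subset[OF bounded_closed_interval])
  moreover have "?A \<noteq> {}" using f01 v01 by force
  ultimately obtain u where u: "u \<in> ?A" "\<And>t. t \<in> ?A \<Longrightarrow> t \<le> u"
    by (meson compact_attains_sup)
  obtain y where y: "u \<le> y" "y \<le> v" "f y = a"
    using IVT'[of f u a v] fv u ab continuous_on_subset[OF contv, of "{u..v}"] by auto
  have "y \<le> u" using y u(1) by (intro u(2)) auto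
  with y have fu: "f u = a" by auto
  have uv: "0 \<le> u" "u \<le> v" using u by auto
  have mid: "a \<le> f t \<and> f t \<le> b" if "t \<in> {u..v}" for t
  proof
    show "a \<le> f t"
    proof (rule ccontr)
      assume "\<not> a \<le> f t"
      then have "t \<in> ?A" using that uv by auto
      then have "t = u" using u(2)[of t] that by simp
      with fu \<open>\<not> a \<le> f t\<close> show False by simp
    qed
    show "f t \<le> b"
    proof (rule ccontr)
      assume "\<not> f t \<le> b"
      then have "t \<in> ?B" using that uv v01 by auto
      then have "t = v" using v(2)[of t] that by simp
      with fv \<open>\<not> f t \<le> b\<close> show False by simp
    qed
  qed
  have uI: "u \<in> {0..1}" and vI: "v \<in> {0..1}" using uv v01 by auto
  have "path_component (S \<inter> {x. a \<le> \<phi> x \<and> \<phi> x \<le> b}) (g u) (g v)"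
    unfolding path_component_def
  proof (intro exI conjI)
    show "path (subpath u v g)" using g uI vI by simp
    show "path_image (subpath u v g) \<subseteq> S \<inter> {x. a \<le> \<phi> x \<and> \<phi> x \<le> b}"
      unfolding path_image_subpath using mid g(2) uv v01 by (auto simp: f_def path_image_def)
  qed auto
  moreover have "path_component S p (g u)"
  proof -
    have "g u \<in> path_image g" using uI by (auto simp: path_image_def)
    then show ?thesis
      using path_component_path_image_pathstart[of g "g u"] g path_component_of_subset by metis
  qed
  ultimately show ?thesis
    using fu fv by (auto simp: f_def)
qed

text \<open>Stated by \<open>path_component\<close> so that gluing becomes transitivity, and for an
  arbitrary set so that occupied and vacant crossings share one notion.\<close>

definition hcross :: "(real \<times> real) set \<Rightarrow> real \<Rightarrow> real \<Rightarrow> real \<Rightarrow> real \<Rightarrow> bool" where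
  "hcross C a b c d \<longleftrightarrow> (\<exists>p q. fst p = a \<and> fst q = b \<and> path_component (C \<inter> ({a..b} \<times> {c..d})) p q)"

definition vcross :: "(real \<times> real) set \<Rightarrow> real \<Rightarrow> real \<Rightarrow> real \<Rightarrow> real \<Rightarrow> bool" where
  "vcross C a b c d \<longleftrightarrow> (\<exists>p q. snd p = c \<and> snd q = d \<and> path_component (C \<inter> ({a..b} \<times> {c..d})) p q)"

lemma path_component_image:
  assumes "path_component S p q" "continuous_on S h" "h ` S \<subseteq> T"
  shows "path_component T (h p) (h q)"
proof -
  obtain g where g: "path g" "path_image g \<subseteq> S" "pathstart g = p" "pathfinish g = q"
    using assms(1) unfolding path_component_def by blast
  show ?thesis unfolding path_component_def
  proof (intro exI conjI)
    show "path (h \<circ> g)"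
      using g assms(2) by (intro path_continuous_image) (auto intro: continuous_on_subset)
    show "path_image (h \<circ> g) \<subseteq> T" unfolding path_image_compose using g(2) assms(3) by blast
  qed (use g in \<open>auto simp: pathstart_compose pathfinish_compose\<close>)
qed

lemma vcross_conv_hcross: "vcross C a b c d \<longleftrightarrow> hcross (prod.swap ` C) c d a b"
proof
  assume "vcross C a b c d"
  then obtain p q where pq: "snd p = c" "snd q = d" "path_component (C \<inter> ({a..b} \<times> {c..d})) p q"
    unfolding vcross_def by blast
  have "path_component (prod.swap ` C \<inter> ({c..d} \<times> {a..b})) (prod.swap p) (prod.swap q)"
    by (rule path_component_image[OF pq(3)]) (auto intro: continuous_on_swap)
  with pq show "hcross (prod.swap ` C) c d a b" unfolding hcross_def by (metis fst_swap)
next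
  assume "hcross (prod.swap ` C) c d a b"
  then obtain p q where pq: "fst p = c" "fst q = d"
    "path_component (prod.swap ` C \<inter> ({c..d} \<times> {a..b})) p q"
    unfolding hcross_def by blast
  have "path_component (C \<inter> ({a..b} \<times> {c..d})) (prod.swap p) (prod.swap q)"
    by (rule path_component_image[OF pq(3)]) (auto intro: continuous_on_swap)
  with pq show "vcross C a b c d" unfolding vcross_def by (metis snd_swap)
qed

lemma hcross_mono: "hcross C a b c d \<Longrightarrow> C \<inter> ({a..b} \<times> {c..d}) \<subseteq> D \<Longrightarrow> c' \<le> c \<Longrightarrow> d \<le> d' \<Longrightarrow> hcross D a b c' d'"
  unfolding hcross_def by (elim exE conjE, intro exI conjI) (auto elim!: path_component_of_subset[rotated])

lemma vcross_mono: "vcross C a b c d \<Longrightarrow> C \<inter> ({a..b} \<times> {c..d}) \<subseteq> D \<Longrightarrow> a' \<le> a \<Longrightarrow> b \<le> b' \<Longrightarrow> vcross D a' b' c d"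
  unfolding vcross_def by (elim exE conjE, intro exI conjI) (auto elim!: path_component_of_subset[rotated])

lemma hcrossI_slab:
  assumes "path_component (C \<inter> (X \<times> {c..d})) p q" "fst p \<le> a" "a \<le> b" "b \<le> fst q"
  shows "hcross C a b c d"
proof -
  from path_component_slab[OF assms(1) continuous_on_fst[OF continuous_on_id] assms(2-4)]
  obtain p' q' where "fst p' = a" "fst q' = b"
    "path_component (C \<inter> (X \<times> {c..d}) \<inter> {x. a \<le> fst x \<and> fst x \<le> b}) p' q'"
    by blast
  then show ?thesis unfolding hcross_def
    by (intro exI[of _ p'] exI[of _ q']) (auto elim!: path_component_of_subset[rotated])
qed

lemma vcrossI_slab:
  assumes "path_component (C \<inter> ({a..b} \<times> X)) p q" "snd p \<le> c" "c \<le> d" "d \<le> snd q"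
  shows "vcross C a b c d"
proof -
  from path_component_slab[OF assms(1) continuous_on_snd[OF continuous_on_id] assms(2-4)]
  obtain p' q' where "snd p' = c" "snd q' = d"
    "path_component (C \<inter> ({a..b} \<times> X) \<inter> {x. c \<le> snd x \<and> snd x \<le> d}) p' q'"
    by blast
  then show ?thesis unfolding vcross_def
    by (intro exI[of _ p'] exI[of _ q']) (auto elim!: path_component_of_subset[rotated])
qed

text \<open>This is the Fashoda meet theorem, carried from \<open>real^2\<close> to pairs by
  \<open>\<psi>\<close>. Equal sets \<open>C\<close> and \<open>D\<close> give gluing, complementary
  ones a contradiction.\<close>

lemma crossings_meet:
  fixes a b c d :: real
  assumes h: "path_component (C \<inter> ({a..b} \<times> {c..d})) p q" "fst p = a" "fst q = b"
    and v: "path_component (D \<inter> ({a..b} \<times> {c..d})) p' q'" "snd p' = c" "snd q' = d"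
  obtains z where "z \<in> {a..b} \<times> {c..d}" "path_component (C \<inter> ({a..b} \<times> {c..d})) p z"
    "path_component (D \<inter> ({a..b} \<times> {c..d})) p' z"
proof -
  let ?R = "{a..b} \<times> {c..d}"
  obtain f where f: "path f" "path_image f \<subseteq> C \<inter> ?R" "pathstart f = p" "pathfinish f = q"
    using h unfolding path_component_def by auto
  obtain g where g: "path g" "path_image g \<subseteq> D \<inter> ?R" "pathstart g = p'" "pathfinish g = q'"
    using v unfolding path_component_def by auto
  define \<psi> :: "real \<times> real \<Rightarrow> real^2" where "\<psi> = (\<lambda>x. vector [fst x, snd x])"
  have nth: "\<psi> x $ 1 = fst x" "\<psi> x $ 2 = snd x" for x by (auto simp: \<psi>_def)
  have inj: "\<psi> x = \<psi> y \<Longrightarrow> x = y" for x y by (metis nth prod_eqI)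
  have cont: "continuous_on X \<psi>" for X
    by (subst continuous_on_componentwise)
       (auto simp: Basis_vec_def inner_axis nth UNIV_2 intro!: continuous_intros)
  obtain z where z: "z \<in> path_image (\<psi> \<circ> f)" "z \<in> path_image (\<psi> \<circ> g)"
  proof (rule fashoda[of "\<psi> \<circ> f" "\<psi> \<circ> g" "\<psi> (a,c)" "\<psi> (b,d)"])
    show "path (\<psi> \<circ> f)" "path (\<psi> \<circ> g)" using f g cont by (auto intro: path_continuous_image)
    show "path_image (\<psi> \<circ> f) \<subseteq> cbox (\<psi> (a, c)) (\<psi> (b, d))"
      "path_image (\<psi> \<circ> g) \<subseteq> cbox (\<psi> (a, c)) (\<psi> (b, d))"
      using f g by (fastforce simp: path_image_compose mem_box_cart forall_2 nth)+
  qed (use f g h v in \<open>auto simp: pathstart_compose pathfinish_compose nth\<close>)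
  then obtain w where w: "w \<in> path_image f" "w \<in> path_image g"
    unfolding path_image_compose by (metis imageE inj)
  have "path_component (C \<inter> ?R) p w" "path_component (D \<inter> ?R) p' w"
    using path_component_path_image_pathstart[of f w] path_component_path_image_pathstart[of g w]
      f g w path_component_of_subset by metis+
  with that w f show ?thesis by blast
qed

text \<open>The vertical crossing of the overlap traverses both rectangles from bottom to top, hence
  meets both horizontal crossings and joins them.\<close>

lemma hcross_glue:
  assumes 1: "hcross C a c e f" and v: "vcross C b c e f" and 2: "hcross C b d e f"
    and ord: "a \<le> b" "c \<le> d"
  shows "hcross C a d e f"
proof -
  obtain p1 q1 where h1: "path_component (C \<inter> ({a..c} \<times> {e..f})) p1 q1" "fst p1 = a" "fst q1 = c"
    using 1 unfolding hcross_def by blast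
  obtain p2 q2 where h2: "path_component (C \<inter> ({b..d} \<times> {e..f})) p2 q2" "fst p2 = b" "fst q2 = d"
    using 2 unfolding hcross_def by blast
  obtain p q where v: "path_component (C \<inter> ({b..c} \<times> {e..f})) p q" "snd p = e" "snd q = f"
    using v unfolding vcross_def by blast
  have v1: "path_component (C \<inter> ({a..c} \<times> {e..f})) p q"
    and v2: "path_component (C \<inter> ({b..d} \<times> {e..f})) p q"
    using ord by (auto intro!: path_component_of_subset[OF _ v(1)])
  let ?R = "C \<inter> ({a..d} \<times> {e..f})"
  obtain z1 where z1: "path_component (C \<inter> ({a..c} \<times> {e..f})) p1 z1" "path_component (C \<inter> ({a..c} \<times> {e..f})) p z1"
    using crossings_meet[OF h1 v1 v(2,3)] by blast
  obtain z2 where z2: "path_component (C \<inter> ({b..d} \<times> {e..f})) p2 z2" "path_component (C \<inter> ({b..d} \<times> {e..f})) p z2"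
    using crossings_meet[OF h2 v2 v(2,3)] by blast
  have l: "path_component ?R p1 z1" "path_component ?R p z1"
    using z1 ord by (auto elim!: path_component_of_subset[rotated])
  have r: "path_component ?R p2 z2" "path_component ?R p z2" "path_component ?R p2 q2"
    using z2 h2 ord by (auto elim!: path_component_of_subset[rotated])
  have "path_component ?R p1 q2"
    using l r by (meson path_component_sym path_component_trans)
  with h1 h2 show ?thesis unfolding hcross_def by blast
qed

text \<open>Four rectangles of aspect 3 overlap in three squares; these seven crossings are the
  constant in \<open>pr_not_long_le\<close>.\<close>

lemma hcross_long:
  assumes "hcross C 0 (3 * r) e f" "hcross C (2 * r) (5 * r) e f" "hcross C (4 * r) (7 * r) e f"
      "hcross C (6 * r) (9 * r) e f"
    and "vcross C (2 * r) (3 * r) e f" "vcross C (4 * r) (5 * r) e f" "vcross C (6 * r) (7 * r) e f"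
    and "0 < r"
  shows "hcross C 0 (9 * r) e f"
proof -
  have "hcross C 0 (5 * r) e f" using assms by (intro hcross_glue[OF assms(1,5,2)]) auto
  then have "hcross C 0 (7 * r) e f" using assms by (intro hcross_glue[OF _ assms(6,3)]) auto
  then show ?thesis using assms by (intro hcross_glue[OF _ assms(7,4)]) auto
qed

lemma path_component_Int:
  assumes "path_component S p q" and "\<And>w. path_component S p w \<Longrightarrow> w \<in> Y"
  shows "path_component (S \<inter> Y) p q"
proof -
  obtain g where g: "path g" "path_image g \<subseteq> S" "pathstart g = p" "pathfinish g = q"
    using assms(1) by (auto simp: path_component_def)
  have "w \<in> Y" if "w \<in> path_image g" for w
    using assms(2) path_component_path_image_pathstart[OF g(1) that] g path_component_of_subset by metis
  with g show ?thesis unfolding path_component_def by blast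
qed

text \<open>A crossing path that starts in one band of height \<open>r\<close> either stays within
  this band and its two neighbours, a window of height \<open>3 * r\<close>, or traverses one of the
  neighbours vertically.\<close>

lemma strip_crossing:
  assumes h: "hcross C 0 r 0 (9 * r)" and r: "0 < r"
  shows "\<exists>j\<in>{-1..10::int}. hcross C 0 r (j * r) ((j + 3) * r) \<or> vcross C 0 r (j * r) ((j + 1) * r)"
proof (rule ccontr)
  assume neg: "\<not> ?thesis"
  let ?S = "C \<inter> ({0..r} \<times> {0..9 * r})"
  obtain p q where pq: "path_component ?S p q" "fst p = 0" "fst q = r"
    using h unfolding hcross_def by blast
  have p: "p \<in> {0..r} \<times> {0..9 * r}" using path_component_mem[OF pq(1)] by blast
  define j where "j = \<lfloor>snd p / r\<rfloor>"
  have j: "of_int j * r \<le> snd p" "snd p \<le> (of_int j + 1) * r"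
  proof -
    have "of_int j \<le> snd p / r" "snd p / r \<le> of_int j + 1" unfolding j_def by linarith+
    with r show "of_int j * r \<le> snd p" "snd p \<le> (of_int j + 1) * r"
      by (simp_all only: pos_le_divide_eq pos_divide_le_eq)
  qed
  have "0 \<le> snd p / r" "snd p / r \<le> 9" using p r by (auto simp: field_simps mem_Times_iff)
  \<comment> \<open>The value 9 occurs when the path starts at height \<open>9 * r\<close>; the
    neighbours \<open>j - 1\<close> and \<open>j + 1\<close> then range over -1 to 10, which makes
    twelve indices.\<close>
  then have j09: "0 \<le> j" "j \<le> 9" unfolding j_def by linarith+
  have novc: "\<not> vcross C 0 r (of_int k * r) ((of_int k + 1) * r)" if "k \<in> {-1..10}" for k
    using neg that by blast
  have mid: "w \<in> UNIV \<times> {of_int (j - 1) * r..of_int (j + 2) * r}" if w: "path_component ?S p w" for w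
  proof -
    have "snd w \<le> (of_int (j + 1) + 1) * r"
    proof (rule ccontr)
      assume "\<not> ?thesis"
      then have "vcross C 0 r (of_int (j + 1) * r) ((of_int (j + 1) + 1) * r)"
        using r j by (intro vcrossI_slab[OF w]) (auto simp: algebra_simps)
      with novc[of "j + 1"] j09 show False by auto
    qed
    moreover have "of_int (j - 1) * r \<le> snd w"
    proof (rule ccontr)
      assume "\<not> ?thesis"
      then have "vcross C 0 r (of_int (j - 1) * r) ((of_int (j - 1) + 1) * r)"
        using r j by (intro vcrossI_slab[OF path_component_sym[OF w]]) (auto simp: algebra_simps)
      with novc[of "j - 1"] j09 show False by auto
    qed
    ultimately show ?thesis by (auto simp: mem_Times_iff algebra_simps)
  qed
  have eq: "(of_int (j - 1) + 3 :: real) = of_int (j + 2)" by simp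
  have "hcross C 0 r (of_int (j - 1) * r) ((of_int (j - 1) + 3) * r)"
    unfolding hcross_def eq
  proof (intro exI conjI)
    show "path_component (C \<inter> {0..r} \<times> {of_int (j - 1) * r..of_int (j + 2) * r}) p q"
      using path_component_Int[OF pq(1) mid] by (rule path_component_of_subset[rotated]) (auto simp del: of_int_diff of_int_add)
  qed (use pq in auto)
  moreover have "j - 1 \<in> {-1..10}" using j09 by auto
  ultimately show False using neg by blast
qed

text \<open>In the sup norm the annulus between radii \<open>r / 2\<close> and
  \<open>3 * r / 2\<close> is covered by four rectangles of size \<open>r\<close> by
  \<open>3 * r\<close>; the side of the outer square at which the path arrives selects the one that
  is crossed the short way.\<close>

lemma annulus_crossing:
  assumes pc: "path_component C p q" and p: "\<bar>fst p\<bar> \<le> r / 2" "\<bar>snd p\<bar> \<le> r / 2"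
    and q: "3 * r / 2 \<le> \<bar>fst q\<bar> \<or> 3 * r / 2 \<le> \<bar>snd q\<bar>" and r: "0 < r"
  shows "hcross C (r / 2) (3 * r / 2) (- (3 * r / 2)) (3 * r / 2) \<or>
    hcross C (- (3 * r / 2)) (- (r / 2)) (- (3 * r / 2)) (3 * r / 2) \<or>
    vcross C (- (3 * r / 2)) (3 * r / 2) (r / 2) (3 * r / 2) \<or>
    vcross C (- (3 * r / 2)) (3 * r / 2) (- (3 * r / 2)) (- (r / 2))"
proof -
  let ?m = "\<lambda>x::real \<times> real. max \<bar>fst x\<bar> \<bar>snd x\<bar>"
  have "continuous_on C ?m" by (intro continuous_intros)
  moreover have "?m p \<le> r / 2" "r / 2 \<le> 3 * r / 2" "3 * r / 2 \<le> ?m q" using p q r by auto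
  ultimately obtain p' q' where 1: "?m p' = r / 2" "?m q' = 3 * r / 2"
    and 2: "path_component (C \<inter> {x. r / 2 \<le> ?m x \<and> ?m x \<le> 3 * r / 2}) p' q'"
    using path_component_slab[OF pc, of ?m "r / 2" "3 * r / 2"] by blast
  have 3: "path_component (C \<inter> ({- (3 * r / 2)..3 * r / 2} \<times> {- (3 * r / 2)..3 * r / 2})) p' q'"
    using 2 by (rule path_component_of_subset[rotated]) auto
  note fwd = 3 and bwd = path_component_sym[OF 3]
  consider "fst q' = 3 * r / 2" | "fst q' = - (3 * r / 2)" | "snd q' = 3 * r / 2" | "snd q' = - (3 * r / 2)"
    using 1 by (auto simp: max_def abs_if split: if_splits)
  then show ?thesis
  proof cases
    case 1 with \<open>?m p' = r / 2\<close> r show ?thesis by (intro disjI1 hcrossI_slab[OF fwd]) auto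
  next
    case 2 with \<open>?m p' = r / 2\<close> r show ?thesis by (intro disjI2[OF disjI1] hcrossI_slab[OF bwd]) auto
  next
    case 3 with \<open>?m p' = r / 2\<close> r show ?thesis by (intro disjI2[OF disjI2[OF disjI1]] vcrossI_slab[OF fwd]) auto
  next
    case 4 with \<open>?m p' = r / 2\<close> r show ?thesis by (intro disjI2[OF disjI2[OF disjI2]] vcrossI_slab[OF bwd]) auto
  qed
qed

section \<open>Components of finite unions of convex sets\<close>

definition meet_rel :: "'i set \<Rightarrow> ('i \<Rightarrow> 'a set) \<Rightarrow> ('i \<times> 'i) set" where
  "meet_rel F C = {(i, j). i \<in> F \<and> j \<in> F \<and> C i \<inter> C j \<noteq> {}}"

text \<open>Otherwise the members reachable from \<open>i\<close> in the intersection graph and the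
  remaining ones would have disjoint closed unions that disconnect \<open>S\<close>.\<close>

lemma meet_rel_of_connected:
  assumes F: "finite F" and cl: "\<And>i. i \<in> F \<Longrightarrow> closed (C i)"
    and S: "connected S" "S \<subseteq> (\<Union>i\<in>F. C i)"
    and x: "x \<in> S" "x \<in> C i" "i \<in> F" and y: "y \<in> S" "y \<in> C j" "j \<in> F"
  shows "(i, j) \<in> (meet_rel F C)\<^sup>*"
proof (rule ccontr)
  assume neg: "(i, j) \<notin> (meet_rel F C)\<^sup>*"
  define I where "I = {k \<in> F. (i, k) \<in> (meet_rel F C)\<^sup>*}"
  have "(\<Union>k\<in>I. C k) \<inter> (\<Union>k\<in>F - I. C k) = {}"
  proof (rule ccontr)
    assume "\<not> ?thesis"
    then obtain k l where kl: "k \<in> I" "l \<in> F - I" "C k \<inter> C l \<noteq> {}" by blast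
    then have "(k, l) \<in> meet_rel F C" by (auto simp: I_def meet_rel_def)
    with kl show False by (auto simp: I_def intro: rtrancl_into_rtrancl)
  qed
  moreover have "closed (\<Union>k\<in>I. C k)" "closed (\<Union>k\<in>F - I. C k)"
    using F cl by (auto simp: I_def intro!: closed_UN)
  moreover have "S \<subseteq> (\<Union>k\<in>I. C k) \<union> (\<Union>k\<in>F - I. C k)" using S(2) by (auto simp: I_def)
  moreover have "i \<in> I" "j \<in> F - I" using x y neg by (auto simp: I_def)
  then have "x \<in> (\<Union>k\<in>I. C k)" "y \<in> (\<Union>k\<in>F - I. C k)" using x y by auto
  ultimately show False
    using connected_closedD[OF S(1), of "\<Union>k\<in>I. C k" "\<Union>k\<in>F - I. C k"] x(1) y(1) by blast
qed

text \<open>Each member is path connected by convexity, so a chain of meeting members carries a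
  path. With the previous lemma, connections in a finite union of closed convex sets depend only on
  which members meet.\<close>

lemma path_component_of_meet_rel:
  fixes C :: "'i \<Rightarrow> 'a::real_normed_vector set"
  assumes "(i, j) \<in> (meet_rel F C)\<^sup>*" and conv: "\<And>k. k \<in> F \<Longrightarrow> convex (C k)"
    and i: "i \<in> F" "x \<in> C i" and "y \<in> C j"
  shows "path_component (\<Union>k\<in>F. C k) x y"
proof -
  have *: "path_component (\<Union>k\<in>F. C k) u v" if "k \<in> F" "u \<in> C k" "v \<in> C k" for k u v
    using convex_imp_path_connected[OF conv[OF that(1)]] that
    by (intro path_component_of_subset[of "C k" "\<Union>k\<in>F. C k"]) (auto simp: path_connected_component)
  have "j \<in> F \<and> (\<forall>y\<in>C j. path_component (\<Union>k\<in>F. C k) x y)"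
    using assms(1)
  proof (induction rule: rtrancl_induct)
    case base then show ?case using * i by blast
  next
    case (step j l)
    then obtain w where w: "w \<in> C j" "w \<in> C l" and l: "l \<in> F" by (auto simp: meet_rel_def)
    with step.IH have "path_component (\<Union>k\<in>F. C k) x w" by blast
    with w l * show ?case by (meson path_component_trans)
  qed
  with assms show ?thesis by blast
qed

section \<open>Planar duality\<close>

lemma Janiszewski_prod:
  fixes p q :: "real \<times> real"
  assumes S: "compact S" and T: "closed T" and con: "connected (S \<inter> T)"
    and ccS: "connected_component (- S) p q" and ccT: "connected_component (- T) p q"
  shows "connected_component (- (S \<union> T)) p q"
proof -
  define f :: "real \<times> real \<Rightarrow> complex" where "f = (\<lambda>x. Complex (fst x) (snd x))"
  define g :: "complex \<Rightarrow> real \<times> real" where "g = (\<lambda>z. (Re z, Im z))"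
  have fg: "f (g z) = z" and gf: "g (f x) = x" for z x by (auto simp: f_def g_def)
  have cf: "continuous_on X f" for X
    unfolding f_def Complex_eq by (intro continuous_intros)
  have cg: "continuous_on X g" for X unfolding g_def by (intro continuous_intros)
  have im: "f ` X = g -` X" for X
  proof
    show "f ` X \<subseteq> g -` X" using gf by auto
    show "g -` X \<subseteq> f ` X" by (metis (no_types, lifting) fg image_eqI subsetI vimageD)
  qed
  have imf: "f ` (- X) = - f ` X" for X unfolding im by auto

  have cc: "connected_component (h ` X) (h x) (h y)"
    if xy: "connected_component X x y" and h: "\<And>X. continuous_on X h"
    for h :: "'u::topological_space \<Rightarrow> 'v::topological_space" and X x y
  proof -
    obtain Y where "connected Y" "Y \<subseteq> X" "x \<in> Y" "y \<in> Y"
      using xy unfolding connected_component_def by blast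
    then show ?thesis
      using connected_continuous_image[OF h, of Y] unfolding connected_component_def by blast
  qed
  have "connected_component (- (f ` S \<union> f ` T)) (f p) (f q)"
  proof (rule Janiszewski)
    show "compact (f ` S)" using S cf by (rule compact_continuous_image[rotated])
    show "closed (f ` T)" unfolding im using T cg by (rule closed_vimage)
    have "f ` S \<inter> f ` T = f ` (S \<inter> T)" unfolding im by auto
    then show "connected (f ` S \<inter> f ` T)" using con cf by (simp add: connected_continuous_image)
    show "connected_component (- f ` S) (f p) (f q)" "connected_component (- f ` T) (f p) (f q)"
      using cc[OF ccS cf] cc[OF ccT cf] by (simp_all add: imf)
  qed
  from cc[OF this cg] have "connected_component (g ` f ` (- (S \<union> T))) p q"
    unfolding gf imf image_Un .
  then show ?thesis by (simp add: image_image gf)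
qed

text \<open>\<open>A\<close> collects the components of the union that touch the left side,
  \<open>B\<close> the others; without a crossing \<open>A\<close> misses the right side. Adding the
  left side to \<open>A\<close> and the exterior of a taller box to \<open>B\<close> gives sets with
  connected intersection, neither of which separates a point above the rectangle from one below. By
  Janiszewski's theorem their union does not either.\<close>

lemma vacant_vcross:
  fixes C :: "'i \<Rightarrow> (real \<times> real) set"
  assumes F: "finite F" and C: "\<And>i. i \<in> F \<Longrightarrow> compact (C i)" "\<And>i. i \<in> F \<Longrightarrow> convex (C i)"
      "\<And>i. i \<in> F \<Longrightarrow> C i \<subseteq> {a..b} \<times> {c..d}"
    and ab: "a < b" "c \<le> d" and no: "\<not> hcross (\<Union>i\<in>F. C i) a b c d"
  shows "vcross (- (\<Union>i\<in>F. C i)) a b c d"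
proof -
  let ?K = "\<Union>i\<in>F. C i"
  define I where "I = {j \<in> F. \<exists>i\<in>F. \<exists>x\<in>C i. fst x = a \<and> (i, j) \<in> (meet_rel F C)\<^sup>*}"
  define A where "A = (\<Union>i\<in>I. C i)"
  define B where "B = (\<Union>i\<in>F - I. C i)"
  have KR: "?K \<subseteq> {a..b} \<times> {c..d}" using C(3) by blast
  have "I \<subseteq> F" unfolding I_def by blast
  then have AB: "A \<union> B = ?K" unfolding A_def B_def by blast
  have comp: "compact A" "compact B" using F C(1) by (auto simp: A_def B_def I_def intro!: compact_UN)
  have disj: "A \<inter> B = {}"
  proof (rule ccontr)
    assume "\<not> ?thesis"
    then obtain k l where kl: "k \<in> I" "l \<in> F - I" "C k \<inter> C l \<noteq> {}" unfolding A_def B_def by blast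
    then have "(k, l) \<in> meet_rel F C" by (auto simp: I_def meet_rel_def)
    with kl show False unfolding I_def by (blast intro: rtrancl_into_rtrancl)
  qed
  have Ab: "fst x \<noteq> b" if x: "x \<in> A" for x
  proof
    assume xb: "fst x = b"
    from x obtain i j y where ij: "i \<in> F" "y \<in> C i" "fst y = a" "(i, j) \<in> (meet_rel F C)\<^sup>*" "x \<in> C j"
      unfolding A_def I_def by blast
    have "path_component ?K y x"
      by (rule path_component_of_meet_rel[OF ij(4) C(2) ij(1,2,5)])
    moreover have "?K \<inter> ({a..b} \<times> {c..d}) = ?K" using KR by blast
    ultimately show False using no xb ij unfolding hcross_def by metis
  qed
  have Ba: "fst x \<noteq> a" if x: "x \<in> B" for x
    using x unfolding B_def I_def by blast
  \<comment> \<open>The box extends one unit above and below the rectangle, which leaves room inside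
    it for \<open>p\<close> and \<open>q\<close>.\<close>
  define L where "L = {a} \<times> {c - 1..d + 1}"
  define S where "S = A \<union> L"
  define T where "T = B \<union> - ({a<..<b} \<times> {c - 1<..<d + 1})"
  define p where "p = ((a + b) / 2, d + 1 / 2)"
  define q where "q = ((a + b) / 2, c - 1 / 2)"
  have S: "compact S" unfolding S_def L_def by (intro compact_Un comp compact_Times) auto
  have T: "closed T" unfolding T_def
    by (intro closed_Un compact_imp_closed comp closed_Compl open_Times) auto
  have AR: "x \<in> {a..b} \<times> {c..d}" if "x \<in> A \<or> x \<in> B" for x using that KR AB by blast
  have "S \<inter> T = L"
  proof
    show "S \<inter> T \<subseteq> L"
    proof
      fix x assume x: "x \<in> S \<inter> T"
      show "x \<in> L"
      proof (cases "x \<in> L")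
        case False
        then have "x \<in> A" using x by (auto simp: S_def)
        then have "x \<notin> B" "x \<in> {a..b} \<times> {c..d}" "fst x \<noteq> b" using disj AR Ab by auto
        then have "fst x = a" using x by (auto simp: T_def)
        with \<open>x \<in> {a..b} \<times> {c..d}\<close> show ?thesis by (auto simp: L_def)
      qed
    qed
    show "L \<subseteq> S \<inter> T" by (auto simp: S_def T_def L_def)
  qed
  moreover have "connected L" unfolding L_def by (intro convex_connected convex_Times) auto
  ultimately have con: "connected (S \<inter> T)" by simp
  have conv: "connected_component Y u v" if "X \<subseteq> Y" "convex X" "u \<in> X" "v \<in> X" for X Y and u v :: "real \<times> real"
    unfolding connected_component_def using that convex_connected by blast
  have U: "connected_component Y p q" if e: "a < e" "e \<le> b"
    and Y: "{min e ((a+b)/2)..max e ((a+b)/2)} \<times> {d + 1/2} \<subseteq> Y" "{e} \<times> {c - 1/2..d + 1/2} \<subseteq> Y"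
      "{min e ((a+b)/2)..max e ((a+b)/2)} \<times> {c - 1/2} \<subseteq> Y" for e Y
  proof -
    have "connected_component Y p (e, d + 1/2)"
      by (rule conv[OF Y(1)]) (auto simp: p_def min_def intro!: convex_Times)
    moreover have "connected_component Y (e, d + 1/2) (e, c - 1/2)"
      using ab by (intro conv[OF Y(2)]) (auto intro!: convex_Times)
    moreover have "connected_component Y (e, c - 1/2) q"
      by (rule conv[OF Y(3)]) (auto simp: q_def min_def intro!: convex_Times)
    ultimately show ?thesis by (meson connected_component_trans)
  qed
  \<comment> \<open>Go along the right side, which \<open>A\<close> does not touch.\<close>
  have ccS: "connected_component (- S) p q"
    using ab AR Ab by (intro U[of b]) (fastforce simp: S_def L_def)+
  \<comment> \<open>\<open>B\<close> is compact and misses the left side, so some vertical line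
    inside the rectangle passes to the left of \<open>B\<close> and joins \<open>p\<close> to
    \<open>q\<close> off \<open>T\<close>.\<close>
  obtain e where e: "a < e" "e < b" "\<And>x. x \<in> B \<Longrightarrow> e < fst x"
  proof (cases "B = {}")
    case True then show ?thesis using that[of "(a+b)/2"] ab by auto
  next
    case False
    obtain x0 where x0: "x0 \<in> B" "\<And>x. x \<in> B \<Longrightarrow> fst x0 \<le> fst x"
      using continuous_attains_inf[OF comp(2) False continuous_on_fst[OF continuous_on_id]] by blast
    have "a < fst x0" "fst x0 \<le> b" using Ba[OF x0(1)] AR[of x0] x0(1) by auto
    then show ?thesis using that[of "(a + fst x0) / 2"] x0(2) by fastforce
  qed
  have ccT: "connected_component (- T) p q"
    using ab AR e by (intro U[of e]) (fastforce simp: T_def min_def max_def split: if_splits)+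
  have "connected_component (- (S \<union> T)) p q"
    by (rule Janiszewski_prod[OF S T con ccS ccT])
  then have "path_component (- (S \<union> T)) p q"
    using open_path_connected_component[of "- (S \<union> T)"] S T
    by (simp only: open_Compl closed_Un compact_imp_closed)
  then have "path_component (- ?K \<inter> ({a..b} \<times> UNIV)) p q"
    by (rule path_component_of_subset[rotated]) (auto simp: S_def T_def AB[symmetric])
  from vcrossI_slab[OF path_component_sym[OF this]] show ?thesis
    using ab by (auto simp: p_def q_def)
qed

section \<open>Locally finite configurations of discs\<close>

text \<open>Discs whose bounding squares meet the rectangle. Squares make the section at a fixed
  radius a rectangle of explicit area, and every disc that meets the rectangle is still
  included.\<close>

definition reach :: "real \<Rightarrow> real \<Rightarrow> real \<Rightarrow> real \<Rightarrow> ((real \<times> real) \<times> real) set" where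
  "reach a b c d = {p. a - snd p \<le> fst (fst p) \<and> fst (fst p) \<le> b + snd p \<and>
     c - snd p \<le> snd (fst p) \<and> snd (fst p) \<le> d + snd p}"

lemma in_reachI:
  assumes "y \<in> cball (fst p) (snd p)" "y \<in> {a..b} \<times> {c..d}"
  shows "p \<in> reach a b c d"
proof -
  have "\<bar>fst (fst p) - fst y\<bar> \<le> snd p" "\<bar>snd (fst p) - snd y\<bar> \<le> snd p"
    using assms(1) dist_fst_le[of "fst p" y] dist_snd_le[of "fst p" y] by (auto simp: dist_real_def)
  then show ?thesis using assms(2) by (auto simp: reach_def mem_Times_iff)
qed

lemma reach_mono: "a' \<le> a \<Longrightarrow> b \<le> b' \<Longrightarrow> c' \<le> c \<Longrightarrow> d \<le> d' \<Longrightarrow> reach a b c d \<subseteq> reach a' b' c' d'"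
  by (auto simp: reach_def)

definition locally_finite :: "config \<Rightarrow> bool" where
  "locally_finite \<omega> \<longleftrightarrow> (\<forall>n::nat. finite (\<omega> \<inter> reach (- real n) n (- real n) n))"

lemma locally_finite_reach:
  assumes "locally_finite \<omega>" shows "finite (\<omega> \<inter> reach a b c d)"
proof -
  obtain n :: nat where n: "max (max \<bar>a\<bar> \<bar>b\<bar>) (max \<bar>c\<bar> \<bar>d\<bar>) \<le> n"
    using real_arch_simple by blast
  then have "\<omega> \<inter> reach a b c d \<subseteq> \<omega> \<inter> reach (- real n) n (- real n) n"
    by (intro Int_mono reach_mono order_refl) auto
  then show ?thesis using assms finite_subset unfolding locally_finite_def by blast
qed

lemma locally_finite_mono: "locally_finite \<omega> \<Longrightarrow> \<eta> \<subseteq> \<omega> \<Longrightarrow> locally_finite \<eta>"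
  unfolding locally_finite_def by (meson Int_mono finite_subset order_refl)

lemma locally_finite_Un: "locally_finite \<omega> \<Longrightarrow> locally_finite \<eta> \<Longrightarrow> locally_finite (\<omega> \<union> \<eta>)"
  unfolding locally_finite_def by (simp add: Int_Un_distrib2)

lemma occupied_eq: "occupied \<omega> = (\<Union>p\<in>\<omega>. cball (fst p) (snd p))"
  unfolding occupied_def by (auto simp: case_prod_beta)

lemma occupied_mono: "\<omega> \<subseteq> \<eta> \<Longrightarrow> occupied \<omega> \<subseteq> occupied \<eta>"
  unfolding occupied_eq by blast

lemma occupied_local:
  assumes "K \<subseteq> {a..b} \<times> {c..d}"
  shows "occupied \<omega> \<inter> K = occupied (\<omega> \<inter> reach a b c d) \<inter> K"
  unfolding occupied_eq using in_reachI assms by fast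

lemma closed_occupied:
  assumes "locally_finite \<omega>" shows "closed (occupied \<omega>)"
proof -
  have "\<exists>e>0. ball x e \<subseteq> - occupied \<omega>" if x: "x \<in> - occupied \<omega>" for x
  proof -
    let ?B = "{fst x - 1..fst x + 1} \<times> {snd x - 1..snd x + 1}"
    let ?F = "\<omega> \<inter> reach (fst x - 1) (fst x + 1) (snd x - 1) (snd x + 1)"
    have "closed (occupied ?F)"
      unfolding occupied_eq using locally_finite_reach[OF assms] by (intro closed_UN) auto
    moreover have "x \<notin> occupied ?F" using x occupied_mono[of ?F \<omega>] by blast
    ultimately obtain e where e: "e > 0" "ball x e \<subseteq> - occupied ?F"
      by (metis ComplI open_Compl openE)
    have "ball x (min e 1) \<subseteq> ?B"
    proof
      fix y assume "y \<in> ball x (min e 1)"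
      then have "\<bar>fst x - fst y\<bar> < 1" "\<bar>snd x - snd y\<bar> < 1"
        using dist_fst_le[of x y] dist_snd_le[of x y] by (auto simp: dist_real_def)
      then show "y \<in> ?B" by (auto simp: mem_Times_iff)
    qed
    then have "ball x (min e 1) \<inter> occupied \<omega> = {}"
      using occupied_local[of "ball x (min e 1)" _ _ _ _ \<omega>] e(2) by fastforce
    then show ?thesis using e(1) by (intro exI[of _ "min e 1"]) auto
  qed
  then have "open (- occupied \<omega>)" by (auto simp: open_contains_ball)
  then show ?thesis by (simp add: open_closed)
qed

lemma bounded_subset_square:
  fixes K :: "(real \<times> real) set"
  assumes "bounded K"
  obtains N where "K \<subseteq> {-N..N} \<times> {-N..N}"
proof -
  obtain N where N: "\<And>x. x \<in> K \<Longrightarrow> norm x \<le> N"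
    using assms by (auto simp: bounded_iff)
  have "x \<in> {-N..N} \<times> {-N..N}" if "x \<in> K" for x
    using N[OF that] norm_fst_le[of "fst x" "snd x"] norm_snd_le[of "snd x" "fst x"]
    by (auto simp: mem_Times_iff)
  with that show ?thesis by blast
qed

section \<open>Connections under enlarged radii\<close>

definition inflate :: "real \<Rightarrow> config \<Rightarrow> config" where
  "inflate \<delta> \<omega> = (\<lambda>p. (fst p, snd p + \<delta>)) ` \<omega>"

lemma occupied_inflate: "occupied (inflate \<delta> \<omega>) = (\<Union>p\<in>\<omega>. cball (fst p) (snd p + \<delta>))"
  unfolding occupied_eq inflate_def by auto

lemma occupied_inflate_local:
  assumes "K \<subseteq> {a..b} \<times> {c..d}" "\<delta> \<le> 1"
  shows "occupied (inflate \<delta> \<omega>) \<inter> K = (\<Union>p\<in>\<omega> \<inter> reach (a - 1) (b + 1) (c - 1) (d + 1). cball (fst p) (snd p + \<delta>) \<inter> K)"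
proof -
  have "p \<in> reach (a - 1) (b + 1) (c - 1) (d + 1)"
    if "y \<in> cball (fst p) (snd p + \<delta>)" "y \<in> K" for y p
    using in_reachI[of y "(fst p, snd p + \<delta>)" a b c d] that assms by (auto simp: reach_def)
  then show ?thesis unfolding occupied_inflate by blast
qed

text \<open>Common form of crossings and of connections from the origin to a sphere, so that
  measurability is proved once.\<close>

definition connects :: "(real \<times> real) set \<Rightarrow> (real \<times> real) set \<Rightarrow> (real \<times> real) set \<Rightarrow> (real \<times> real) set \<Rightarrow> bool" where
  "connects K A B C \<longleftrightarrow> (\<exists>p\<in>A. \<exists>q\<in>B. path_component (C \<inter> K) p q)"

lemma connects_mono: "connects K A B C \<Longrightarrow> C \<inter> K \<subseteq> D \<Longrightarrow> connects K A B D"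
  unfolding connects_def by (meson Int_greatest inf_le2 path_component_of_subset)

lemma finite_uniform_pos:
  fixes P :: "'a \<Rightarrow> real \<Rightarrow> bool"
  assumes "finite G" "\<And>g. g \<in> G \<Longrightarrow> \<exists>e>0. P g e"
    and anti: "\<And>g e e'. P g e \<Longrightarrow> 0 < e' \<Longrightarrow> e' \<le> e \<Longrightarrow> P g e'"
  shows "\<exists>e>0. \<forall>g\<in>G. P g e"
  using assms(1,2)
proof (induction G)
  case (insert x G)
  obtain e1 e2 where "e1 > 0" "\<forall>g\<in>G. P g e1" "e2 > 0" "P x e2" using insert by blast
  then show ?case using anti[of _ e1 "min e1 e2"] anti[of x e2 "min e1 e2"]
    by (intro exI[of _ "min e1 e2"]) auto
qed (auto intro: exI[of _ 1])

lemma compact_pos_gap: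
  fixes f :: "'a::topological_space \<Rightarrow> real"
  assumes "compact X" "continuous_on X f" "\<And>x. x \<in> X \<Longrightarrow> 0 < f x"
  shows "\<exists>e>0. \<forall>x\<in>X. e < f x"
proof (cases "X = {}")
  case False
  obtain x where "x \<in> X" "\<And>y. y \<in> X \<Longrightarrow> f x \<le> f y"
    using continuous_attains_inf[OF assms(1) False assms(2)] by blast
  then show ?thesis using assms(3)[of x] by (intro exI[of _ "f x / 2"]) fastforce
qed (auto intro: exI[of _ 1])

text \<open>Finitely many discs are relevant in \<open>K\<close>. By compactness, two of them that
  are disjoint within \<open>K\<close> stay so under a small inflation, and likewise for a disc and
  \<open>A\<close> or \<open>B\<close>. For some \<open>e > 0\<close> the intersection graph is thus
  the original one, and a chain of inflated discs is a chain of discs. Convexity of \<open>K\<close>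
  keeps the discs cut to \<open>K\<close> convex.\<close>

lemma connects_inflate_limit:
  assumes lf: "locally_finite \<omega>" and K: "compact K" "convex K" and AB: "closed A" "closed B"
    and con: "\<And>\<delta>. \<delta> > 0 \<Longrightarrow> connects K A B (occupied (inflate \<delta> \<omega>))"
  shows "connects K A B (occupied \<omega>)"
proof -
  obtain N where KN: "K \<subseteq> {-N..N} \<times> {-N..N}"
    using bounded_subset_square compact_imp_bounded K(1) by blast
  define F where "F = \<omega> \<inter> reach (- N - 1) (N + 1) (- N - 1) (N + 1)"
  have F: "finite F" unfolding F_def by (rule locally_finite_reach[OF lf])
  define C where "C = (\<lambda>\<delta> p. cball (fst p) (snd p + \<delta>) \<inter> K)"
  have Cmono: "C e p \<subseteq> C e' p" if "e \<le> e'" for e e' p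
    unfolding C_def using that by auto
  have comp: "compact (C \<delta> p)" "convex (C \<delta> p)" for \<delta> p
    unfolding C_def using K by (auto intro: convex_Int closed_Int_compact)
  have gapAB: "\<exists>e>0. C e i \<inter> X \<noteq> {} \<longrightarrow> C 0 i \<inter> X \<noteq> {}" if "closed X" for i X
  proof (cases "C 0 i \<inter> X = {}")
    case True
    have "0 < dist (fst i) y - snd i" if "y \<in> K \<inter> X" for y
    proof (rule ccontr)
      assume "\<not> ?thesis"
      with that have "y \<in> C 0 i \<inter> X" unfolding C_def by (simp add: not_less)
      with True show False by blast
    qed
    then have "\<exists>e>0. \<forall>y\<in>K \<inter> X. e < dist (fst i) y - snd i"
      by (intro compact_pos_gap compact_Int_closed K(1) \<open>closed X\<close> continuous_intros)
    then obtain e where "e > 0" "\<And>y. y \<in> K \<inter> X \<Longrightarrow> e < dist (fst i) y - snd i" by blast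
    then have "C e i \<inter> X = {}" unfolding C_def by force
    with \<open>e > 0\<close> show ?thesis by blast
  qed (auto intro: exI[of _ 1])
  have gap2: "\<exists>e>0. C e i \<inter> C e j \<noteq> {} \<longrightarrow> C 0 i \<inter> C 0 j \<noteq> {}" for i j
  proof (cases "C 0 i \<inter> C 0 j = {}")
    case True
    let ?f = "\<lambda>y. max (dist (fst i) y - snd i) (dist (fst j) y - snd j)"
    have "0 < ?f y" if "y \<in> K" for y
    proof (rule ccontr)
      assume "\<not> ?thesis"
      with that have "y \<in> C 0 i \<inter> C 0 j" unfolding C_def by (simp add: not_less)
      with True show False by blast
    qed
    then have "\<exists>e>0. \<forall>y\<in>K. e < ?f y"
      by (intro compact_pos_gap K(1) continuous_intros)
    then obtain e where "e > 0" "\<And>y. y \<in> K \<Longrightarrow> e < ?f y" by blast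
    then have "C e i \<inter> C e j = {}" unfolding C_def by (force simp: less_max_iff_disj)
    with \<open>e > 0\<close> show ?thesis by blast
  qed (auto intro: exI[of _ 1])
  have "\<exists>e>0. \<forall>p\<in>F \<times> F. C e (fst p) \<inter> C e (snd p) \<noteq> {} \<longrightarrow> C 0 (fst p) \<inter> C 0 (snd p) \<noteq> {}"
    by (rule finite_uniform_pos) (use F gap2 Cmono in \<open>blast+\<close>)
  then obtain e1 where e1: "e1 > 0" "\<And>i j. i \<in> F \<Longrightarrow> j \<in> F \<Longrightarrow> C e1 i \<inter> C e1 j \<noteq> {} \<Longrightarrow> C 0 i \<inter> C 0 j \<noteq> {}"
    by fastforce
  have "\<exists>e>0. \<forall>i\<in>F. C e i \<inter> X \<noteq> {} \<longrightarrow> C 0 i \<inter> X \<noteq> {}" if "closed X" for X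
    by (rule finite_uniform_pos) (use F gapAB[OF that] Cmono in \<open>blast+\<close>)
  from this[OF AB(1)] this[OF AB(2)]
  obtain e2 e3 where e2: "e2 > 0" "\<And>i. i \<in> F \<Longrightarrow> C e2 i \<inter> A \<noteq> {} \<Longrightarrow> C 0 i \<inter> A \<noteq> {}"
    and e3: "e3 > 0" "\<And>i. i \<in> F \<Longrightarrow> C e3 i \<inter> B \<noteq> {} \<Longrightarrow> C 0 i \<inter> B \<noteq> {}" by blast
  define e where "e = min (min e1 e2) (min e3 1)"
  have e: "e > 0" "e \<le> 1" "e \<le> e1" "e \<le> e2" "e \<le> e3" unfolding e_def using e1 e2 e3 by auto
  have eq: "occupied (inflate e \<omega>) \<inter> K = (\<Union>p\<in>F. C e p)"
    unfolding F_def C_def using occupied_inflate_local[OF KN e(2), of \<omega>] by simp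
  have eq0: "(\<Union>p\<in>F. C 0 p) \<subseteq> occupied \<omega> \<inter> K"
    unfolding F_def C_def occupied_eq by auto
  obtain p q where pq: "p \<in> A" "q \<in> B" "path_component (\<Union>p\<in>F. C e p) p q"
    using con[OF e(1)] unfolding connects_def eq by blast
  then obtain g where g: "path g" "path_image g \<subseteq> (\<Union>p\<in>F. C e p)" "pathstart g = p" "pathfinish g = q"
    unfolding path_component_def by blast
  have pg: "p \<in> path_image g" "q \<in> path_image g" using g by auto
  then obtain i j where ij: "i \<in> F" "p \<in> C e i" "j \<in> F" "q \<in> C e j" using g(2) by blast
  have chain: "(i, j) \<in> (meet_rel F (C e))\<^sup>*"
    using compact_imp_closed[OF comp(1)] g(2) pg ij
    by (intro meet_rel_of_connected[OF F _ connected_path_image[OF g(1)]]) auto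
  have "meet_rel F (C e) \<subseteq> meet_rel F (C 0)"
    unfolding meet_rel_def using e1(2) Cmono[OF e(3)] by blast
  then have chain0: "(i, j) \<in> (meet_rel F (C 0))\<^sup>*" using chain rtrancl_mono by blast
  have "C e2 i \<inter> A \<noteq> {}" "C e3 j \<inter> B \<noteq> {}" using ij pq Cmono e by blast+
  with ij e2(2) e3(2) obtain p' q' where p'q': "p' \<in> C 0 i" "p' \<in> A" "q' \<in> C 0 j" "q' \<in> B" by blast
  have "path_component (\<Union>p\<in>F. C 0 p) p' q'"
    using comp p'q' ij by (intro path_component_of_meet_rel[OF chain0]) auto
  then have "path_component (occupied \<omega> \<inter> K) p' q'" using eq0 path_component_of_subset by blast
  with p'q' show ?thesis unfolding connects_def by blast
qed

text \<open>A vacant path is compact and only finitely many discs come near it, so it keeps a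
  positive distance from all of them.\<close>

lemma vacant_inflate:
  assumes lf: "locally_finite \<omega>" and K: "compact K" and con: "connects K A B (vacant \<omega>)"
  shows "\<exists>\<delta>>0. connects K A B (vacant (inflate \<delta> \<omega>))"
proof -
  obtain N where KN: "K \<subseteq> {-N..N} \<times> {-N..N}"
    using bounded_subset_square compact_imp_bounded K by blast
  obtain p q where pq: "p \<in> A" "q \<in> B" "path_component (vacant \<omega> \<inter> K) p q"
    using con unfolding connects_def by blast
  then obtain g where g: "path g" "path_image g \<subseteq> vacant \<omega> \<inter> K" "pathstart g = p" "pathfinish g = q"
    unfolding path_component_def by blast
  define F where "F = \<omega> \<inter> reach (- N - 1) (N + 1) (- N - 1) (N + 1)"
  have F: "finite F" unfolding F_def by (rule locally_finite_reach[OF lf])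
  have "\<exists>e>0. \<forall>i\<in>F. \<forall>y\<in>path_image g. e < dist (fst i) y - snd i"
  proof (rule finite_uniform_pos[OF F])
    fix i assume "i \<in> F"
    then show "\<exists>e>0. \<forall>y\<in>path_image g. e < dist (fst i) y - snd i"
      using g(2) compact_path_image[OF g(1)]
      by (intro compact_pos_gap continuous_intros) (fastforce simp: F_def vacant_def occupied_eq)+
  qed force
  then obtain e where e: "e > 0" "\<And>i y. i \<in> F \<Longrightarrow> y \<in> path_image g \<Longrightarrow> snd i + e < dist (fst i) y"
    by (metis less_diff_eq add.commute)
  have "path_image g \<subseteq> {-N..N} \<times> {-N..N}" using g(2) KN by blast
  from occupied_inflate_local[OF this, of "min e 1" \<omega>]
  have "occupied (inflate (min e 1) \<omega>) \<inter> path_image g = (\<Union>p\<in>F. cball (fst p) (snd p + min e 1) \<inter> path_image g)"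
    unfolding F_def by simp
  also have "\<dots> = {}"
  proof -
    have "y \<notin> cball (fst p) (snd p + min e 1)" if "p \<in> F" "y \<in> path_image g" for p y
      using e(2)[OF that] by auto
    then show ?thesis by blast
  qed
  finally have "occupied (inflate (min e 1) \<omega>) \<inter> path_image g = {}" .
  then have "path_image g \<subseteq> vacant (inflate (min e 1) \<omega>) \<inter> K" using g(2) by (auto simp: vacant_def)
  then have "connects K A B (vacant (inflate (min e 1) \<omega>))"
    unfolding connects_def path_component_def using g pq by blast
  then show ?thesis using e(1) by (intro exI[of _ "min e 1"]) auto
qed

definition unbounded_from :: "(real \<times> real) set \<Rightarrow> real \<times> real \<Rightarrow> bool" where
  "unbounded_from C x \<longleftrightarrow> (\<forall>R. \<exists>q. path_component C x q \<and> R \<le> dist x q)"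

text \<open>Cutting a path when it reaches norm \<open>n\<close> confines it to a compact ball and
  leaves countably many conditions, as measurability requires. The form
  \<open>unbounded_from\<close> makes sense at every starting point, as translation
  requires.\<close>

lemma origin_to_infinity_characterizations:
  shows origin_to_infinity_iff_connects:
      "origin_to_infinity C \<longleftrightarrow> (\<forall>n::nat. connects (cball 0 n) {0} (sphere 0 n) C)"
    and origin_to_infinity_iff_unbounded_from: "origin_to_infinity C \<longleftrightarrow> unbounded_from C 0"
proof -
  have slab: "\<exists>q'. norm q' = r \<and> path_component (C \<inter> cball 0 r) 0 q'"
    if q: "path_component C 0 q" and r: "0 \<le> r" "r \<le> norm q" for q r
  proof -
    have "norm (0 :: real \<times> real) \<le> 0" by simp
    from path_component_slab[OF q continuous_on_norm_id this r]
    obtain p' q' where "norm p' = 0" "norm q' = r"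
      "path_component (C \<inter> {x. 0 \<le> norm x \<and> norm x \<le> r}) p' q'"
      by blast
    moreover have "{x. 0 \<le> norm x \<and> norm x \<le> r} = cball (0 :: real \<times> real) r" by auto
    ultimately have "norm q' = r" "path_component (C \<inter> cball 0 r) 0 q'" by simp_all
    then show ?thesis by blast
  qed
  have 1: "unbounded_from C 0" if C: "origin_to_infinity C" unfolding unbounded_from_def
  proof
    fix R
    obtain \<gamma> where "path \<gamma>" "path_image \<gamma> \<subseteq> C" "pathstart \<gamma> = 0" "dist 0 (pathfinish \<gamma>) = max R 1"
      using C unfolding origin_to_infinity_def by (meson max.cobounded2)
    then show "\<exists>q. path_component C 0 q \<and> R \<le> dist 0 q"
      unfolding path_component_def by (intro exI[of _ "pathfinish \<gamma>"]) auto
  qed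
  have 2: "\<forall>n::nat. connects (cball 0 n) {0} (sphere 0 n) C" if "unbounded_from C 0"
  proof
    fix n :: nat
    obtain q where "path_component C 0 q" "n \<le> norm q"
      using \<open>unbounded_from C 0\<close> unfolding unbounded_from_def by (metis dist_0_norm)
    from slab[OF this(1) of_nat_0_le_iff this(2)] show "connects (cball 0 n) {0} (sphere 0 n) C"
      unfolding connects_def by auto
  qed
  have 3: "origin_to_infinity C" if C: "\<forall>n::nat. connects (cball 0 n) {0} (sphere 0 n) C"
    unfolding origin_to_infinity_def
  proof (intro allI impI)
    fix r :: real assume "1 \<le> r"
    obtain n :: nat where n: "r \<le> n" using real_arch_simple by blast
    obtain q where q: "q \<in> sphere 0 (real n)" "path_component (C \<inter> cball 0 n) 0 q"
      using C unfolding connects_def by blast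
    have "path_component C 0 q" "0 \<le> r" "r \<le> norm q"
      using path_component_of_subset[OF Int_lower1 q(2)] q(1) n \<open>1 \<le> r\<close> by auto
    from slab[OF this] obtain q' \<gamma> where "norm q' = r" "path \<gamma>" "path_image \<gamma> \<subseteq> C \<inter> cball 0 r"
      "pathstart \<gamma> = 0" "pathfinish \<gamma> = q'" unfolding path_component_def by blast
    then show "\<exists>\<gamma>. path \<gamma> \<and> path_image \<gamma> \<subseteq> C \<and> pathstart \<gamma> = 0 \<and> dist 0 (pathfinish \<gamma>) = r"
      by (intro exI[of _ \<gamma>]) auto
  qed
  show "origin_to_infinity C \<longleftrightarrow> (\<forall>n::nat. connects (cball 0 n) {0} (sphere 0 n) C)"
    "origin_to_infinity C \<longleftrightarrow> unbounded_from C 0"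
    using 1 2 3 by blast+
qed

section \<open>Laws determined by void probabilities\<close>

lemma borel_measurable_half_line:
  assumes "sets M = sets (restrict_space borel {0::real..})"
  shows "(\<lambda>x. x) \<in> measurable M borel"
  using measurable_restrict_space1[OF measurable_id, of borel "{0::real..}"]
  by (subst measurable_cong_sets[OF assms refl]) (simp add: id_def)

definition lf_configs :: "config set" where
  "lf_configs = {\<omega>. \<omega> \<subseteq> UNIV \<times> {0..} \<and> locally_finite \<omega>}"

lemma lf_configs_mono: "\<omega> \<in> lf_configs \<Longrightarrow> \<eta> \<subseteq> \<omega> \<Longrightarrow> \<eta> \<in> lf_configs"
  unfolding lf_configs_def using locally_finite_mono by auto

lemma lf_configs_Un: "\<omega> \<in> lf_configs \<Longrightarrow> \<eta> \<in> lf_configs \<Longrightarrow> \<omega> \<union> \<eta> \<in> lf_configs"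
  unfolding lf_configs_def using locally_finite_Un by auto

lemma empty_in_lf_configs [simp]: "{} \<in> lf_configs"
  by (simp add: lf_configs_def locally_finite_def)

locale boolean_model =
  fixes \<mu> :: "real measure"
  assumes prob_space_\<mu>: "prob_space \<mu>"
    and sets_\<mu>: "sets \<mu> = sets (restrict_space borel {0..})"
    and second_moment: "integrable \<mu> (\<lambda>x. x\<^sup>2)"
begin

definition E :: "((real \<times> real) \<times> real) measure" where
  "E = lborel \<Otimes>\<^sub>M \<mu>"

lemma space_\<mu>: "space \<mu> = {0..}"
  using sets_eq_imp_space_eq[OF sets_\<mu>] by (simp add: space_restrict_space)

lemma space_E: "space E = UNIV \<times> {0..}"
  by (simp add: E_def space_pair_measure space_\<mu>)

lemma measurable_\<mu>: "(\<lambda>x. x) \<in> measurable \<mu> borel"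
  by (rule borel_measurable_half_line[OF sets_\<mu>])

lemma measurable_fst_E [measurable]: "fst \<in> measurable E borel"
  unfolding E_def by measurable

lemma measurable_snd_E [measurable]: "snd \<in> measurable E borel"
  unfolding E_def by (rule measurable_compose[OF measurable_snd measurable_\<mu>])

lemma measurable_coord_E [measurable]:
  "(\<lambda>p. fst (fst p)) \<in> borel_measurable E" "(\<lambda>p. snd (fst p)) \<in> borel_measurable E"
  by (rule measurable_compose[OF measurable_fst_E], rule borel_measurable_continuous_onI,
      intro continuous_intros)+

lemma measurable_E_borel: "(\<lambda>p. p) \<in> measurable E borel"
proof -
  have "(\<lambda>p. (fst p, snd p)) \<in> measurable E (borel \<Otimes>\<^sub>M borel)" by measurable
  then show ?thesis by (simp add: borel_prod)
qed

lemma pair_sigma_finite_E: "pair_sigma_finite (lborel :: (real \<times> real) measure) \<mu>"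
  using prob_space_imp_sigma_finite[OF prob_space_\<mu>] lborel.sigma_finite_measure_axioms
  by (simp add: pair_sigma_finite_def)

lemma emeasure_lborel_square:
  assumes "a \<le> b" "c \<le> d"
  shows "emeasure lborel ({a..b} \<times> {c..d} :: (real \<times> real) set) = ennreal ((b - a) * (d - c))"
  using assms by (simp add: lborel_prod[symmetric] lborel.emeasure_pair_measure_Times ennreal_mult)

section \<open>Intensity of the discs that reach a rectangle\<close>

definition tall :: "real \<Rightarrow> ((real \<times> real) \<times> real) set" where
  "tall s = {p. s < snd p}"

lemma sets_reach [measurable]: "reach a b c d \<inter> space E \<in> sets E"
proof -
  have "{p \<in> space E. a - snd p \<le> fst (fst p) \<and> fst (fst p) \<le> b + snd p \<and>
     c - snd p \<le> snd (fst p) \<and> snd (fst p) \<le> d + snd p} \<in> sets E"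
    by measurable
  moreover have "{p \<in> space E. a - snd p \<le> fst (fst p) \<and> fst (fst p) \<le> b + snd p \<and>
     c - snd p \<le> snd (fst p) \<and> snd (fst p) \<le> d + snd p} = reach a b c d \<inter> space E"
    by (auto simp: reach_def)
  ultimately show ?thesis by simp
qed

lemma sets_tall [measurable]: "tall s \<inter> space E \<in> sets E"
proof -
  have "{p \<in> space E. s < snd p} \<in> sets E" by measurable
  moreover have "{p \<in> space E. s < snd p} = tall s \<inter> space E" by (auto simp: tall_def)
  ultimately show ?thesis by simp
qed

lemma sets_reach_tall [measurable]: "reach a b c d \<inter> tall s \<inter> space E \<in> sets E"
  using sets.Int[OF sets_reach[of a b c d] sets_tall[of s]] by (simp add: Int_ac)

text \<open>Fubini: the section at radius \<open>z\<close> is the rectangle enlarged by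
  \<open>z\<close> on every side.\<close>

lemma emeasure_reach_tall:
  assumes "a \<le> b" "c \<le> d"
  shows "emeasure E (reach a b c d \<inter> tall s \<inter> space E) =
    (\<integral>\<^sup>+z. indicator {s<..} z * ennreal ((b - a + 2 * z) * (d - c + 2 * z)) \<partial>\<mu>)"
proof -
  interpret pair_sigma_finite "lborel :: (real \<times> real) measure" \<mu> by (rule pair_sigma_finite_E)
  have "emeasure E (reach a b c d \<inter> tall s \<inter> space E) =
    (\<integral>\<^sup>+z. emeasure lborel ((\<lambda>x. (x, z)) -` (reach a b c d \<inter> tall s \<inter> space E)) \<partial>\<mu>)"
    using sets_reach_tall[of a b c d s] unfolding E_def by (rule emeasure_pair_measure_alt2)
  also have "\<dots> = (\<integral>\<^sup>+z. indicator {s<..} z * ennreal ((b - a + 2 * z) * (d - c + 2 * z)) \<partial>\<mu>)"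
  proof (rule nn_integral_cong)
    fix z assume "z \<in> space \<mu>"
    then have z: "0 \<le> z" by (simp add: space_\<mu>)
    have "(\<lambda>x. (x, z)) -` (reach a b c d \<inter> tall s \<inter> space E) =
      (if s < z then {a - z..b + z} \<times> {c - z..d + z} else {})"
      using z by (auto simp: reach_def tall_def space_E)
    moreover have "emeasure lborel ({a - z..b + z} \<times> {c - z..d + z}) = ennreal ((b - a + 2 * z) * (d - c + 2 * z))"
      using assms z by (subst emeasure_lborel_square) (auto simp: algebra_simps)
    ultimately show "emeasure lborel ((\<lambda>x. (x, z)) -` (reach a b c d \<inter> tall s \<inter> space E)) =
       indicator {s<..} z * ennreal ((b - a + 2 * z) * (d - c + 2 * z))"
      by (auto simp: indicator_def)
  qed
  finally show ?thesis .
qed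

definition tail :: "real \<Rightarrow> real" where
  "tail s = (LINT z|\<mu>. indicator {s<..} z * z\<^sup>2)"

lemma integrable_tail: "integrable \<mu> (\<lambda>z. indicator {s<..} z * z\<^sup>2 :: real)"
proof (rule Bochner_Integration.integrable_bound[OF second_moment])
  show "(\<lambda>z. indicator {s<..} z * z\<^sup>2 :: real) \<in> borel_measurable \<mu>"
    by (rule measurable_compose[OF measurable_\<mu>]) measurable
qed (auto simp: indicator_def)

lemma tail_nonneg: "0 \<le> tail s"
  unfolding tail_def by (intro integral_nonneg_AE) auto

lemma nn_integral_tail: "(\<integral>\<^sup>+z. indicator {s<..} z * ennreal (z\<^sup>2) \<partial>\<mu>) = ennreal (tail s)"
proof -
  have "(\<integral>\<^sup>+z. indicator {s<..} z * ennreal (z\<^sup>2) \<partial>\<mu>) = (\<integral>\<^sup>+z. ennreal (indicator {s<..} z * z\<^sup>2) \<partial>\<mu>)"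
    by (intro nn_integral_cong) (auto simp: indicator_def)
  then show ?thesis
    unfolding tail_def using nn_integral_eq_integral[OF integrable_tail[of s]] by simp
qed

text \<open>For a radius \<open>z > s\<close> sides of length at most \<open>k * s\<close> are at
  most \<open>k * z\<close>, so the enlarged sides are at most \<open>(k + 2) * z\<close> and the
  area is a multiple of \<open>z\<^sup>2\<close>.\<close>

lemma measure_reach_tall_le:
  assumes ab: "a \<le> b" "c \<le> d" and s: "0 < s" and k: "b - a \<le> k * s" "d - c \<le> k * s"
  shows "emeasure E (reach a b c d \<inter> tall s \<inter> space E) \<le> ennreal ((k + 2)\<^sup>2 * tail s)"
proof -
  have k0: "0 \<le> k" using ab s k by (smt (verit, best) mult_neg_pos)
  have "emeasure E (reach a b c d \<inter> tall s \<inter> space E) \<le>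
     (\<integral>\<^sup>+z. ennreal ((k + 2)\<^sup>2) * (indicator {s<..} z * ennreal (z\<^sup>2)) \<partial>\<mu>)"
    unfolding emeasure_reach_tall[OF ab]
  proof (rule nn_integral_mono)
    fix z assume "z \<in> space \<mu>"
    show "indicator {s<..} z * ennreal ((b - a + 2 * z) * (d - c + 2 * z)) \<le>
      ennreal ((k + 2)\<^sup>2) * (indicator {s<..} z * ennreal (z\<^sup>2))"
    proof (cases "s < z")
      case True
      then have "k * s \<le> k * z" using k0 by (intro mult_left_mono) auto
      then have "b - a + 2 * z \<le> (k + 2) * z" "d - c + 2 * z \<le> (k + 2) * z" using k by (auto simp: algebra_simps)
      then have "(b - a + 2 * z) * (d - c + 2 * z) \<le> ((k + 2) * z) * ((k + 2) * z)"
        using ab True s by (intro mult_mono) auto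
      then show ?thesis using True by (simp add: ennreal_mult[symmetric] power2_eq_square ac_simps ennreal_leI)
    qed simp
  qed
  also have "\<dots> = ennreal ((k + 2)\<^sup>2) * (\<integral>\<^sup>+z. indicator {s<..} z * ennreal (z\<^sup>2) \<partial>\<mu>)"
    by (rule nn_integral_cmult, rule measurable_compose[OF measurable_\<mu>]) measurable
  also have "\<dots> = ennreal ((k + 2)\<^sup>2 * tail s)"
    unfolding nn_integral_tail by (simp add: ennreal_mult' tail_nonneg)
  finally show ?thesis .
qed

text \<open>The second moment enters here, because the enlarged area grows quadratically in the
  radius. Almost sure local finiteness rests on this.\<close>

lemma emeasure_reach_finite: "emeasure E (reach a b c d \<inter> space E) < \<infinity>"
proof -
  define l where "l = max (max \<bar>a\<bar> \<bar>b\<bar>) (max \<bar>c\<bar> \<bar>d\<bar>)"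
  have l: "0 \<le> l" "- l \<le> a" "b \<le> l" "- l \<le> c" "d \<le> l" by (auto simp: l_def)
  \<comment> \<open>All radii are nonnegative, so intersecting with \<open>tall (-1)\<close> keeps
    the set and makes the area formula applicable.\<close>
  have "emeasure E (reach a b c d \<inter> space E) \<le> emeasure E (reach (-l) l (-l) l \<inter> tall (-1) \<inter> space E)"
    using l reach_mono[of "-l" a b l "-l" c d l]
    by (intro emeasure_mono sets_reach_tall) (auto simp: tall_def space_E)
  also have "\<dots> \<le> (\<integral>\<^sup>+z. ennreal (8 * l\<^sup>2 + 8 * z\<^sup>2) \<partial>\<mu>)"
  proof -
    have eq: "emeasure E (reach (-l) l (-l) l \<inter> tall (-1) \<inter> space E) =
      (\<integral>\<^sup>+z. indicator {-1<..} z * ennreal ((l - - l + 2 * z) * (l - - l + 2 * z)) \<partial>\<mu>)"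
      using l by (intro emeasure_reach_tall) auto
    show ?thesis
      unfolding eq
  proof (rule nn_integral_mono)
    fix z
    have "(l - - l + 2 * z) * (l - - l + 2 * z) \<le> 8 * l\<^sup>2 + 8 * z\<^sup>2"
      using sum_squares_bound[of l z] by (simp add: power2_eq_square algebra_simps)
    then show "indicator {-1<..} z * ennreal ((l - - l + 2 * z) * (l - - l + 2 * z)) \<le> ennreal (8 * l\<^sup>2 + 8 * z\<^sup>2)"
      by (auto simp: indicator_def simp del: ennreal_plus intro!: ennreal_leI)
  qed
  qed
  also have "\<dots> = ennreal (LINT z|\<mu>. 8 * l\<^sup>2 + 8 * z\<^sup>2)"
    using second_moment finite_measure.integrable_const[OF prob_space.finite_measure[OF prob_space_\<mu>]]
    by (intro nn_integral_eq_integral Bochner_Integration.integrable_add) auto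
  finally show ?thesis by (rule le_less_trans) simp
qed

lemma emeasure_finite_of_reach: "A \<subseteq> reach a b c d \<Longrightarrow> A \<subseteq> space E \<Longrightarrow> emeasure E A < \<infinity>"
  using emeasure_mono[of A "reach a b c d \<inter> space E" E] emeasure_reach_finite[of a b c d]
  by (meson Int_greatest le_less_trans sets_reach)

section \<open>The sigma-algebra of void events\<close>

text \<open>Avoiding \<open>A\<close> and avoiding \<open>B\<close> means avoiding their union, so
  void events are stable under intersection. Laws need to be compared, and maps tested for
  measurability, on void events only; this is the idea of Renyi's characterisation of simple point
  processes.\<close>

definition V :: "config measure" where
  "V = sigma lf_configs {{\<omega> \<in> lf_configs. \<omega> \<inter> A = {}} | A. A \<in> sets E \<and> emeasure E A < \<infinity>}"

lemma space_V [simp]: "space V = lf_configs"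
  unfolding V_def by (rule space_measure_of) auto

lemma sets_V: "sets V = sigma_sets lf_configs {{\<omega> \<in> lf_configs. \<omega> \<inter> A = {}} | A. A \<in> sets E \<and> emeasure E A < \<infinity>}"
  unfolding V_def by (rule sets_measure_of) auto

lemma void_pred [measurable (raw)]:
  assumes "A \<in> sets E" "emeasure E A < \<infinity>"
  shows "Measurable.pred V (\<lambda>\<omega>. \<omega> \<inter> A = {})"
proof -
  have "{\<omega> \<in> lf_configs. \<omega> \<inter> A = {}} \<in> sets V"
    unfolding sets_V by (rule sigma_sets.Basic) (use assms in blast)
  then show ?thesis by (simp add: pred_def)
qed

lemma measurable_VI:
  assumes "\<And>x. x \<in> space N \<Longrightarrow> f x \<in> lf_configs"
    and "\<And>A. A \<in> sets E \<Longrightarrow> emeasure E A < \<infinity> \<Longrightarrow> {x \<in> space N. f x \<inter> A = {}} \<in> sets N"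
  shows "f \<in> measurable N V"
  unfolding V_def
proof (rule measurable_measure_of)
  show "f \<in> space N \<rightarrow> lf_configs" using assms(1) by auto
  fix y assume "y \<in> {{\<omega> \<in> lf_configs. \<omega> \<inter> A = {}} | A. A \<in> sets E \<and> emeasure E A < \<infinity>}"
  then obtain A where A: "y = {\<omega> \<in> lf_configs. \<omega> \<inter> A = {}}" "A \<in> sets E" "emeasure E A < \<infinity>" by blast
  have "f -` y \<inter> space N = {x \<in> space N. f x \<inter> A = {}}" using assms(1) by (auto simp: A(1))
  with assms(2) A show "f -` y \<inter> space N \<in> sets N" by simp
qed auto

lemma V_measure_eqI:
  assumes N: "prob_space N" "sets N = sets V" and N': "prob_space N'" "sets N' = sets V"
    and eq: "\<And>A. A \<in> sets E \<Longrightarrow> emeasure E A < \<infinity> \<Longrightarrow>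
      measure N {\<omega> \<in> lf_configs. \<omega> \<inter> A = {}} = measure N' {\<omega> \<in> lf_configs. \<omega> \<inter> A = {}}"
  shows "N = N'"
proof (rule measure_eqI_generator_eq)
  let ?G = "{{\<omega> \<in> lf_configs. \<omega> \<inter> A = {}} | A. A \<in> sets E \<and> emeasure E A < \<infinity>}"
  interpret N: prob_space N by fact
  interpret N': prob_space N' by fact
  show "Int_stable ?G"
  proof (rule Int_stableI)
    fix a b assume "a \<in> ?G" "b \<in> ?G"
    then obtain A B where A: "a = {\<omega> \<in> lf_configs. \<omega> \<inter> A = {}}" "A \<in> sets E" "emeasure E A < \<infinity>"
      and B: "b = {\<omega> \<in> lf_configs. \<omega> \<inter> B = {}}" "B \<in> sets E" "emeasure E B < \<infinity>" by blast
    have "a \<inter> b = {\<omega> \<in> lf_configs. \<omega> \<inter> (A \<union> B) = {}}" unfolding A(1) B(1) by blast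
    moreover have "emeasure E (A \<union> B) < \<infinity>"
      using emeasure_subadditive[OF A(2) B(2)] A(3) B(3)
      by (simp add: le_less_trans)
    ultimately show "a \<inter> b \<in> ?G" using A(2) B(2) by blast
  qed
  show "?G \<subseteq> Pow lf_configs" by blast
  fix X assume "X \<in> ?G"
  then show "emeasure N X = emeasure N' X"
    using eq by (auto simp: N.emeasure_eq_measure N'.emeasure_eq_measure)
next
  let ?G = "{{\<omega> \<in> lf_configs. \<omega> \<inter> A = {}} | A. A \<in> sets E \<and> emeasure E A < \<infinity>}"
  show "sets N = sigma_sets lf_configs ?G" "sets N' = sigma_sets lf_configs ?G"
    using N N' sets_V by auto
  have "lf_configs = {\<omega> \<in> lf_configs. \<omega> \<inter> {} = {}} \<and> {} \<in> sets E \<and> emeasure E {} < \<infinity>" by auto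
  then have "lf_configs \<in> ?G" by blast
  then show "range (\<lambda>i::nat. lf_configs) \<subseteq> ?G" by blast
  show "(\<Union>i::nat. lf_configs) = lf_configs" by simp
  show "emeasure N lf_configs \<noteq> \<infinity>" for i :: nat
    using N finite_measure.emeasure_finite[OF prob_space.axioms(1)[OF N(1)]] by simp
qed

end

locale poisson_boolean = boolean_model +
  fixes P :: "real \<Rightarrow> config measure"
  assumes law: "\<And>\<rho>. 0 \<le> \<rho> \<Longrightarrow> poisson_process_law (boolean_intensity \<mu> \<rho>) (P \<rho>)"
begin

lemma prob_space_P: "0 \<le> \<rho> \<Longrightarrow> prob_space (P \<rho>)"
  using law unfolding poisson_process_law_def by blast

lemma sets_P: "0 \<le> \<rho> \<Longrightarrow> sets (P \<rho>) = sets (config_algebra E)"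
  using law[of \<rho>] unfolding poisson_process_law_def config_algebra_def configurations_def
    boolean_intensity_def E_def space_scale_measure sets_scale_measure by blast

lemma space_P: "0 \<le> \<rho> \<Longrightarrow> space (P \<rho>) = configurations E"
proof -
  assume "0 \<le> \<rho>"
  have "space (config_algebra E) = configurations E"
    unfolding config_algebra_def by (rule space_measure_of) auto
  with sets_eq_imp_space_eq[OF sets_P[OF \<open>0 \<le> \<rho>\<close>]] show ?thesis by simp
qed

lemma count_sets:
  assumes "0 \<le> \<rho>" "A \<in> sets E"
  shows "{\<omega> \<in> space (P \<rho>). finite (\<omega> \<inter> A) \<and> card (\<omega> \<inter> A) = k} \<in> sets (P \<rho>)"
proof -
  have "sets (config_algebra E) = sigma_sets (configurations E)
     {{\<omega> \<in> configurations E. finite (\<omega> \<inter> A) \<and> card (\<omega> \<inter> A) = k} | A k. A \<in> sets E}"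
    unfolding config_algebra_def by (rule sets_measure_of) auto
  moreover have "{\<omega> \<in> space (P \<rho>). finite (\<omega> \<inter> A) \<and> card (\<omega> \<inter> A) = k} \<in> sigma_sets (configurations E)
     {{\<omega> \<in> configurations E. finite (\<omega> \<inter> A) \<and> card (\<omega> \<inter> A) = k} | A k. A \<in> sets E}"
    using assms space_P by (intro sigma_sets.Basic) blast
  ultimately show ?thesis using sets_P assms by simp
qed

lemma count_prob:
  assumes "0 \<le> \<rho>" "A \<in> sets E" "emeasure E A < \<infinity>"
  shows "measure (P \<rho>) {\<omega> \<in> space (P \<rho>). finite (\<omega> \<inter> A) \<and> card (\<omega> \<inter> A) = k} =
    (\<rho> * measure E A) ^ k / fact k * exp (- (\<rho> * measure E A))"
proof -
  have "A \<in> sets (boolean_intensity \<mu> \<rho>)" "emeasure (boolean_intensity \<mu> \<rho>) A < \<infinity>"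
    "measure (boolean_intensity \<mu> \<rho>) A = \<rho> * measure E A"
    using assms by (auto simp: boolean_intensity_def E_def ennreal_mult_less_top measure_def enn2real_mult)
  with law[OF assms(1)] show ?thesis unfolding poisson_process_law_def by simp
qed

text \<open>The Poisson weights of the finite counts already sum to one.\<close>

lemma AE_finite:
  assumes "0 \<le> \<rho>" "A \<in> sets E" "emeasure E A < \<infinity>"
  shows "AE \<omega> in P \<rho>. finite (\<omega> \<inter> A)"
proof -
  interpret prob_space "P \<rho>" using prob_space_P assms by blast
  let ?S = "\<lambda>k. {\<omega> \<in> space (P \<rho>). finite (\<omega> \<inter> A) \<and> card (\<omega> \<inter> A) = k}"
  let ?l = "\<rho> * measure E A"
  have "(\<lambda>k. prob (?S k)) sums prob (\<Union>k. ?S k)"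
    using count_sets[OF assms(1,2)] by (intro finite_measure_UNION) (auto simp: disjoint_family_on_def)
  moreover have "(\<lambda>k. prob (?S k)) sums (exp ?l * exp (- ?l))"
    unfolding count_prob[OF assms] using exp_converges[of ?l]
    by (intro sums_mult2) (simp add: scaleR_conv_of_real divide_inverse mult.commute)
  ultimately have "prob (\<Union>k. ?S k) = 1" using sums_unique2 by (fastforce simp: exp_minus_inverse)
  then have "AE \<omega> in P \<rho>. \<omega> \<in> (\<Union>k. ?S k)"
    using count_sets[OF assms(1,2)] by (intro prob_eq_1[THEN iffD1]) auto
  then show ?thesis by eventually_elim auto
qed

lemma AE_lf_configs: "0 \<le> \<rho> \<Longrightarrow> AE \<omega> in P \<rho>. \<omega> \<in> lf_configs"
proof -
  assume \<rho>: "0 \<le> \<rho>"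
  have "AE \<omega> in P \<rho>. \<forall>n::nat. finite (\<omega> \<inter> (reach (- real n) n (- real n) n \<inter> space E))"
    using AE_finite[OF \<rho> sets_reach emeasure_reach_finite] by (simp add: AE_all_countable)
  then show ?thesis
  proof (rule AE_mp, intro AE_I2 impI)
    fix \<omega> assume \<omega>: "\<omega> \<in> space (P \<rho>)" "\<forall>n::nat. finite (\<omega> \<inter> (reach (- real n) n (- real n) n \<inter> space E))"
    then have "\<omega> \<subseteq> space E" using space_P[OF \<rho>] by (auto simp: configurations_def)
    then have "\<omega> \<inter> (reach a b c d \<inter> space E) = \<omega> \<inter> reach a b c d" for a b c d by blast
    with \<omega> \<open>\<omega> \<subseteq> space E\<close> show "\<omega> \<in> lf_configs"
      by (simp add: lf_configs_def locally_finite_def space_E)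
  qed
qed

text \<open>Configurations that are not locally finite form a null set. They are sent to the default
  \<open>{}\<close>, which lies in \<open>lf_configs\<close>, so that the law lives where the
  topological lemmas apply.\<close>

definition M :: "real \<Rightarrow> config measure" where
  "M \<rho> = distr (P \<rho>) V (\<lambda>\<omega>. if \<omega> \<in> lf_configs then \<omega> else {})"

lemma sets_M [simp, measurable_cong]: "sets (M \<rho>) = sets V"
  by (simp add: M_def)

lemma space_M [simp]: "space (M \<rho>) = lf_configs"
  by (simp add: M_def)

lemma lf_configs_sets_P:
  assumes "0 \<le> \<rho>"
  shows "{\<omega> \<in> space (P \<rho>). \<omega> \<in> lf_configs} \<in> sets (P \<rho>)"
proof -
  have "{\<omega> \<in> space (P \<rho>). finite (\<omega> \<inter> A)} \<in> sets (P \<rho>)" if "A \<in> sets E" for A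
  proof -
    have "{\<omega> \<in> space (P \<rho>). finite (\<omega> \<inter> A)} =
      (\<Union>k. {\<omega> \<in> space (P \<rho>). finite (\<omega> \<inter> A) \<and> card (\<omega> \<inter> A) = k})" by auto
    then show ?thesis using count_sets[OF assms that] by (simp add: sets.countable_UN)
  qed
  then have "{\<omega> \<in> space (P \<rho>). \<forall>n::nat. finite (\<omega> \<inter> (reach (- real n) n (- real n) n \<inter> space E))} \<in> sets (P \<rho>)"
    by (intro sets.sets_Collect_countable_All) simp
  moreover have "\<omega> \<in> lf_configs \<longleftrightarrow> (\<forall>n::nat. finite (\<omega> \<inter> (reach (- real n) n (- real n) n \<inter> space E)))"
    if "\<omega> \<in> space (P \<rho>)" for \<omega>
  proof -
    have "\<omega> \<subseteq> space E" using that space_P[OF assms] by (auto simp: configurations_def)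
    then have "\<omega> \<inter> (reach a b c d \<inter> space E) = \<omega> \<inter> reach a b c d" for a b c d by blast
    with \<open>\<omega> \<subseteq> space E\<close> show ?thesis
      by (simp add: lf_configs_def locally_finite_def space_E)
  qed
  ultimately show ?thesis by (simp cong: conj_cong)
qed

lemma measurable_restrict_lf:
  assumes "0 \<le> \<rho>"
  shows "(\<lambda>\<omega>. if \<omega> \<in> lf_configs then \<omega> else {}) \<in> measurable (P \<rho>) V"
proof (rule measurable_VI)
  fix A assume A: "A \<in> sets E"
  have "{\<omega> \<in> space (P \<rho>). (if \<omega> \<in> lf_configs then \<omega> else {}) \<inter> A = {}} =
     ({\<omega> \<in> space (P \<rho>). \<omega> \<in> lf_configs} \<inter> {\<omega> \<in> space (P \<rho>). finite (\<omega> \<inter> A) \<and> card (\<omega> \<inter> A) = 0})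
     \<union> (space (P \<rho>) - {\<omega> \<in> space (P \<rho>). \<omega> \<in> lf_configs})"
    by (auto simp: card_eq_0_iff)
  then show "{\<omega> \<in> space (P \<rho>). (if \<omega> \<in> lf_configs then \<omega> else {}) \<inter> A = {}} \<in> sets (P \<rho>)"
    using count_sets[OF assms A] lf_configs_sets_P[OF assms] by auto
qed auto

lemma prob_space_M: "0 \<le> \<rho> \<Longrightarrow> prob_space (M \<rho>)"
  unfolding M_def by (rule prob_space.prob_space_distr[OF prob_space_P measurable_restrict_lf])

section \<open>Probabilities on locally finite configurations\<close>

definition pr :: "real \<Rightarrow> (config \<Rightarrow> bool) \<Rightarrow> real" where
  "pr \<rho> Q = measure (M \<rho>) {\<omega> \<in> lf_configs. Q \<omega>}"

lemma pred_sets: "Measurable.pred V Q \<Longrightarrow> {\<omega> \<in> lf_configs. Q \<omega>} \<in> sets (M \<rho>)"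
  by (simp add: pred_def)

text \<open>\<open>Q\<close> may be arbitrary on the null set of configurations that are not locally
  finite; the completion makes its trace there measurable.\<close>

lemma event_prob_eq:
  assumes \<rho>: "0 \<le> \<rho>" and Q: "Measurable.pred V Q"
  shows "event_prob (P \<rho>) Q = pr \<rho> Q"
proof -
  interpret prob_space "P \<rho>" using prob_space_P[OF \<rho>] .
  let ?f = "\<lambda>\<omega>. if \<omega> \<in> lf_configs then \<omega> else {}"
  have S: "{\<omega> \<in> space (P \<rho>). Q (?f \<omega>)} \<in> sets (P \<rho>)"
    using measurable_sets[OF measurable_restrict_lf[OF \<rho>], of "{\<omega> \<in> lf_configs. Q \<omega>}"] Q
    by (auto simp: pred_def vimage_def Int_def conj_commute cong: if_cong split: if_splits
      elim!: back_subst[of "\<lambda>X. X \<in> _"])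
  have "pr \<rho> Q = prob {\<omega> \<in> space (P \<rho>). Q (?f \<omega>)}"
    unfolding pr_def M_def using Q
    by (subst measure_distr[OF measurable_restrict_lf[OF \<rho>]])
       (auto simp: pred_def intro!: arg_cong[of _ _ prob])
  moreover have AE: "AE \<omega> in completion (P \<rho>). \<omega> \<in> lf_configs"
    using AE_lf_configs[OF \<rho>] by (rule AE_completion)
  have "measure (completion (P \<rho>)) {\<omega> \<in> space (P \<rho>). Q \<omega>} = measure (completion (P \<rho>)) {\<omega> \<in> space (P \<rho>). Q (?f \<omega>)}"
  proof (rule measure_eq_AE)
    show "AE \<omega> in completion (P \<rho>). \<omega> \<in> {\<omega> \<in> space (P \<rho>). Q \<omega>} \<longleftrightarrow> \<omega> \<in> {\<omega> \<in> space (P \<rho>). Q (?f \<omega>)}"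
      using AE by eventually_elim auto
    show "{\<omega> \<in> space (P \<rho>). Q (?f \<omega>)} \<in> sets (completion (P \<rho>))" using S by auto
    have "{\<omega> \<in> space (P \<rho>). Q \<omega>} = ({\<omega> \<in> space (P \<rho>). Q (?f \<omega>)} \<inter> {\<omega> \<in> space (P \<rho>). \<omega> \<in> lf_configs})
       \<union> {\<omega> \<in> space (P \<rho>). \<omega> \<notin> lf_configs \<and> Q \<omega>}" by auto
    moreover have "{\<omega> \<in> space (P \<rho>). \<omega> \<notin> lf_configs \<and> Q \<omega>} \<in> sets (completion (P \<rho>))"
    proof -
      have "{\<omega> \<in> space (P \<rho>). \<omega> \<notin> lf_configs} \<in> null_sets (P \<rho>)"
        using AE_lf_configs[OF \<rho>] lf_configs_sets_P[OF \<rho>]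
        by (subst AE_iff_null[symmetric]) (auto intro: sets.sets_Collect_neg)
      then have "{\<omega> \<in> space (P \<rho>). \<omega> \<notin> lf_configs \<and> Q \<omega>} \<in> null_sets (completion (P \<rho>))"
        by (intro null_sets_completion_subset[OF _ null_sets_completionI]) auto
      then show ?thesis by auto
    qed
    moreover have "{\<omega> \<in> space (P \<rho>). Q (?f \<omega>)} \<inter> {\<omega> \<in> space (P \<rho>). \<omega> \<in> lf_configs} \<in> sets (completion (P \<rho>))"
      by (intro sets_completionI_sets sets.Int S lf_configs_sets_P \<rho>)
    ultimately show "{\<omega> \<in> space (P \<rho>). Q \<omega>} \<in> sets (completion (P \<rho>))"
      by (simp only: sets.Un)
  qed
  ultimately show ?thesis unfolding event_prob_def using S by simp
qed

lemma pr_bounds: "0 \<le> \<rho> \<Longrightarrow> 0 \<le> pr \<rho> Q \<and> pr \<rho> Q \<le> 1"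
  unfolding pr_def using prob_space.prob_le_1[OF prob_space_M] by (simp add: measure_nonneg)

text \<open>Only the larger event has to be measurable, because \<open>measure\<close> is 0 on sets
  outside the sigma-algebra.\<close>

lemma pr_mono:
  assumes "0 \<le> \<rho>" "Measurable.pred V Q'" "\<And>\<omega>. \<omega> \<in> lf_configs \<Longrightarrow> Q \<omega> \<Longrightarrow> Q' \<omega>"
  shows "pr \<rho> Q \<le> pr \<rho> Q'"
  unfolding pr_def using assms pred_sets
  by (intro finite_measure.finite_measure_mono prob_space.finite_measure prob_space_M) auto

lemma pr_not:
  assumes "0 \<le> \<rho>" "Measurable.pred V Q"
  shows "pr \<rho> (\<lambda>\<omega>. \<not> Q \<omega>) = 1 - pr \<rho> Q"
proof -
  interpret prob_space "M \<rho>" by (rule prob_space_M[OF assms(1)])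
  have "{\<omega> \<in> lf_configs. \<not> Q \<omega>} = space (M \<rho>) - {\<omega> \<in> lf_configs. Q \<omega>}" by auto
  then show ?thesis unfolding pr_def using prob_compl[OF pred_sets[OF assms(2)]] by simp
qed

lemma pr_disj:
  assumes "0 \<le> \<rho>" "Measurable.pred V Q" "Measurable.pred V Q'"
  shows "pr \<rho> (\<lambda>\<omega>. Q \<omega> \<or> Q' \<omega>) \<le> pr \<rho> Q + pr \<rho> Q'"
proof -
  interpret prob_space "M \<rho>" by (rule prob_space_M[OF assms(1)])
  have "{\<omega> \<in> lf_configs. Q \<omega> \<or> Q' \<omega>} = {\<omega> \<in> lf_configs. Q \<omega>} \<union> {\<omega> \<in> lf_configs. Q' \<omega>}" by auto
  then show ?thesis unfolding pr_def
    using measure_Un_le[OF pred_sets[OF assms(2)] pred_sets[OF assms(3)]] by simp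
qed

lemma pr_bex:
  assumes "0 \<le> \<rho>" "finite I" "\<And>i. i \<in> I \<Longrightarrow> Measurable.pred V (Q i)"
  shows "pr \<rho> (\<lambda>\<omega>. \<exists>i\<in>I. Q i \<omega>) \<le> (\<Sum>i\<in>I. pr \<rho> (Q i))"
proof -
  interpret prob_space "M \<rho>" by (rule prob_space_M[OF assms(1)])
  have "{\<omega> \<in> lf_configs. \<exists>i\<in>I. Q i \<omega>} = (\<Union>i\<in>I. {\<omega> \<in> lf_configs. Q i \<omega>})" by auto
  moreover have "(\<lambda>i. {\<omega> \<in> lf_configs. Q i \<omega>}) ` I \<subseteq> sets (M \<rho>)" using assms(3) pred_sets by blast
  from finite_measure_subadditive_finite[OF assms(2) this]
  have "measure (M \<rho>) (\<Union>i\<in>I. {\<omega> \<in> lf_configs. Q i \<omega>}) \<le> (\<Sum>i\<in>I. measure (M \<rho>) {\<omega> \<in> lf_configs. Q i \<omega>})" .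
  ultimately show ?thesis unfolding pr_def by (simp only:)
qed

lemma pr_ex:
  assumes "0 \<le> \<rho>" "\<And>i::nat. Measurable.pred V (Q i)" "summable (\<lambda>i. pr \<rho> (Q i))"
  shows "pr \<rho> (\<lambda>\<omega>. \<exists>i. Q i \<omega>) \<le> (\<Sum>i. pr \<rho> (Q i))"
proof -
  interpret prob_space "M \<rho>" by (rule prob_space_M[OF assms(1)])
  have "{\<omega> \<in> lf_configs. \<exists>i. Q i \<omega>} = (\<Union>i. {\<omega> \<in> lf_configs. Q i \<omega>})" by auto
  moreover have "range (\<lambda>i. {\<omega> \<in> lf_configs. Q i \<omega>}) \<subseteq> sets (M \<rho>)" using assms(2) pred_sets by blast
  from finite_measure_subadditive_countably[OF this assms(3)[unfolded pr_def]]
  have "measure (M \<rho>) (\<Union>i. {\<omega> \<in> lf_configs. Q i \<omega>}) \<le> (\<Sum>i. measure (M \<rho>) {\<omega> \<in> lf_configs. Q i \<omega>})" .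
  ultimately show ?thesis unfolding pr_def by (simp only:)
qed

lemma pr_ex_null:
  assumes "0 \<le> \<rho>" "countable I" "\<And>i. i \<in> I \<Longrightarrow> Measurable.pred V (Q i)" "\<And>i. i \<in> I \<Longrightarrow> pr \<rho> (Q i) = 0"
  shows "pr \<rho> (\<lambda>\<omega>. \<exists>i\<in>I. Q i \<omega>) = 0"
proof -
  interpret prob_space "M \<rho>" by (rule prob_space_M[OF assms(1)])
  have "{\<omega> \<in> lf_configs. Q i \<omega>} \<in> null_sets (M \<rho>)" if "i \<in> I" for i
    using assms(3,4)[OF that] pred_sets by (auto simp: pr_def emeasure_eq_measure intro!: null_setsI)
  then have "(\<Union>i\<in>I. {\<omega> \<in> lf_configs. Q i \<omega>}) \<in> null_sets (M \<rho>)"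
    using assms(2) by (intro null_sets_UN') auto
  moreover have "{\<omega> \<in> lf_configs. \<exists>i\<in>I. Q i \<omega>} = (\<Union>i\<in>I. {\<omega> \<in> lf_configs. Q i \<omega>})" by auto
  ultimately show ?thesis unfolding pr_def by (simp add: measure_def null_setsD1)
qed

lemma pr_void:
  assumes \<rho>: "0 \<le> \<rho>" and A: "A \<in> sets E" "emeasure E A < \<infinity>"
  shows "pr \<rho> (\<lambda>\<omega>. \<omega> \<inter> A = {}) = exp (- (\<rho> * measure E A))"
proof -
  interpret prob_space "P \<rho>" using prob_space_P[OF \<rho>] .
  let ?f = "\<lambda>\<omega>. if \<omega> \<in> lf_configs then \<omega> else {}"
  have S: "{\<omega> \<in> lf_configs. \<omega> \<inter> A = {}} \<in> sets V"
    using void_pred[OF A] by (simp add: pred_def)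
  have "pr \<rho> (\<lambda>\<omega>. \<omega> \<inter> A = {}) = prob (?f -` {\<omega> \<in> lf_configs. \<omega> \<inter> A = {}} \<inter> space (P \<rho>))"
    unfolding pr_def M_def by (rule measure_distr[OF measurable_restrict_lf[OF \<rho>] S])
  also have "\<dots> = prob {\<omega> \<in> space (P \<rho>). finite (\<omega> \<inter> A) \<and> card (\<omega> \<inter> A) = 0}"
  proof (rule measure_eq_AE)
    show "AE \<omega> in P \<rho>. \<omega> \<in> ?f -` {\<omega> \<in> lf_configs. \<omega> \<inter> A = {}} \<inter> space (P \<rho>) \<longleftrightarrow>
      \<omega> \<in> {\<omega> \<in> space (P \<rho>). finite (\<omega> \<inter> A) \<and> card (\<omega> \<inter> A) = 0}"
      using AE_lf_configs[OF \<rho>] by eventually_elim (auto simp: card_eq_0_iff)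
  qed (use measurable_sets[OF measurable_restrict_lf[OF \<rho>] S] count_sets[OF \<rho> A(1)] in auto)
  also have "\<dots> = exp (- (\<rho> * measure E A))" using count_prob[OF \<rho> A, of 0] by simp
  finally show ?thesis .
qed

lemma M_eqI:
  assumes "prob_space N" "sets N = sets V" "0 \<le> \<rho>"
    and "\<And>A. A \<in> sets E \<Longrightarrow> emeasure E A < \<infinity> \<Longrightarrow>
      measure N {\<omega> \<in> lf_configs. \<omega> \<inter> A = {}} = exp (- (\<rho> * measure E A))"
  shows "N = M \<rho>"
  using assms pr_void[OF assms(3)] by (intro V_measure_eqI prob_space_M) (auto simp: pr_def)

lemma pr_hit_le:
  assumes \<rho>: "0 \<le> \<rho>" and A: "A \<in> sets E" "emeasure E A \<le> ennreal c" "0 \<le> c"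
  shows "pr \<rho> (\<lambda>\<omega>. \<omega> \<inter> A \<noteq> {}) \<le> \<rho> * c"
proof -
  have fin: "emeasure E A < \<infinity>" using A(2) by (rule le_less_trans) simp
  have "pr \<rho> (\<lambda>\<omega>. \<omega> \<inter> A \<noteq> {}) = 1 - exp (- (\<rho> * measure E A))"
    using pr_not[OF \<rho> void_pred[OF A(1) fin]] pr_void[OF \<rho> A(1) fin] by simp
  also have "\<dots> \<le> \<rho> * measure E A" using exp_ge_add_one_self[of "- (\<rho> * measure E A)"] by simp
  also have "\<dots> \<le> \<rho> * c"
    using \<rho> A(2,3) by (intro mult_left_mono) (auto simp: measure_def enn2real_leI)
  finally show ?thesis .
qed

section \<open>Invariance, superposition and resampling\<close>

lemma measurable_image:
  assumes g: "g \<in> measurable E E" "distr E E g = E" and L: "\<And>\<omega>. \<omega> \<in> lf_configs \<Longrightarrow> g ` \<omega> \<in> lf_configs"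
  shows "(\<lambda>\<omega>. g ` \<omega>) \<in> measurable V V"
proof (rule measurable_VI)
  fix A assume A: "A \<in> sets E" "emeasure E A < \<infinity>"
  have "{\<omega> \<in> lf_configs. g ` \<omega> \<inter> A = {}} = {\<omega> \<in> lf_configs. \<omega> \<inter> (g -` A \<inter> space E) = {}}"
    by (auto simp: lf_configs_def space_E)
  moreover have "emeasure E (g -` A \<inter> space E) = emeasure E A"
    using emeasure_distr[OF g(1) A(1)] by (simp add: g(2))
  ultimately show "{\<omega> \<in> space V. g ` \<omega> \<inter> A = {}} \<in> sets V"
    using void_pred[OF measurable_sets[OF g(1) A(1)]] A by (simp add: pred_def)
qed (use L in auto)

text \<open>A measure preserving map of the points keeps every void probability, hence the
  law.\<close>

lemma pr_image:
  assumes g: "g \<in> measurable E E" "distr E E g = E" and L: "\<And>\<omega>. \<omega> \<in> lf_configs \<Longrightarrow> g ` \<omega> \<in> lf_configs"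
    and \<rho>: "0 \<le> \<rho>" and Q: "Measurable.pred V Q"
  shows "pr \<rho> (\<lambda>\<omega>. Q (g ` \<omega>)) = pr \<rho> Q"
proof -
  have m: "(\<lambda>\<omega>. g ` \<omega>) \<in> measurable (M \<rho>) V"
    using measurable_image[OF g L] by (simp add: measurable_cong_sets[OF sets_M refl])
  have "distr (M \<rho>) V (\<lambda>\<omega>. g ` \<omega>) = M \<rho>"
  proof (rule M_eqI)
    fix A assume A: "A \<in> sets E" "emeasure E A < \<infinity>"
    have em: "emeasure E (g -` A \<inter> space E) = emeasure E A"
      using emeasure_distr[OF g(1) A(1)] by (simp add: g(2))
    have "measure (distr (M \<rho>) V (\<lambda>\<omega>. g ` \<omega>)) {\<omega> \<in> lf_configs. \<omega> \<inter> A = {}} =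
      measure (M \<rho>) ((\<lambda>\<omega>. g ` \<omega>) -` {\<omega> \<in> lf_configs. \<omega> \<inter> A = {}} \<inter> space (M \<rho>))"
      using void_pred[OF A] by (intro measure_distr m) (simp add: pred_def)
    also have "(\<lambda>\<omega>. g ` \<omega>) -` {\<omega> \<in> lf_configs. \<omega> \<inter> A = {}} \<inter> space (M \<rho>) =
       {\<omega> \<in> lf_configs. \<omega> \<inter> (g -` A \<inter> space E) = {}}"
      using L by (auto simp: lf_configs_def space_E)
    also have "measure (M \<rho>) \<dots> = exp (- (\<rho> * measure E A))"
      using pr_void[OF \<rho> measurable_sets[OF g(1) A(1)]] A em by (simp add: pr_def measure_def)
    finally show "measure (distr (M \<rho>) V (\<lambda>\<omega>. g ` \<omega>)) {\<omega> \<in> lf_configs. \<omega> \<inter> A = {}} = exp (- (\<rho> * measure E A))" .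
  qed (use \<rho> m prob_space.prob_space_distr[OF prob_space_M] in auto)
  then have "pr \<rho> Q = measure (distr (M \<rho>) V (\<lambda>\<omega>. g ` \<omega>)) {\<omega> \<in> lf_configs. Q \<omega>}"
    by (simp add: pr_def)
  also have "\<dots> = measure (M \<rho>) ((\<lambda>\<omega>. g ` \<omega>) -` {\<omega> \<in> lf_configs. Q \<omega>} \<inter> space (M \<rho>))"
    using Q by (intro measure_distr m) (simp add: pred_def)
  also have "(\<lambda>\<omega>. g ` \<omega>) -` {\<omega> \<in> lf_configs. Q \<omega>} \<inter> space (M \<rho>) = {\<omega> \<in> lf_configs. Q (g ` \<omega>)}"
    using L by auto
  finally show ?thesis by (simp add: pr_def)
qed

lemma measure_pair_M:
  assumes "0 \<le> a" "0 \<le> b" "X \<in> sets V" "Y \<in> sets V"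
  shows "measure (M a \<Otimes>\<^sub>M M b) (X \<times> Y) = measure (M a) X * measure (M b) Y"
proof -
  interpret B: prob_space "M b" using prob_space_M assms by blast
  show ?thesis
    using assms by (simp add: measure_def B.emeasure_pair_measure_Times enn2real_mult)
qed

lemma prob_space_pair_M: "0 \<le> a \<Longrightarrow> 0 \<le> b \<Longrightarrow> prob_space (M a \<Otimes>\<^sub>M M b)"
  using prob_space_M by (intro prob_space_pair) auto

text \<open>Superposition and resampling are both instances of combining two independent processes by
  an operation whose void events factorise.\<close>

lemma distr_combine:
  assumes ab: "0 \<le> a" "0 \<le> b" "0 \<le> c"
    and L: "\<And>\<omega> \<eta>. \<omega> \<in> lf_configs \<Longrightarrow> \<eta> \<in> lf_configs \<Longrightarrow> f \<omega> \<eta> \<in> lf_configs"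
    and split: "\<And>A. A \<in> sets E \<Longrightarrow> emeasure E A < \<infinity> \<Longrightarrow> \<exists>A1 A2. A1 \<in> sets E \<and> emeasure E A1 < \<infinity> \<and>
      A2 \<in> sets E \<and> emeasure E A2 < \<infinity> \<and> c * measure E A = a * measure E A1 + b * measure E A2 \<and>
      (\<forall>\<omega>\<in>lf_configs. \<forall>\<eta>\<in>lf_configs. f \<omega> \<eta> \<inter> A = {} \<longleftrightarrow> \<omega> \<inter> A1 = {} \<and> \<eta> \<inter> A2 = {})"
  shows "(\<lambda>(\<omega>, \<eta>). f \<omega> \<eta>) \<in> measurable (M a \<Otimes>\<^sub>M M b) V"
    and "distr (M a \<Otimes>\<^sub>M M b) V (\<lambda>(\<omega>, \<eta>). f \<omega> \<eta>) = M c"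
proof -
  have sp: "space (M a \<Otimes>\<^sub>M M b) = lf_configs \<times> lf_configs" by (simp add: space_pair_measure)
  have key: "\<exists>X\<in>sets V. \<exists>Y\<in>sets V. {x \<in> space (M a \<Otimes>\<^sub>M M b). (case x of (\<omega>, \<eta>) \<Rightarrow> f \<omega> \<eta>) \<inter> A = {}} = X \<times> Y \<and>
    measure (M a) X * measure (M b) Y = exp (- (c * measure E A))"
    if A: "A \<in> sets E" "emeasure E A < \<infinity>" for A
    using split[OF A]
  proof (elim exE conjE)
    fix A1 A2
    assume s: "A1 \<in> sets E" "emeasure E A1 < \<infinity>"
      "A2 \<in> sets E" "emeasure E A2 < \<infinity>" "c * measure E A = a * measure E A1 + b * measure E A2"
      "\<forall>\<omega>\<in>lf_configs. \<forall>\<eta>\<in>lf_configs. f \<omega> \<eta> \<inter> A = {} \<longleftrightarrow> \<omega> \<inter> A1 = {} \<and> \<eta> \<inter> A2 = {}"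
    have "{x \<in> space (M a \<Otimes>\<^sub>M M b). (case x of (\<omega>, \<eta>) \<Rightarrow> f \<omega> \<eta>) \<inter> A = {}} =
      {\<omega> \<in> lf_configs. \<omega> \<inter> A1 = {}} \<times> {\<eta> \<in> lf_configs. \<eta> \<inter> A2 = {}}"
      unfolding sp by (intro set_eqI) (simp add: s(6) mem_Times_iff split_beta conj_ac cong: conj_cong)
    moreover have "measure (M a) {\<omega> \<in> lf_configs. \<omega> \<inter> A1 = {}} * measure (M b) {\<eta> \<in> lf_configs. \<eta> \<inter> A2 = {}}
      = exp (- (c * measure E A))"
      using pr_void[OF ab(1) s(1,2)] pr_void[OF ab(2) s(3,4)] unfolding pr_def s(5)
      by (simp add: exp_add[symmetric])
    ultimately show ?thesis using void_pred[OF s(1,2)] void_pred[OF s(3,4)] unfolding pred_def space_V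
      by blast
  qed
  show m: "(\<lambda>(\<omega>, \<eta>). f \<omega> \<eta>) \<in> measurable (M a \<Otimes>\<^sub>M M b) V"
  proof (rule measurable_VI)
    fix A assume "A \<in> sets E" "emeasure E A < \<infinity>"
    from key[OF this] obtain X Y where "X \<in> sets V" "Y \<in> sets V"
      "{x \<in> space (M a \<Otimes>\<^sub>M M b). (case x of (\<omega>, \<eta>) \<Rightarrow> f \<omega> \<eta>) \<inter> A = {}} = X \<times> Y" by blast
    then show "{x \<in> space (M a \<Otimes>\<^sub>M M b). (case x of (\<omega>, \<eta>) \<Rightarrow> f \<omega> \<eta>) \<inter> A = {}} \<in> sets (M a \<Otimes>\<^sub>M M b)"
      by simp
  qed (use L in \<open>auto simp: sp\<close>)
  show "distr (M a \<Otimes>\<^sub>M M b) V (\<lambda>(\<omega>, \<eta>). f \<omega> \<eta>) = M c"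
  proof (rule M_eqI)
    fix A assume A: "A \<in> sets E" "emeasure E A < \<infinity>"
    from key[OF A] obtain X Y where XY: "X \<in> sets V" "Y \<in> sets V"
      "{x \<in> space (M a \<Otimes>\<^sub>M M b). (case x of (\<omega>, \<eta>) \<Rightarrow> f \<omega> \<eta>) \<inter> A = {}} = X \<times> Y"
      "measure (M a) X * measure (M b) Y = exp (- (c * measure E A))" by blast
    have "measure (distr (M a \<Otimes>\<^sub>M M b) V (\<lambda>(\<omega>, \<eta>). f \<omega> \<eta>)) {\<omega> \<in> lf_configs. \<omega> \<inter> A = {}} =
      measure (M a \<Otimes>\<^sub>M M b) ((\<lambda>(\<omega>, \<eta>). f \<omega> \<eta>) -` {\<omega> \<in> lf_configs. \<omega> \<inter> A = {}} \<inter> space (M a \<Otimes>\<^sub>M M b))"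
      using void_pred[OF A] by (intro measure_distr m) (simp add: pred_def)
    also have "(\<lambda>(\<omega>, \<eta>). f \<omega> \<eta>) -` {\<omega> \<in> lf_configs. \<omega> \<inter> A = {}} \<inter> space (M a \<Otimes>\<^sub>M M b) = X \<times> Y"
      unfolding XY(3)[symmetric] using L by (auto simp: sp)
    finally show "measure (distr (M a \<Otimes>\<^sub>M M b) V (\<lambda>(\<omega>, \<eta>). f \<omega> \<eta>)) {\<omega> \<in> lf_configs. \<omega> \<inter> A = {}} = exp (- (c * measure E A))"
      using measure_pair_M[OF ab(1,2) XY(1,2)] XY(4) by simp
  qed (use ab prob_space.prob_space_distr[OF prob_space_pair_M m] in auto)
qed

lemma pr_combine:
  assumes m: "(\<lambda>(\<omega>, \<eta>). f \<omega> \<eta>) \<in> measurable (M a \<Otimes>\<^sub>M M b) V"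
    and d: "distr (M a \<Otimes>\<^sub>M M b) V (\<lambda>(\<omega>, \<eta>). f \<omega> \<eta>) = M c"
    and L: "\<And>\<omega> \<eta>. \<omega> \<in> lf_configs \<Longrightarrow> \<eta> \<in> lf_configs \<Longrightarrow> f \<omega> \<eta> \<in> lf_configs"
    and Q: "Measurable.pred V Q"
  shows "pr c Q = measure (M a \<Otimes>\<^sub>M M b) {x \<in> lf_configs \<times> lf_configs. Q (f (fst x) (snd x))}"
    and "{x \<in> lf_configs \<times> lf_configs. Q (f (fst x) (snd x))} \<in> sets (M a \<Otimes>\<^sub>M M b)"
proof -
  have S: "{\<omega> \<in> lf_configs. Q \<omega>} \<in> sets V" using Q by (simp add: pred_def)
  have sp: "space (M a \<Otimes>\<^sub>M M b) = lf_configs \<times> lf_configs" by (simp add: space_pair_measure)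
  have *: "(\<lambda>(\<omega>, \<eta>). f \<omega> \<eta>) -` {\<omega> \<in> lf_configs. Q \<omega>} \<inter> space (M a \<Otimes>\<^sub>M M b) =
    {x \<in> lf_configs \<times> lf_configs. Q (f (fst x) (snd x))}" unfolding sp using L by auto
  have "pr c Q = measure (distr (M a \<Otimes>\<^sub>M M b) V (\<lambda>(\<omega>, \<eta>). f \<omega> \<eta>)) {\<omega> \<in> lf_configs. Q \<omega>}"
    unfolding d pr_def ..
  also have "\<dots> = measure (M a \<Otimes>\<^sub>M M b) {x \<in> lf_configs \<times> lf_configs. Q (f (fst x) (snd x))}"
    unfolding *[symmetric] by (rule measure_distr[OF m S])
  finally show "pr c Q = measure (M a \<Otimes>\<^sub>M M b) {x \<in> lf_configs \<times> lf_configs. Q (f (fst x) (snd x))}" .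
  show "{x \<in> lf_configs \<times> lf_configs. Q (f (fst x) (snd x))} \<in> sets (M a \<Otimes>\<^sub>M M b)"
    using measurable_sets[OF m S] unfolding * .
qed

text \<open>Coupling by superposition: an independent process of intensity \<open>b - a\<close>
  added to one of intensity \<open>a\<close> gives intensity \<open>b\<close>, and an increasing
  event survives the added points.\<close>

lemma pr_increasing:
  assumes ab: "0 \<le> a" "a \<le> b" and Q: "Measurable.pred V Q"
    and inc: "\<And>\<omega> \<eta>. \<omega> \<subseteq> \<eta> \<Longrightarrow> Q \<omega> \<Longrightarrow> Q \<eta>"
  shows "pr a Q \<le> pr b Q"
proof -
  have pos: "0 \<le> b - a" "0 \<le> b" using ab by auto
  have c: "(\<lambda>(\<omega>, \<eta>). \<omega> \<union> \<eta>) \<in> measurable (M a \<Otimes>\<^sub>M M (b - a)) V"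
    "distr (M a \<Otimes>\<^sub>M M (b - a)) V (\<lambda>(\<omega>, \<eta>). \<omega> \<union> \<eta>) = M b"
  proof (rule distr_combine[OF ab(1) pos lf_configs_Un], assumption, assumption, goal_cases)
    case (1 A) then show ?case by (intro exI[of _ A]) (auto simp: algebra_simps)
  next
    case 2 show ?case
    proof (rule distr_combine[OF ab(1) pos lf_configs_Un], assumption, assumption, goal_cases)
      case (1 A) then show ?case by (intro exI[of _ A]) (auto simp: algebra_simps)
    qed
  qed
  interpret pair: prob_space "M a \<Otimes>\<^sub>M M (b - a)" using prob_space_pair_M ab by auto
  have "pr a Q = measure (M a \<Otimes>\<^sub>M M (b - a)) ({\<omega> \<in> lf_configs. Q \<omega>} \<times> lf_configs)"
    using measure_pair_M[OF ab(1) pos(1), of "{\<omega> \<in> lf_configs. Q \<omega>}" lf_configs] Q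
      prob_space.prob_space[OF prob_space_M[OF pos(1)]] sets.top[of V]
    by (simp add: pr_def pred_def)
  also have "\<dots> \<le> measure (M a \<Otimes>\<^sub>M M (b - a)) {x \<in> lf_configs \<times> lf_configs. Q (fst x \<union> snd x)}"
    using inc pr_combine(2)[OF c lf_configs_Un Q]
    by (intro pair.finite_measure_mono) (auto intro: inc[OF Un_upper1])
  also have "\<dots> = pr b Q" using pr_combine(1)[OF c lf_configs_Un Q] by simp
  finally show ?thesis .
qed

lemma measurable_Int:
  assumes B: "B \<in> sets E" shows "(\<lambda>\<omega>. \<omega> \<inter> B) \<in> measurable V V"
proof (rule measurable_VI)
  fix A assume A: "A \<in> sets E" "emeasure E A < \<infinity>"
  have "emeasure E (B \<inter> A) < \<infinity>" using emeasure_mono[of "B \<inter> A" A E] A by (auto intro: le_less_trans)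
  then have "Measurable.pred V (\<lambda>\<omega>. \<omega> \<inter> (B \<inter> A) = {})" using A B by (intro void_pred) auto
  then show "{\<omega> \<in> space V. \<omega> \<inter> B \<inter> A = {}} \<in> sets V" by (simp add: pred_def Int_assoc)
qed (auto intro: lf_configs_mono)

text \<open>Resampling: points in \<open>B\<close> from one copy and points off \<open>B\<close>
  from an independent copy form a process of the same law, and for this combination the joint event
  is a product set.\<close>

lemma pr_independent:
  assumes \<rho>: "0 \<le> \<rho>" and B: "B \<in> sets E" and Q: "Measurable.pred V Q" "Measurable.pred V Q'"
    and loc: "\<And>\<omega>. \<omega> \<in> lf_configs \<Longrightarrow> Q \<omega> \<longleftrightarrow> Q (\<omega> \<inter> B)" "\<And>\<omega>. \<omega> \<in> lf_configs \<Longrightarrow> Q' \<omega> \<longleftrightarrow> Q' (\<omega> - B)"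
  shows "pr \<rho> (\<lambda>\<omega>. Q \<omega> \<and> Q' \<omega>) = pr \<rho> Q * pr \<rho> Q'"
proof -
  let ?f = "\<lambda>\<omega> \<eta>. (\<omega> \<inter> B) \<union> (\<eta> - B)"
  have L: "?f \<omega> \<eta> \<in> lf_configs" if "\<omega> \<in> lf_configs" "\<eta> \<in> lf_configs" for \<omega> \<eta>
    using that lf_configs_mono[of \<omega> "\<omega> \<inter> B"] lf_configs_mono[of \<eta> "\<eta> - B"] by (intro lf_configs_Un) auto
  have sp: "\<exists>A1 A2. A1 \<in> sets E \<and> emeasure E A1 < \<infinity> \<and>
      A2 \<in> sets E \<and> emeasure E A2 < \<infinity> \<and> \<rho> * measure E A = \<rho> * measure E A1 + \<rho> * measure E A2 \<and>
      (\<forall>\<omega>\<in>lf_configs. \<forall>\<eta>\<in>lf_configs. ?f \<omega> \<eta> \<inter> A = {} \<longleftrightarrow> \<omega> \<inter> A1 = {} \<and> \<eta> \<inter> A2 = {})"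
    if A: "A \<in> sets E" "emeasure E A < \<infinity>" for A
  proof (intro exI conjI ballI)
    show 1: "A \<inter> B \<in> sets E" "A - B \<in> sets E" using A B by auto
    show 2: "emeasure E (A \<inter> B) < \<infinity>" "emeasure E (A - B) < \<infinity>"
      using emeasure_mono[of "A \<inter> B" A E] emeasure_mono[of "A - B" A E] A by (auto intro: le_less_trans)
    have "measure E ((A \<inter> B) \<union> (A - B)) = measure E (A \<inter> B) + measure E (A - B)"
      using 1 2 by (intro measure_Union) auto
    then show "\<rho> * measure E A = \<rho> * measure E (A \<inter> B) + \<rho> * measure E (A - B)"
      by (simp add: Int_Diff_Un distrib_left)
  qed blast
  note c = distr_combine[OF \<rho> \<rho> \<rho> L sp]
  have "Measurable.pred V (\<lambda>\<omega>. Q \<omega> \<and> Q' \<omega>)" using Q by measurable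
  from pr_combine(1)[OF c L this]
  have "pr \<rho> (\<lambda>\<omega>. Q \<omega> \<and> Q' \<omega>) = measure (M \<rho> \<Otimes>\<^sub>M M \<rho>) {x \<in> lf_configs \<times> lf_configs. Q (?f (fst x) (snd x)) \<and> Q' (?f (fst x) (snd x))}" .
  also have "{x \<in> lf_configs \<times> lf_configs. Q (?f (fst x) (snd x)) \<and> Q' (?f (fst x) (snd x))} =
    {\<omega> \<in> lf_configs. Q \<omega>} \<times> {\<omega> \<in> lf_configs. Q' \<omega>}"
  proof -
    have "Q (?f \<omega> \<eta>) \<longleftrightarrow> Q \<omega>" "Q' (?f \<omega> \<eta>) \<longleftrightarrow> Q' \<eta>" if "\<omega> \<in> lf_configs" "\<eta> \<in> lf_configs" for \<omega> \<eta>
    proof -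
      have "?f \<omega> \<eta> \<inter> B = \<omega> \<inter> B" "?f \<omega> \<eta> - B = \<eta> - B" by auto
      then show "Q (?f \<omega> \<eta>) \<longleftrightarrow> Q \<omega>" "Q' (?f \<omega> \<eta>) \<longleftrightarrow> Q' \<eta>" using loc L that by metis+
    qed
    then show ?thesis by auto
  qed
  also have "measure (M \<rho> \<Otimes>\<^sub>M M \<rho>) \<dots> = pr \<rho> Q * pr \<rho> Q'"
    using measure_pair_M[OF \<rho> \<rho>] Q by (simp add: pr_def pred_def)
  finally show ?thesis .
qed

end

section \<open>Measurability and invariance of connection events\<close>

context poisson_boolean
begin

lemma occupied_inflate_approx:
  assumes "dist p t < \<delta>"
  shows "cball (fst p) (snd p) \<subseteq> cball (fst t) (snd t + 2 * \<delta>)"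
proof -
  have "dist (fst p) (fst t) < \<delta>" "\<bar>snd p - snd t\<bar> < \<delta>"
    using assms dist_fst_le[of p t] dist_snd_le[of p t] by (auto simp: dist_real_def)
  moreover have "dist (fst t) y \<le> dist (fst p) (fst t) + dist (fst p) y" for y
    by (rule dist_triangle3)
  ultimately show ?thesis by (auto simp: dist_norm intro: order_trans) (smt (verit))
qed

text \<open>An increasing event that only depends on the occupied set in a bounded region, and that is
  closed under decreasing limits of the radii, agrees with an intersection over \<open>\<delta> = 1 / (n + 1)\<close>
  of countable unions of events \<open>there is a point \<delta>-close to each point of T\<close>, with \<open>T\<close> finite.\<close>

lemma pred_increasing_closed:
  assumes K: "bounded K"
    and inc: "\<And>\<omega> \<eta>. occupied \<omega> \<inter> K \<subseteq> occupied \<eta> \<Longrightarrow> Q \<omega> \<Longrightarrow> Q \<eta>"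
    and cl: "\<And>\<omega>. locally_finite \<omega> \<Longrightarrow> (\<And>\<delta>. \<delta> > 0 \<Longrightarrow> Q (inflate \<delta> \<omega>)) \<Longrightarrow> Q \<omega>"
  shows "Measurable.pred V Q"
proof -
  obtain D :: "((real \<times> real) \<times> real) set" where D: "countable D"
    "\<And>X. open X \<Longrightarrow> X \<noteq> {} \<Longrightarrow> \<exists>d\<in>D. d \<in> X"
    using countable_dense_exists by blast
  obtain N where N: "K \<subseteq> {-N..N} \<times> {-N..N}" using bounded_subset_square[OF K] by blast
  define R where "R = (\<lambda>\<delta> \<omega>. \<exists>T\<in>{T. finite T \<and> T \<subseteq> D}. Q (inflate (2 * \<delta>) T) \<and> (\<forall>t\<in>T. \<not> \<omega> \<inter> (ball t \<delta> \<inter> space E) = {}))"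
  have ball_fin: "ball t \<delta> \<inter> space E \<in> sets E \<and> emeasure E (ball t \<delta> \<inter> space E) < \<infinity>" for t \<delta>
  proof
    have "(\<lambda>p. p) -` ball t \<delta> \<inter> space E \<in> sets E"
      by (intro measurable_sets[OF measurable_E_borel]) simp
    then show "ball t \<delta> \<inter> space E \<in> sets E" by (simp add: vimage_def)
    have "p \<in> reach (fst (fst t) - \<delta>) (fst (fst t) + \<delta>) (snd (fst t) - \<delta>) (snd (fst t) + \<delta>)"
      if "p \<in> ball t \<delta> \<inter> space E" for p
    proof -
      have "dist (fst p) (fst t) < \<delta>" "0 \<le> snd p"
        using that dist_fst_le[of p t] by (auto simp: space_E dist_commute mem_Times_iff)
      then show ?thesis
        using dist_fst_le[of "fst p" "fst t"] dist_snd_le[of "fst p" "fst t"]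
        by (auto simp: reach_def dist_real_def)
    qed
    then show "emeasure E (ball t \<delta> \<inter> space E) < \<infinity>"
      by (intro emeasure_finite_of_reach[OF subsetI]) auto
  qed
  have "countable {T. finite T \<and> T \<subseteq> D}"
    using countable_Collect_finite_subset[OF D(1)] .
  moreover have "Measurable.pred V (\<lambda>\<omega>. Q (inflate (2 * \<delta>) T) \<and> (\<forall>t\<in>T. \<omega> \<inter> (ball t \<delta> \<inter> space E) \<noteq> {}))"
    if "finite T" for T \<delta>
    using ball_fin that by (intro pred_intros_logic pred_intros_finite void_pred) auto
  ultimately have predR: "Measurable.pred V (R \<delta>)" for \<delta>
    unfolding R_def pred_def by (intro sets.sets_Collect_countable_Ex') auto
  have "Measurable.pred V (\<lambda>\<omega>. \<forall>n::nat. R (1 / real (Suc n)) \<omega>)"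
    using predR by (intro pred_intros_countable) auto
  moreover have "Q \<omega> \<longleftrightarrow> (\<forall>n::nat. R (1 / real (Suc n)) \<omega>)" if "\<omega> \<in> space V" for \<omega>
  proof -
    have lf: "locally_finite \<omega>" and sub: "\<omega> \<subseteq> space E"
      using that by (auto simp: lf_configs_def space_E)
    have "R \<delta> \<omega>" if "Q \<omega>" "\<delta> > 0" for \<delta>
    proof -
      \<comment> \<open>Witness for \<open>R\<close>: each of the finitely many discs near
        \<open>K\<close> is replaced by a point of \<open>D\<close> within distance
        \<open>\<delta>\<close>.\<close>
      define S where "S = \<omega> \<inter> reach (-N) N (-N) N"
      have S: "finite S" "S \<subseteq> \<omega>" unfolding S_def using locally_finite_reach[OF lf] by auto
      have "\<exists>t. t \<in> D \<and> dist p t < \<delta>" for p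
        using D(2)[of "ball p \<delta>"] \<open>\<delta> > 0\<close> by auto
      then obtain t where t: "\<And>p. t p \<in> D" "\<And>p. dist p (t p) < \<delta>" by metis
      have "occupied \<omega> \<inter> K \<subseteq> occupied S" unfolding S_def using occupied_local[OF N, of \<omega>] by blast
      also have "\<dots> \<subseteq> occupied (inflate (2 * \<delta>) (t ` S))"
        unfolding occupied_inflate unfolding occupied_eq using occupied_inflate_approx[OF t(2)] by blast
      finally have "Q (inflate (2 * \<delta>) (t ` S))" using inc \<open>Q \<omega>\<close> by blast
      moreover have "\<omega> \<inter> (ball (t p) \<delta> \<inter> space E) \<noteq> {}" if "p \<in> S" for p
      proof -
        have "p \<in> \<omega> \<inter> (ball (t p) \<delta> \<inter> space E)"
          using that S(2) sub t(2)[of p] by (auto simp: dist_commute)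
        then show ?thesis by blast
      qed
      ultimately show ?thesis unfolding R_def using S(1) t(1) by (intro bexI[of _ "t ` S"]) auto
    qed
    moreover have "Q \<omega>" if R: "\<And>n::nat. R (1 / real (Suc n)) \<omega>"
    proof (rule cl[OF lf])
      fix \<delta> :: real assume "\<delta> > 0"
      \<comment> \<open>A quarter of \<open>\<delta>\<close>, because the inflation of
        \<open>T\<close> and the displacement of its points each cost \<open>2 * e\<close>.\<close>
      then obtain n :: nat where "inverse (real (Suc n)) < \<delta> / 4"
        using reals_Archimedean[of "\<delta> / 4"] by (metis divide_pos_pos zero_less_numeral)
      then have n: "4 * (1 / real (Suc n)) \<le> \<delta>" unfolding inverse_eq_divide by linarith
      define e where "e = 1 / real (Suc n)"
      obtain T where T: "Q (inflate (2 * e) T)" "\<And>t. t \<in> T \<Longrightarrow> \<omega> \<inter> (ball t e \<inter> space E) \<noteq> {}"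
        using R[of n] unfolding R_def e_def[symmetric] by blast
      have "occupied (inflate (2 * e) T) \<subseteq> occupied (inflate \<delta> \<omega>)"
      proof
        fix y assume "y \<in> occupied (inflate (2 * e) T)"
        then obtain t where t: "t \<in> T" "y \<in> cball (fst t) (snd t + 2 * e)"
          unfolding occupied_inflate by blast
        then obtain p where p: "p \<in> \<omega>" "dist t p < e" using T(2)[of t] by (auto simp: ball_def)
        have "cball (fst (fst t, snd t + 2 * e)) (snd (fst t, snd t + 2 * e)) \<subseteq>
           cball (fst (fst p, snd p + 2 * e)) (snd (fst p, snd p + 2 * e) + 2 * e)"
          using p(2) by (intro occupied_inflate_approx) (simp add: dist_prod_def)
        then have "y \<in> cball (fst p) (snd p + \<delta>)"
          using t(2) n unfolding e_def by auto
        then show "y \<in> occupied (inflate \<delta> \<omega>)" unfolding occupied_inflate using p(1) by blast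
      qed
      then show "Q (inflate \<delta> \<omega>)" using inc T(1) by blast
    qed
    ultimately show ?thesis by auto
  qed
  ultimately show ?thesis by (subst measurable_cong) auto
qed

lemma pred_connects_occupied:
  assumes "compact K" "convex K" "closed A" "closed B"
  shows "Measurable.pred V (\<lambda>\<omega>. connects K A B (occupied \<omega>))"
  using assms compact_imp_bounded[OF assms(1)]
  by (intro pred_increasing_closed[of K]) (auto intro: connects_inflate_limit elim: connects_mono)

text \<open>The complement is increasing in the occupied set, and it is closed under decreasing
  radii because a vacant path tolerates a small inflation.\<close>

lemma pred_connects_vacant:
  assumes "compact K"
  shows "Measurable.pred V (\<lambda>\<omega>. connects K A B (vacant \<omega>))"
proof -
  have "Measurable.pred V (\<lambda>\<omega>. \<not> connects K A B (vacant \<omega>))"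
  proof (rule pred_increasing_closed)
    show "bounded K" using assms by (rule compact_imp_bounded)
    fix \<omega> \<eta> assume "occupied \<omega> \<inter> K \<subseteq> occupied \<eta>" "\<not> connects K A B (vacant \<omega>)"
    then show "\<not> connects K A B (vacant \<eta>)"
      using connects_mono[of K A B "vacant \<eta>" "vacant \<omega>"] by (auto simp: vacant_def)
  next
    fix \<omega> assume "locally_finite \<omega>" "\<And>\<delta>. \<delta> > 0 \<Longrightarrow> \<not> connects K A B (vacant (inflate \<delta> \<omega>))"
    then show "\<not> connects K A B (vacant \<omega>)" using vacant_inflate[OF _ assms] by blast
  qed
  from pred_intros_logic(2)[OF this] show ?thesis by simp
qed

lemma hcross_eq_connects: "hcross C a b c d \<longleftrightarrow> connects ({a..b} \<times> {c..d}) {p. fst p = a} {p. fst p = b} C"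
  unfolding hcross_def connects_def by auto

lemma vcross_eq_connects: "vcross C a b c d \<longleftrightarrow> connects ({a..b} \<times> {c..d}) {p. snd p = c} {p. snd p = d} C"
  unfolding vcross_def connects_def by auto

lemma closed_coord: "closed {p::real \<times> real. fst p = a}" "closed {p::real \<times> real. snd p = a}"
  by (intro closed_Collect_eq continuous_intros)+

lemma pred_hcross [measurable]: "Measurable.pred V (\<lambda>\<omega>. hcross (occupied \<omega>) a b c d)"
  unfolding hcross_eq_connects
  by (intro pred_connects_occupied compact_Times convex_Times closed_coord) auto

lemma pred_vcross [measurable]: "Measurable.pred V (\<lambda>\<omega>. vcross (occupied \<omega>) a b c d)"
  unfolding vcross_eq_connects
  by (intro pred_connects_occupied compact_Times convex_Times closed_coord) auto

lemma pred_origin_to_infinity [measurable]: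
  "Measurable.pred V (\<lambda>\<omega>. origin_to_infinity (occupied \<omega>))"
  "Measurable.pred V (\<lambda>\<omega>. origin_to_infinity (vacant \<omega>))"
  unfolding origin_to_infinity_iff_connects
  by (intro pred_intros_countable pred_connects_occupied pred_connects_vacant; simp)+

lemma Cross_iff: "Cross r h \<omega> \<longleftrightarrow> hcross (occupied \<omega>) 0 r 0 h"
proof
  assume "Cross r h \<omega>"
  then show "hcross (occupied \<omega>) 0 r 0 h"
    unfolding Cross_def hcross_def path_component_def by fastforce
next
  assume "hcross (occupied \<omega>) 0 r 0 h"
  then obtain p q g where g: "fst p = 0" "fst q = r" "path g"
    "path_image g \<subseteq> occupied \<omega> \<inter> ({0..r} \<times> {0..h})" "pathstart g = p" "pathfinish g = q"
    unfolding hcross_def path_component_def by blast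
  then have "p \<in> {0..r} \<times> {0..h}" "q \<in> {0..r} \<times> {0..h}"
    using pathstart_in_path_image[of g] pathfinish_in_path_image[of g] by blast+
  with g show "Cross r h \<omega>" unfolding Cross_def by (intro exI[of _ g]) (auto simp: mem_Times_iff)
qed

section \<open>Translations and the reflection in the diagonal\<close>

definition move :: "(real \<times> real \<Rightarrow> real \<times> real) \<Rightarrow> (real \<times> real) \<times> real \<Rightarrow> (real \<times> real) \<times> real" where
  "move h p = (h (fst p), snd p)"

lemma occupied_move:
  assumes "\<And>x y. dist (h x) (h y) = dist x y" "surj h"
  shows "occupied (move h ` \<omega>) = h ` occupied \<omega>"
proof -
  have "cball (h x) z = h ` cball x z" for x z
  proof -
    have "y \<in> h ` cball x z" if "y \<in> cball (h x) z" for y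
    proof -
      obtain w where "y = h w" using assms(2) by (metis surjD)
      with that show ?thesis using assms(1) by auto
    qed
    moreover have "h y \<in> cball (h x) z" if "y \<in> cball x z" for y
      using that assms(1)[of x y] by simp
    ultimately show ?thesis by blast
  qed
  then show ?thesis unfolding occupied_eq move_def by auto
qed

lemma measurable_move:
  assumes "h \<in> measurable borel borel" "distr lborel lborel h = (lborel :: (real \<times> real) measure)"
  shows "move h \<in> measurable E E" "distr E E (move h) = E"
proof -
  have h: "h \<in> measurable lborel lborel" using assms(1) by simp
  show "move h \<in> measurable E E"
    unfolding move_def[abs_def] E_def using h by measurable
  interpret \<mu>: prob_space \<mu> by (rule prob_space_\<mu>)
  have id: "distr \<mu> \<mu> (\<lambda>x. x) = \<mu>" by (rule distr_id)
  have "distr lborel lborel h \<Otimes>\<^sub>M distr \<mu> \<mu> (\<lambda>x. x) = distr (lborel \<Otimes>\<^sub>M \<mu>) (lborel \<Otimes>\<^sub>M \<mu>) (\<lambda>(x, y). (h x, y))"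
    by (rule pair_measure_distr[OF h]) (simp_all add: id \<mu>.sigma_finite_measure_axioms)
  then show "distr E E (move h) = E"
    unfolding assms(2) id E_def move_def[abs_def] by (simp add: case_prod_beta')
qed

definition translation :: "real \<times> real \<Rightarrow> config \<Rightarrow> config" where
  "translation v \<omega> = move ((+) v) ` \<omega>"

lemma translation_props:
  shows "occupied (translation v \<omega>) = (+) v ` occupied \<omega>"
    and "move ((+) v) \<in> measurable E E" "distr E E (move ((+) v)) = E"
    and "\<omega> \<in> lf_configs \<Longrightarrow> translation v \<omega> \<in> lf_configs"
proof -
  show "occupied (translation v \<omega>) = (+) v ` occupied \<omega>"
    unfolding translation_def by (rule occupied_move) auto
  have "distr lborel lborel ((+) v) = (lborel :: (real \<times> real) measure)"
    using lborel_distr_plus[of v] by (simp cong: distr_cong)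
  then show "move ((+) v) \<in> measurable E E" "distr E E (move ((+) v)) = E"
    by (intro measurable_move; simp)+
  assume "\<omega> \<in> lf_configs"
  then have lf: "locally_finite \<omega>" and sub: "\<omega> \<subseteq> UNIV \<times> {0..}" by (auto simp: lf_configs_def)
  have "translation v \<omega> \<inter> reach a b c d \<subseteq> move ((+) v) ` (\<omega> \<inter> reach (a - fst v) (b - fst v) (c - snd v) (d - snd v))" for a b c d
    by (auto simp: translation_def move_def reach_def)
  then have "finite (translation v \<omega> \<inter> reach a b c d)" for a b c d
    using locally_finite_reach[OF lf] by (meson finite_imageI finite_subset)
  then show "translation v \<omega> \<in> lf_configs"
    using sub by (auto simp: lf_configs_def locally_finite_def translation_def move_def)
qed

lemma pr_translation: "0 \<le> \<rho> \<Longrightarrow> Measurable.pred V Q \<Longrightarrow> pr \<rho> (\<lambda>\<omega>. Q (translation v \<omega>)) = pr \<rho> Q"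
  using pr_image[OF translation_props(2,3) translation_props(4)[unfolded translation_def]]
  unfolding translation_def by blast

lemma pred_translation: "Measurable.pred V Q \<Longrightarrow> Measurable.pred V (\<lambda>\<omega>. Q (translation v \<omega>))"
  unfolding translation_def
  using measurable_compose[OF measurable_image[OF translation_props(2,3) translation_props(4)[unfolded translation_def]]]
  by blast

lemma swap_props:
  shows "occupied (move prod.swap ` \<omega>) = prod.swap ` occupied \<omega>"
    and "move prod.swap \<in> measurable E E" "distr E E (move prod.swap) = E"
    and "\<omega> \<in> lf_configs \<Longrightarrow> move prod.swap ` \<omega> \<in> lf_configs"
proof -
  show "occupied (move prod.swap ` \<omega>) = prod.swap ` occupied \<omega>"
    by (rule occupied_move) (auto simp: dist_prod_def add.commute)

  have "prod.swap \<in> measurable borel (borel :: (real \<times> real) measure)"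
    by (intro borel_measurable_continuous_onI continuous_on_swap)
  moreover have "distr lborel lborel prod.swap = (lborel :: (real \<times> real) measure)"
  proof -
    have "lborel = distr lborel (lborel \<Otimes>\<^sub>M lborel) (\<lambda>(x, y). (y, x :: real) :: real \<times> real)"
      using lborel_pair.distr_pair_swap unfolding lborel_prod .
    then show ?thesis
      by (simp add: lborel_prod prod.swap_def[abs_def] case_prod_beta')
  qed
  ultimately show "move prod.swap \<in> measurable E E" "distr E E (move prod.swap) = E"
    by (intro measurable_move; simp)+
  assume "\<omega> \<in> lf_configs"
  then have lf: "locally_finite \<omega>" and sub: "\<omega> \<subseteq> UNIV \<times> {0..}" by (auto simp: lf_configs_def)
  have "move prod.swap ` \<omega> \<inter> reach a b c d \<subseteq> move prod.swap ` (\<omega> \<inter> reach c d a b)" for a b c d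
    by (auto simp: move_def reach_def)
  then have "finite (move prod.swap ` \<omega> \<inter> reach a b c d)" for a b c d
    using locally_finite_reach[OF lf] by (meson finite_imageI finite_subset)
  then show "move prod.swap ` \<omega> \<in> lf_configs"
    using sub by (auto simp: lf_configs_def locally_finite_def move_def)
qed

lemma hcross_translate: "hcross ((+) v ` C) a b c d \<longleftrightarrow> hcross C (a - fst v) (b - fst v) (c - snd v) (d - snd v)"
proof -
  have *: "hcross ((+) v ` C) (a + fst v) (b + fst v) (c + snd v) (d + snd v)" if h: "hcross C a b c d" for v C a b c d
  proof -
    obtain p q where pq: "fst p = a" "fst q = b" "path_component (C \<inter> ({a..b} \<times> {c..d})) p q"
      using h unfolding hcross_def by blast
    have "path_component ((+) v ` C \<inter> ({a + fst v..b + fst v} \<times> {c + snd v..d + snd v})) (v + p) (v + q)"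
      by (rule path_component_image[OF pq(3)], intro continuous_intros) (cases v, auto)
    with pq show ?thesis unfolding hcross_def by (intro exI[of _ "v + p"] exI[of _ "v + q"]) auto
  qed
  show ?thesis
    using *[of C "a - fst v" "b - fst v" "c - snd v" "d - snd v" v] *[of "(+) v ` C" a b c d "- v"]
    by (auto simp: image_image)
qed

lemma pr_hcross:
  assumes "0 \<le> \<rho>"
  shows "pr \<rho> (\<lambda>\<omega>. hcross (occupied \<omega>) a b c d) = pr \<rho> (\<lambda>\<omega>. hcross (occupied \<omega>) 0 (b - a) 0 (d - c))"
proof -
  have "pr \<rho> (\<lambda>\<omega>. hcross (occupied \<omega>) a b c d) = pr \<rho> (\<lambda>\<omega>. hcross (occupied (translation (a, c) \<omega>)) a b c d)"
    by (rule pr_translation[symmetric, OF assms pred_hcross])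
  then show ?thesis by (simp add: translation_props(1) hcross_translate)
qed

lemma pr_vcross:
  assumes "0 \<le> \<rho>"
  shows "pr \<rho> (\<lambda>\<omega>. vcross (occupied \<omega>) a b c d) = pr \<rho> (\<lambda>\<omega>. hcross (occupied \<omega>) 0 (d - c) 0 (b - a))"
proof -
  have "pr \<rho> (\<lambda>\<omega>. vcross (occupied \<omega>) a b c d) = pr \<rho> (\<lambda>\<omega>. hcross (occupied (move prod.swap ` \<omega>)) c d a b)"
    unfolding vcross_conv_hcross swap_props(1) ..
  also have "\<dots> = pr \<rho> (\<lambda>\<omega>. hcross (occupied \<omega>) c d a b)"
    by (rule pr_image[OF swap_props(2-4) assms pred_hcross])
  finally show ?thesis using pr_hcross[OF assms, of c d a b] by simp
qed

end

section \<open>Renormalisation inequalities\<close>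

text \<open>After \<open>n\<close> steps the starting value contributes at most 2^(-n). Only the
  scales \<open>r\<close> and \<open>3 * r\<close> are related, so the bound by 1 on all starting
  scales provides the uniformity.\<close>

lemma tendsto_zero_of_recursion:
  fixes p e :: "real \<Rightarrow> real"
  assumes R: "0 < R" and p: "\<And>r. R \<le> r \<Longrightarrow> 0 \<le> p r \<and> p r \<le> 1"
    and rec: "\<And>r. R \<le> r \<Longrightarrow> p (3 * r) \<le> e r + p r / 2" and e: "(e \<longlongrightarrow> 0) at_top"
  shows "(p \<longlongrightarrow> 0) at_top"
proof (rule tendstoI)
  fix \<eta> :: real assume \<eta>: "0 < \<eta>"
  have "eventually (\<lambda>r. e r < \<eta> / 4) at_top" using order_tendstoD(2)[OF e, of "\<eta> / 4"] \<eta> by simp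
  then obtain R0 where R0: "\<And>r. R0 \<le> r \<Longrightarrow> e r < \<eta> / 4" by (auto simp: eventually_at_top_linorder)
  define R1 where "R1 = max R0 R"
  \<comment> \<open>The level \<open>\<eta> / 2\<close> reproduces itself under the recursion:
    \<open>\<eta> / 4 + (\<eta> / 2) / 2\<close>.\<close>
  have bound: "p r \<le> \<eta> / 2 + (1 / 2) ^ n" if "3 ^ n * R1 \<le> r" for n r
    using that
  proof (induction n arbitrary: r)
    case 0
    then have "p r \<le> 1" using p[of r] by (simp add: R1_def)
    with \<eta> show ?case by simp
  next
    case (Suc n)
    then have 1: "3 ^ n * R1 \<le> r / 3" by simp
    have "1 * R1 \<le> 3 ^ n * R1" using R by (intro mult_right_mono) (auto simp: R1_def)
    with 1 have "R1 \<le> r / 3" by simp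
    then have "p r \<le> e (r / 3) + p (r / 3) / 2" "e (r / 3) < \<eta> / 4"
      using rec[of "r / 3"] R0[of "r / 3"] by (auto simp: R1_def)
    with Suc.IH[OF 1] show ?case by simp
  qed
  obtain n where n: "(1 / 2) ^ n < \<eta> / 2" using real_arch_pow_inv[of "\<eta> / 2" "1 / 2"] \<eta> by auto
  show "eventually (\<lambda>r. dist (p r) 0 < \<eta>) at_top"
    using eventually_ge_at_top[of "max R (3 ^ n * R1)"]
    by eventually_elim (use bound[of n] n p in \<open>fastforce simp: dist_real_def\<close>)
qed

definition short :: "real \<Rightarrow> ((real \<times> real) \<times> real) set" where
  "short s = {p. snd p \<le> s}"

text \<open>Phrased through the occupied set, so that it is immediate for crossings;
  \<open>local_inD\<close> turns it into dependence on the points in \<open>reach\<close>.\<close>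

definition local_in :: "real \<Rightarrow> real \<Rightarrow> real \<Rightarrow> real \<Rightarrow> (config \<Rightarrow> bool) \<Rightarrow> bool" where
  "local_in a b c d Q \<longleftrightarrow> (\<forall>\<omega> \<eta>. occupied \<omega> \<inter> ({a..b} \<times> {c..d}) = occupied \<eta> \<inter> ({a..b} \<times> {c..d}) \<longrightarrow> Q \<omega> \<longrightarrow> Q \<eta>)"

lemma local_inD:
  assumes "local_in a b c d Q" "\<omega> \<inter> reach a b c d = \<eta> \<inter> reach a b c d"
  shows "Q \<omega> \<longleftrightarrow> Q \<eta>"
  using assms occupied_local[of "{a..b} \<times> {c..d}" a b c d \<omega>] occupied_local[of "{a..b} \<times> {c..d}" a b c d \<eta>]
  unfolding local_in_def by (metis order_refl)

lemma local_in_hcross: "local_in a b c d (\<lambda>\<omega>. hcross (occupied \<omega>) a b c d)"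
  unfolding local_in_def by (auto intro: hcross_mono)

lemma local_in_not: "local_in a b c d Q \<Longrightarrow> local_in a b c d (\<lambda>\<omega>. \<not> Q \<omega>)"
  unfolding local_in_def by metis

context poisson_boolean
begin

lemma sets_short: "short s \<inter> space E \<in> sets E"
proof -
  have "{p \<in> space E. snd p \<le> s} \<in> sets E" by measurable
  moreover have "{p \<in> space E. snd p \<le> s} = short s \<inter> space E" by (auto simp: short_def)
  ultimately show ?thesis by simp
qed

lemma pred_short:
  assumes "Measurable.pred V Q" shows "Measurable.pred V (\<lambda>\<omega>. Q (\<omega> \<inter> short s))"
proof -
  have "Measurable.pred V (\<lambda>\<omega>. Q (\<omega> \<inter> (short s \<inter> space E)))"
    using measurable_compose[OF measurable_Int[OF sets_short] assms] .
  moreover have "\<omega> \<inter> (short s \<inter> space E) = \<omega> \<inter> short s" if "\<omega> \<in> space V" for \<omega>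
    using that by (auto simp: lf_configs_def space_E)
  ultimately show ?thesis
    using measurable_cong[of V "\<lambda>\<omega>. Q (\<omega> \<inter> (short s \<inter> space E))" "\<lambda>\<omega>. Q (\<omega> \<inter> short s)"] by simp
qed

text \<open>A disc of radius at most \<open>s\<close> that reaches the first rectangle has its
  centre within \<open>s\<close> of it, hence lies in \<open>B\<close>; one that reaches the second
  rectangle does not, as the gap exceeds \<open>2 * s\<close>.\<close>

lemma pr_independent_regions:
  assumes \<rho>: "0 \<le> \<rho>" and Q: "Measurable.pred V Q" "local_in a b c d Q"
    and Q': "Measurable.pred V Q'" "local_in a' b' c' d' Q'"
    and sep: "b + 2 * s < a' \<or> d + 2 * s < c'"
  shows "pr \<rho> (\<lambda>\<omega>. Q (\<omega> \<inter> short s) \<and> Q' (\<omega> \<inter> short s)) = pr \<rho> (\<lambda>\<omega>. Q (\<omega> \<inter> short s)) * pr \<rho> (\<lambda>\<omega>. Q' (\<omega> \<inter> short s))"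
proof -
  define B where "B = {p \<in> space E. a - s \<le> fst (fst p) \<and> fst (fst p) \<le> b + s \<and> c - s \<le> snd (fst p) \<and> snd (fst p) \<le> d + s}"
  have B: "B \<in> sets E" unfolding B_def by measurable
  have "Q (\<omega> \<inter> short s) \<longleftrightarrow> Q (\<omega> \<inter> B \<inter> short s)" if "\<omega> \<in> lf_configs" for \<omega>
    using that by (intro local_inD[OF Q(2)]) (auto simp: B_def reach_def short_def lf_configs_def space_E)
  moreover have "Q' (\<omega> \<inter> short s) \<longleftrightarrow> Q' ((\<omega> - B) \<inter> short s)" if "\<omega> \<in> lf_configs" for \<omega>
    using that sep by (intro local_inD[OF Q'(2)]) (auto simp: B_def reach_def short_def lf_configs_def space_E)
  ultimately show ?thesis by (intro pr_independent[OF \<rho> B pred_short pred_short] Q(1) Q'(1))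
qed

text \<open>Unless a disc of radius above \<open>s\<close> reaches the rectangle, the cut changes
  nothing there. Hence the bound holds for crossings and for their failures alike.\<close>

lemma pr_le_short:
  assumes \<rho>: "0 \<le> \<rho>" and Q: "Measurable.pred V Q" "local_in a b c d Q"
    and ab: "a \<le> b" "c \<le> d" and s: "0 < s" and k: "b - a \<le> k * s" "d - c \<le> k * s"
  shows "pr \<rho> Q \<le> pr \<rho> (\<lambda>\<omega>. Q (\<omega> \<inter> short s)) + \<rho> * ((k + 2)\<^sup>2 * tail s)"
proof -
  let ?A = "reach a b c d \<inter> tall s \<inter> space E"
  have A: "emeasure E ?A \<le> ennreal ((k + 2)\<^sup>2 * tail s)" by (rule measure_reach_tall_le[OF ab s k])
  have m: "Measurable.pred V (\<lambda>\<omega>. \<not> \<omega> \<inter> ?A = {})"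
    using A by (intro pred_intros_logic void_pred sets_reach_tall) (auto intro: le_less_trans)
  have "pr \<rho> Q \<le> pr \<rho> (\<lambda>\<omega>. Q (\<omega> \<inter> short s) \<or> \<not> \<omega> \<inter> ?A = {})"
  proof (rule pr_mono[OF \<rho>])
    show "Measurable.pred V (\<lambda>\<omega>. Q (\<omega> \<inter> short s) \<or> \<not> \<omega> \<inter> ?A = {})"
      by (intro pred_intros_logic pred_short Q m)
    fix \<omega> assume \<omega>: "\<omega> \<in> lf_configs" "Q \<omega>"
    have "Q (\<omega> \<inter> short s)" if "\<omega> \<inter> ?A = {}"
    proof -
      have "\<omega> \<inter> reach a b c d = \<omega> \<inter> short s \<inter> reach a b c d"
        using that \<omega>(1) by (fastforce simp: tall_def short_def lf_configs_def space_E not_less)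
      with local_inD[OF Q(2)] \<omega>(2) show ?thesis by metis
    qed
    then show "Q (\<omega> \<inter> short s) \<or> \<not> \<omega> \<inter> ?A = {}" by blast
  qed
  also have "\<dots> \<le> pr \<rho> (\<lambda>\<omega>. Q (\<omega> \<inter> short s)) + pr \<rho> (\<lambda>\<omega>. \<omega> \<inter> ?A \<noteq> {})"
    by (rule pr_disj[OF \<rho> pred_short[OF Q(1)] m])
  also have "pr \<rho> (\<lambda>\<omega>. \<omega> \<inter> ?A \<noteq> {}) \<le> \<rho> * ((k + 2)\<^sup>2 * tail s)"
    by (rule pr_hit_le[OF \<rho> sets_reach_tall A]) (simp add: tail_nonneg)
  finally show ?thesis by simp
qed

lemma tail_tendsto: "(tail \<longlongrightarrow> 0) at_top"
proof -
  have "((\<lambda>s. LINT z|\<mu>. indicator {s<..} z * z\<^sup>2) \<longlongrightarrow> (LINT z|\<mu>. 0)) at_top"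
  proof (rule integral_dominated_convergence_at_top)
    show "integrable \<mu> (\<lambda>z. z\<^sup>2)" by (rule second_moment)
    show "(\<lambda>z. indicator {s<..} z * z\<^sup>2) \<in> borel_measurable \<mu>" for s :: real
      using integrable_tail[of s] by (rule borel_measurable_integrable)
    show "\<forall>\<^sub>F s in at_top. AE z in \<mu>. norm (indicator {s<..} z * z\<^sup>2) \<le> z\<^sup>2"
      by (auto simp: indicator_def)
    have "eventually (\<lambda>s. indicator {s<..} z * z\<^sup>2 = 0) at_top" for z :: real
      using eventually_ge_at_top[of z] by eventually_elim auto
    then show "AE z in \<mu>. ((\<lambda>s. indicator {s<..} z * z\<^sup>2) \<longlongrightarrow> 0) at_top"
      by (auto intro!: tendsto_eventually)
  qed auto
  then show ?thesis by (simp add: tail_def[abs_def])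
qed

lemma tail_le: "tail s \<le> (LINT z|\<mu>. z\<^sup>2)"
  unfolding tail_def using integrable_tail second_moment by (intro integral_mono) (auto simp: indicator_def)

lemma short_move: "move h ` \<omega> \<inter> short s = move h ` (\<omega> \<inter> short s)"
  by (auto simp: move_def short_def)

lemma pr_hcross_short:
  assumes "0 \<le> \<rho>"
  shows "pr \<rho> (\<lambda>\<omega>. \<not> hcross (occupied (\<omega> \<inter> short s)) a b c d) = pr \<rho> (\<lambda>\<omega>. \<not> hcross (occupied (\<omega> \<inter> short s)) 0 (b - a) 0 (d - c))"
proof -
  have "pr \<rho> (\<lambda>\<omega>. \<not> hcross (occupied (\<omega> \<inter> short s)) a b c d) =
    pr \<rho> (\<lambda>\<omega>. \<not> hcross (occupied (translation (a, c) \<omega> \<inter> short s)) a b c d)"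
    by (rule pr_translation[symmetric, OF assms]) (intro pred_intros_logic pred_short pred_hcross)
  also have "\<dots> = pr \<rho> (\<lambda>\<omega>. \<not> hcross (occupied (translation (a, c) (\<omega> \<inter> short s))) a b c d)"
    unfolding translation_def short_move ..
  finally show ?thesis by (simp add: translation_props(1) hcross_translate)
qed

lemma pr_vcross_short:
  assumes "0 \<le> \<rho>"
  shows "pr \<rho> (\<lambda>\<omega>. \<not> vcross (occupied (\<omega> \<inter> short s)) a b c d) = pr \<rho> (\<lambda>\<omega>. \<not> hcross (occupied (\<omega> \<inter> short s)) 0 (d - c) 0 (b - a))"
proof -
  have "pr \<rho> (\<lambda>\<omega>. \<not> vcross (occupied (\<omega> \<inter> short s)) a b c d) =
    pr \<rho> (\<lambda>\<omega>. \<not> hcross (occupied (move prod.swap ` \<omega> \<inter> short s)) c d a b)"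
    unfolding vcross_conv_hcross short_move swap_props(1) ..
  also have "\<dots> = pr \<rho> (\<lambda>\<omega>. \<not> hcross (occupied (\<omega> \<inter> short s)) c d a b)"
  proof (rule pr_image[OF swap_props(2-4) assms])
    show "Measurable.pred V (\<lambda>\<omega>. \<not> hcross (occupied (\<omega> \<inter> short s)) c d a b)"
      by (intro pred_intros_logic pred_short pred_hcross)
  qed
  finally show ?thesis using pr_hcross_short[OF assms, of s c d a b] by simp
qed

section \<open>Crossings in the short direction\<close>

definition easy :: "real \<Rightarrow> real \<Rightarrow> real" where
  "easy \<rho> r = pr \<rho> (\<lambda>\<omega>. hcross (occupied \<omega>) 0 r 0 (3 * r))"

lemma easy_bounds: "0 \<le> \<rho> \<Longrightarrow> 0 \<le> easy \<rho> r \<and> easy \<rho> r \<le> 1"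
  unfolding easy_def by (rule pr_bounds)

text \<open>Each of the twelve bands of \<open>strip_crossing\<close> contributes two events: the
  crossing of a window, of probability \<open>easy \<rho> r\<close>, and the crossing of a square,
  which is at most as likely.\<close>

lemma pr_strip_le:
  assumes \<rho>: "0 \<le> \<rho>" and r: "0 < r"
  shows "pr \<rho> (\<lambda>\<omega>. hcross (occupied \<omega>) 0 r 0 (9 * r)) \<le> 24 * easy \<rho> r"
proof -
  let ?H = "\<lambda>j \<omega>. hcross (occupied \<omega>) 0 r (real_of_int j * r) ((real_of_int j + 3) * r)"
  let ?V = "\<lambda>j \<omega>. vcross (occupied \<omega>) 0 r (real_of_int j * r) ((real_of_int j + 1) * r)"
  have HV: "pr \<rho> (\<lambda>\<omega>. ?H j \<omega> \<or> ?V j \<omega>) \<le> 2 * easy \<rho> r" for j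
  proof -
    have "pr \<rho> (\<lambda>\<omega>. ?H j \<omega> \<or> ?V j \<omega>) \<le> pr \<rho> (?H j) + pr \<rho> (?V j)"
      by (rule pr_disj[OF \<rho> pred_hcross pred_vcross])
    also have "pr \<rho> (?H j) = easy \<rho> r"
      unfolding easy_def by (subst pr_hcross[OF \<rho>]) (simp add: algebra_simps)
    also have "pr \<rho> (?V j) = pr \<rho> (\<lambda>\<omega>. hcross (occupied \<omega>) 0 r 0 r)"
      by (subst pr_vcross[OF \<rho>]) (simp add: algebra_simps)
    also have "\<dots> \<le> easy \<rho> r"
      unfolding easy_def using r by (intro pr_mono[OF \<rho> pred_hcross]) (auto elim: hcross_mono)
    finally show ?thesis by simp
  qed
  have "pr \<rho> (\<lambda>\<omega>. hcross (occupied \<omega>) 0 r 0 (9 * r)) \<le> pr \<rho> (\<lambda>\<omega>. \<exists>j\<in>{-1..10::int}. ?H j \<omega> \<or> ?V j \<omega>)"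
    using strip_crossing[OF _ r]
    by (intro pr_mono[OF \<rho>] pred_intros_finite pred_intros_logic pred_hcross pred_vcross) auto
  also have "\<dots> \<le> (\<Sum>j\<in>{-1..10::int}. pr \<rho> (\<lambda>\<omega>. ?H j \<omega> \<or> ?V j \<omega>))"
    by (intro pr_bex[OF \<rho>] pred_intros_logic pred_hcross pred_vcross) auto
  also have "\<dots> \<le> (\<Sum>j\<in>{-1..10::int}. 2 * easy \<rho> r)" by (intro sum_mono HV)
  finally show ?thesis by simp
qed

text \<open>Both outer strips of width \<open>r\<close> are crossed, and for radii at most
  \<open>r / 4\<close> their gap \<open>r\<close> makes them independent. The length
  \<open>9 * r\<close> is 36 times \<open>r / 4\<close>, whence 1444 = (36 + 2)^2; and 576 =
  24^2.\<close>

lemma easy_recursion: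
  assumes \<rho>: "0 \<le> \<rho>" and r: "0 < r"
  shows "easy \<rho> (3 * r) \<le> 1444 * \<rho> * tail (r / 4) + 576 * (easy \<rho> r)\<^sup>2"
proof -
  let ?s = "r / 4"
  let ?Q = "\<lambda>\<omega>. hcross (occupied \<omega>) 0 r 0 (9 * r)"
  let ?Q' = "\<lambda>\<omega>. hcross (occupied \<omega>) (2 * r) (3 * r) 0 (9 * r)"
  have "easy \<rho> (3 * r) \<le> pr \<rho> (\<lambda>\<omega>. hcross (occupied (\<omega> \<inter> short ?s)) 0 (3 * r) 0 (9 * r)) + \<rho> * ((36 + 2)\<^sup>2 * tail ?s)"
  proof -
    have "easy \<rho> (3 * r) = pr \<rho> (\<lambda>\<omega>. hcross (occupied \<omega>) 0 (3 * r) 0 (9 * r))" by (simp add: easy_def)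
    then show ?thesis
      using r pr_le_short[OF \<rho> pred_hcross[of 0 "3 * r" 0 "9 * r"] local_in_hcross, of "r / 4" 36] by simp
  qed
  also have "pr \<rho> (\<lambda>\<omega>. hcross (occupied (\<omega> \<inter> short ?s)) 0 (3 * r) 0 (9 * r)) \<le>
    pr \<rho> (\<lambda>\<omega>. ?Q (\<omega> \<inter> short ?s) \<and> ?Q' (\<omega> \<inter> short ?s))"
  proof (rule pr_mono[OF \<rho>])
    show "Measurable.pred V (\<lambda>\<omega>. ?Q (\<omega> \<inter> short ?s) \<and> ?Q' (\<omega> \<inter> short ?s))"
      by (intro pred_intros_logic pred_short pred_hcross)
    fix \<omega> assume "hcross (occupied (\<omega> \<inter> short ?s)) 0 (3 * r) 0 (9 * r)"
    then obtain p q where "fst p = 0" "fst q = 3 * r"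
      "path_component (occupied (\<omega> \<inter> short ?s) \<inter> ({0..3 * r} \<times> {0..9 * r})) p q"
      unfolding hcross_def by blast
    with r show "?Q (\<omega> \<inter> short ?s) \<and> ?Q' (\<omega> \<inter> short ?s)" by (auto intro: hcrossI_slab)
  qed
  also have "\<dots> = pr \<rho> (\<lambda>\<omega>. ?Q (\<omega> \<inter> short ?s)) * pr \<rho> (\<lambda>\<omega>. ?Q' (\<omega> \<inter> short ?s))"
    using r by (intro pr_independent_regions[OF \<rho> pred_hcross local_in_hcross pred_hcross local_in_hcross]) auto
  also have "\<dots> \<le> (24 * easy \<rho> r) * (24 * easy \<rho> r)"
  proof (rule mult_mono)
    have "pr \<rho> (\<lambda>\<omega>. ?Q (\<omega> \<inter> short ?s)) \<le> pr \<rho> ?Q"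
      by (intro pr_mono[OF \<rho> pred_hcross]) (auto elim!: hcross_mono dest: subsetD[OF occupied_mono, rotated])
    with pr_strip_le[OF \<rho> r] show "pr \<rho> (\<lambda>\<omega>. ?Q (\<omega> \<inter> short ?s)) \<le> 24 * easy \<rho> r" by simp
    have "pr \<rho> (\<lambda>\<omega>. ?Q' (\<omega> \<inter> short ?s)) \<le> pr \<rho> ?Q'"
      by (intro pr_mono[OF \<rho> pred_hcross]) (auto elim!: hcross_mono dest: subsetD[OF occupied_mono, rotated])
    also have "\<dots> = pr \<rho> ?Q" by (subst pr_hcross[OF \<rho>]) simp
    finally show "pr \<rho> (\<lambda>\<omega>. ?Q' (\<omega> \<inter> short ?s)) \<le> 24 * easy \<rho> r" using pr_strip_le[OF \<rho> r] by simp
  qed (use pr_bounds[OF \<rho>] easy_bounds[OF \<rho>] in auto)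
  finally show ?thesis by (simp add: power2_eq_square)
qed

text \<open>The threshold is 1 / (2 * 576).\<close>

lemma easy_half:
  assumes \<rho>: "0 \<le> \<rho>" and r: "0 < r" and small: "easy \<rho> r \<le> 1 / 1152"
  shows "easy \<rho> (3 * r) \<le> 1444 * \<rho> * tail (r / 4) + easy \<rho> r / 2"
proof -
  have "easy \<rho> r * easy \<rho> r \<le> (1 / 1152) * easy \<rho> r"
    using small easy_bounds[OF \<rho>, of r] by (intro mult_right_mono) auto
  with easy_recursion[OF \<rho> r] show ?thesis by (simp add: power2_eq_square)
qed

text \<open>All tails are at most the full second moment, so a small intensity controls the error at
  every scale at once. For the scales between 1 and 3, where the induction starts, it makes any disc
  near the rectangle unlikely.\<close>

lemma easy_tendsto_small_intensity: "\<exists>\<rho>>0. (easy \<rho> \<longlongrightarrow> 0) at_top"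
proof -
  define m where "m = (LINT z|\<mu>. z\<^sup>2)"
  define c where "c = measure E (reach 0 3 0 9 \<inter> space E)"
  have m: "0 \<le> m" unfolding m_def by simp
  have c: "0 \<le> c" "emeasure E (reach 0 3 0 9 \<inter> space E) \<le> ennreal c"
    unfolding c_def using emeasure_reach_finite[of 0 3 0 9] by (auto simp: emeasure_eq_ennreal_measure)
  \<comment> \<open>Both the error term and the bound at the initial scales become at most 1/2304,
    half of the threshold 1/1152, which the recursion then preserves.\<close>
  define \<rho> where "\<rho> = 1 / (2304 * (1444 * m + c + 1))"
  have \<rho>: "0 < \<rho>" unfolding \<rho>_def using m c by simp
  have \<rho>': "\<rho> * (1444 * m + c + 1) = 1 / 2304" unfolding \<rho>_def using m c(1) by (simp add: add_nonneg_eq_0_iff)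
  have "0 \<le> \<rho> * m" "0 \<le> \<rho> * c" using \<rho> m c by auto
  with \<rho>' \<rho> have \<rho>mc: "1444 * \<rho> * m \<le> 1 / 2304" "\<rho> * c \<le> 1 / 2304" by (auto simp: algebra_simps)
  have small: "easy \<rho> r \<le> 1 / 1152" if "1 \<le> r" "r < 3 ^ n" for n r
    using that
  proof (induction n arbitrary: r)
    case (Suc n)
    show ?case
    proof (cases "r < 3")
      case True
      have "easy \<rho> r \<le> pr \<rho> (\<lambda>\<omega>. \<omega> \<inter> (reach 0 3 0 9 \<inter> space E) \<noteq> {})"
        unfolding easy_def
      proof (rule pr_mono)
        show "Measurable.pred V (\<lambda>\<omega>. \<omega> \<inter> (reach 0 3 0 9 \<inter> space E) \<noteq> {})"
          by (intro pred_intros_logic void_pred sets_reach emeasure_reach_finite)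
        fix \<omega> assume \<omega>: "\<omega> \<in> lf_configs" "hcross (occupied \<omega>) 0 r 0 (3 * r)"
        then obtain p q where "path_component (occupied \<omega> \<inter> ({0..r} \<times> {0..3 * r})) p q"
          unfolding hcross_def by blast
        then have "p \<in> occupied \<omega> \<inter> ({0..r} \<times> {0..3 * r})" using path_component_mem by blast
        moreover have "{0..r} \<times> {0..3 * r} \<subseteq> {0..3} \<times> {0..9}" using True by auto
        ultimately obtain x where x: "x \<in> \<omega>" "p \<in> cball (fst x) (snd x)" "p \<in> {0..3} \<times> {0..9}"
          unfolding occupied_eq by blast
        then have "x \<in> reach 0 3 0 9" using in_reachI by blast
        then show "\<omega> \<inter> (reach 0 3 0 9 \<inter> space E) \<noteq> {}"
          using x(1) \<omega>(1) by (auto simp: lf_configs_def space_E)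
      qed (use \<rho> in auto)
      also have "\<dots> \<le> \<rho> * c" using \<rho> c by (intro pr_hit_le sets_reach) auto
      finally show ?thesis using \<rho>mc by simp
    next
      case False
      then have IH: "easy \<rho> (r / 3) \<le> 1 / 1152" using Suc by auto
      have "easy \<rho> (3 * (r / 3)) \<le> 1444 * \<rho> * tail (r / 3 / 4) + easy \<rho> (r / 3) / 2"
        using \<rho> Suc.prems IH by (intro easy_half) auto
      moreover have "1444 * \<rho> * tail (r / 3 / 4) \<le> 1444 * \<rho> * m"
        unfolding m_def using \<rho> tail_le by (intro mult_left_mono) auto
      ultimately show ?thesis using \<rho>mc IH by simp
    qed
  qed simp
  have small: "easy \<rho> r \<le> 1 / 1152" if "1 \<le> r" for r
    using small[OF that] real_arch_pow[of 3 r] by auto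
  have "(easy \<rho> \<longlongrightarrow> 0) at_top"
  proof (rule tendsto_zero_of_recursion)
    show "((\<lambda>r. 1444 * \<rho> * tail (r / 4)) \<longlongrightarrow> 0) at_top"
    proof (intro tendsto_mult_right_zero filterlim_compose[OF tail_tendsto])
      show "filterlim (\<lambda>r::real. r / 4) at_top at_top"
        unfolding filterlim_at_top
      proof
        fix Z :: real
        show "eventually (\<lambda>r. Z \<le> r / 4) at_top"
          using eventually_ge_at_top[of "4 * Z"] by eventually_elim auto
      qed
    qed
    show "easy \<rho> (3 * r) \<le> 1444 * \<rho> * tail (r / 4) + easy \<rho> r / 2" if "1 \<le> r" for r
      using easy_half[of \<rho> r] small[OF that] \<rho> that by simp
  qed (use easy_bounds \<rho> in auto)
  with \<rho> show ?thesis by blast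
qed

section \<open>Crossings in the long direction\<close>

text \<open>The cut \<open>s\<close> stays fixed while \<open>r\<close> grows. Dropping discs only
  destroys crossings, so a bound on \<open>fail\<close> also bounds the failure for the full
  configuration.\<close>

definition fail :: "real \<Rightarrow> real \<Rightarrow> real \<Rightarrow> real" where
  "fail s \<rho> r = pr \<rho> (\<lambda>\<omega>. \<not> hcross (occupied (\<omega> \<inter> short s)) 0 (3 * r) 0 r)"

lemma fail_bounds: "0 \<le> \<rho> \<Longrightarrow> 0 \<le> fail s \<rho> r \<and> fail s \<rho> r \<le> 1"
  unfolding fail_def by (rule pr_bounds)

lemma pr_not_long_le:
  assumes \<rho>: "0 \<le> \<rho>" and r: "0 < r"
  shows "pr \<rho> (\<lambda>\<omega>. \<not> hcross (occupied (\<omega> \<inter> short s)) 0 (9 * r) 0 r) \<le> 7 * fail s \<rho> r"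
proof -
  let ?H = "\<lambda>j \<omega>. hcross (occupied (\<omega> \<inter> short s)) (j * r) ((j + 3) * r) 0 r"
  let ?V = "\<lambda>j \<omega>. vcross (occupied (\<omega> \<inter> short s)) (j * r) ((j + 1) * r) 0 r"
  have mH: "Measurable.pred V (\<lambda>\<omega>. \<not> ?H j \<omega>)" and mV: "Measurable.pred V (\<lambda>\<omega>. \<not> ?V j \<omega>)" for j
    by (intro pred_intros_logic pred_short pred_hcross pred_vcross)+
  have H: "pr \<rho> (\<lambda>\<omega>. \<not> ?H j \<omega>) = fail s \<rho> r" for j
    unfolding fail_def by (subst pr_hcross_short[OF \<rho>]) (simp add: algebra_simps)
  have V: "pr \<rho> (\<lambda>\<omega>. \<not> ?V j \<omega>) \<le> fail s \<rho> r" for j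
  proof -
    have "pr \<rho> (\<lambda>\<omega>. \<not> ?V j \<omega>) = pr \<rho> (\<lambda>\<omega>. \<not> hcross (occupied (\<omega> \<inter> short s)) 0 r 0 r)"
      by (subst pr_vcross_short[OF \<rho>]) (simp add: algebra_simps)
    also have "\<dots> \<le> fail s \<rho> r" unfolding fail_def
    proof (rule pr_mono[OF \<rho>])
      show "Measurable.pred V (\<lambda>\<omega>. \<not> hcross (occupied (\<omega> \<inter> short s)) 0 (3 * r) 0 r)"
        by (intro pred_intros_logic pred_short pred_hcross)
      fix \<omega> assume "\<not> hcross (occupied (\<omega> \<inter> short s)) 0 r 0 r"
      then show "\<not> hcross (occupied (\<omega> \<inter> short s)) 0 (3 * r) 0 r"
        using r by (auto intro: hcrossI_slab simp: hcross_def[of _ 0 "3 * r"])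
    qed
    finally show ?thesis .
  qed
  have "pr \<rho> (\<lambda>\<omega>. \<not> hcross (occupied (\<omega> \<inter> short s)) 0 (9 * r) 0 r) \<le>
    pr \<rho> (\<lambda>\<omega>. (\<exists>j\<in>{0,2,4,6}. \<not> ?H j \<omega>) \<or> (\<exists>j\<in>{2,4,6}. \<not> ?V j \<omega>))"
  proof (rule pr_mono[OF \<rho>])
    show "Measurable.pred V (\<lambda>\<omega>. (\<exists>j\<in>{0,2,4,6}. \<not> ?H j \<omega>) \<or> (\<exists>j\<in>{2,4,6}. \<not> ?V j \<omega>))"
      by (intro pred_intros_logic pred_intros_finite mH mV) auto
    fix \<omega> assume no: "\<not> hcross (occupied (\<omega> \<inter> short s)) 0 (9 * r) 0 r"
    show "(\<exists>j\<in>{0,2,4,6}. \<not> ?H j \<omega>) \<or> (\<exists>j\<in>{2,4,6}. \<not> ?V j \<omega>)"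
    proof (rule ccontr)
      assume "\<not> ?thesis"
      then have "hcross (occupied (\<omega> \<inter> short s)) 0 (9 * r) 0 r"
        using r by (intro hcross_long) auto
      with no show False by blast
    qed
  qed
  also have "\<dots> \<le> pr \<rho> (\<lambda>\<omega>. \<exists>j\<in>{0,2,4,6}. \<not> ?H j \<omega>) + pr \<rho> (\<lambda>\<omega>. \<exists>j\<in>{2,4,6}. \<not> ?V j \<omega>)"
    by (intro pr_disj[OF \<rho>] pred_intros_finite mH mV) auto
  also have "\<dots> \<le> (\<Sum>j\<in>{0,2,4,6}. pr \<rho> (\<lambda>\<omega>. \<not> ?H j \<omega>)) + (\<Sum>j\<in>{2,4,6}. pr \<rho> (\<lambda>\<omega>. \<not> ?V j \<omega>))"
    by (intro add_mono pr_bex[OF \<rho>] mH mV) auto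
  also have "\<dots> \<le> 7 * fail s \<rho> r"
    using V[of 2] V[of 4] V[of 6] by (simp add: H)
  finally show ?thesis .
qed

text \<open>If a rectangle of height \<open>3 * r\<close> is not crossed, neither are its bottom and
  top strips of height \<open>r\<close>, which are independent; each failure has probability at most
  \<open>7 * fail s \<rho> r\<close>.\<close>

lemma fail_recursion:
  assumes \<rho>: "0 \<le> \<rho>" and r: "0 < r" "4 * s \<le> r"
  shows "fail s \<rho> (3 * r) \<le> 49 * (fail s \<rho> r)\<^sup>2"
proof -
  let ?Q = "\<lambda>\<omega>. \<not> hcross (occupied \<omega>) 0 (9 * r) 0 r"
  let ?Q' = "\<lambda>\<omega>. \<not> hcross (occupied \<omega>) 0 (9 * r) (2 * r) (3 * r)"
  have m: "Measurable.pred V ?Q" "Measurable.pred V ?Q'" by (intro pred_intros_logic pred_hcross)+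
  have "fail s \<rho> (3 * r) \<le> pr \<rho> (\<lambda>\<omega>. ?Q (\<omega> \<inter> short s) \<and> ?Q' (\<omega> \<inter> short s))"
    unfolding fail_def
  proof (rule pr_mono[OF \<rho>])
    show "Measurable.pred V (\<lambda>\<omega>. ?Q (\<omega> \<inter> short s) \<and> ?Q' (\<omega> \<inter> short s))"
      by (intro pred_intros_logic pred_short pred_hcross)
    fix \<omega> assume "\<not> hcross (occupied (\<omega> \<inter> short s)) 0 (3 * (3 * r)) 0 (3 * r)"
    then show "?Q (\<omega> \<inter> short s) \<and> ?Q' (\<omega> \<inter> short s)"
      using r hcross_mono[of "occupied (\<omega> \<inter> short s)" 0 "9 * r" 0 r "occupied (\<omega> \<inter> short s)" 0 "3 * r"]
        hcross_mono[of "occupied (\<omega> \<inter> short s)" 0 "9 * r" "2 * r" "3 * r" "occupied (\<omega> \<inter> short s)" 0 "3 * r"]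
      by auto
  qed
  also have "\<dots> = pr \<rho> (\<lambda>\<omega>. ?Q (\<omega> \<inter> short s)) * pr \<rho> (\<lambda>\<omega>. ?Q' (\<omega> \<inter> short s))"
    using r by (intro pr_independent_regions[OF \<rho> m(1) local_in_not[OF local_in_hcross] m(2) local_in_not[OF local_in_hcross]]) auto
  also have "\<dots> \<le> (7 * fail s \<rho> r) * (7 * fail s \<rho> r)"
  proof (rule mult_mono)
    show "pr \<rho> (\<lambda>\<omega>. ?Q (\<omega> \<inter> short s)) \<le> 7 * fail s \<rho> r" by (rule pr_not_long_le[OF \<rho> r(1)])
    then show "pr \<rho> (\<lambda>\<omega>. ?Q' (\<omega> \<inter> short s)) \<le> 7 * fail s \<rho> r" by (subst pr_hcross_short[OF \<rho>]) simp
  qed (use pr_bounds[OF \<rho>] fail_bounds[OF \<rho>] in auto)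
  finally show ?thesis by (simp add: power2_eq_square)
qed

lemma fail_half:
  assumes \<rho>: "0 \<le> \<rho>" and r: "0 < r" "4 * s \<le> r" and small: "fail s \<rho> r \<le> 1 / 98"
  shows "fail s \<rho> (3 * r) \<le> fail s \<rho> r / 2"
proof -
  have "fail s \<rho> r * fail s \<rho> r \<le> (1 / 98) * fail s \<rho> r"
    using small fail_bounds[OF \<rho>, of s r] by (intro mult_right_mono) auto
  with fail_recursion[OF \<rho> r] show ?thesis by (simp add: power2_eq_square)
qed

end

section \<open>Percolation from crossings\<close>

lemma unbounded_from_path_component:
  assumes "path_component C x' x" "unbounded_from C x" shows "unbounded_from C x'"
  unfolding unbounded_from_def
proof
  fix R
  obtain q where "path_component C x q" "R + dist x x' \<le> dist x q"
    using assms(2) unfolding unbounded_from_def by blast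
  then show "\<exists>q. path_component C x' q \<and> R \<le> dist x' q"
    using assms(1) dist_triangle[of x q x'] by (intro exI[of _ q]) (auto intro: path_component_trans)
qed

lemma unbounded_from_mono: "unbounded_from C x \<Longrightarrow> C \<subseteq> D \<Longrightarrow> unbounded_from D x"
  unfolding unbounded_from_def using path_component_of_subset by blast

lemma unbounded_from_translate:
  assumes "unbounded_from C x" shows "unbounded_from ((+) (- x) ` C) 0"
  unfolding unbounded_from_def
proof
  fix R
  obtain q where q: "R \<le> dist x q" "path_component C x q"
    using assms unfolding unbounded_from_def by blast
  have "path_component ((+) (- x) ` C) (- x + x) (- x + q)"
    by (rule path_component_image[OF q(2)]) (auto intro!: continuous_intros)
  with q(1) show "\<exists>q. path_component ((+) (- x) ` C) 0 q \<and> R \<le> dist 0 q"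
    by (intro exI[of _ "- x + q"]) (auto simp: dist_norm norm_minus_commute)
qed

text \<open>Applied to the occupied and the vacant set: a crossing in one direction blocks the other
  colour in the other direction. This is the elementary half of duality.\<close>

lemma hcross_disjoint_vcross:
  assumes "hcross C a b c d" "vcross D a b c d" shows "C \<inter> D \<noteq> {}"
proof -
  obtain p q where h: "path_component (C \<inter> ({a..b} \<times> {c..d})) p q" "fst p = a" "fst q = b"
    using assms(1) unfolding hcross_def by blast
  obtain p' q' where v: "path_component (D \<inter> ({a..b} \<times> {c..d})) p' q'" "snd p' = c" "snd q' = d"
    using assms(2) unfolding vcross_def by blast
  obtain z where "path_component (C \<inter> ({a..b} \<times> {c..d})) p z" "path_component (D \<inter> ({a..b} \<times> {c..d})) p' z"
    using crossings_meet[OF h v] by blast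
  then have "z \<in> C" "z \<in> D" using path_component_mem by blast+
  then show ?thesis by blast
qed

text \<open>All rectangles share a corner, and the long side of one is the short side of the next.
  So each crossing traverses the next rectangle from side to side and meets its crossing; all of
  them lie in one component.\<close>

lemma unbounded_of_alternating_crossings:
  assumes r: "0 < r"
    and h: "\<And>k. even k \<Longrightarrow> hcross C 0 (3 ^ Suc k * r) 0 (3 ^ k * r)"
    and v: "\<And>k. odd k \<Longrightarrow> vcross C 0 (3 ^ k * r) 0 (3 ^ Suc k * r)"
  shows "\<exists>x. unbounded_from C x"
proof -
  have "\<exists>p q. path_component (C \<inter> (if even k then {0..3 ^ Suc k * r} \<times> {0..3 ^ k * r} else {0..3 ^ k * r} \<times> {0..3 ^ Suc k * r})) p q \<and>
     (if even k then fst p = 0 \<and> fst q = 3 ^ Suc k * r else snd p = 0 \<and> snd q = 3 ^ Suc k * r)" for k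
    using h[of k] v[of k] unfolding hcross_def vcross_def by (cases "even k") auto
  then obtain p q where pq: "\<And>k. path_component (C \<inter> (if even k then {0..3 ^ Suc k * r} \<times> {0..3 ^ k * r} else {0..3 ^ k * r} \<times> {0..3 ^ Suc k * r})) (p k) (q k)"
     "\<And>k. if even k then fst (p k) = 0 \<and> fst (q k) = 3 ^ Suc k * r else snd (p k) = 0 \<and> snd (q k) = 3 ^ Suc k * r"
    by metis
  have le: "3 ^ k * r \<le> 3 ^ Suc k * r" for k using r by simp
  have step: "path_component C (p k) (p (Suc k))" for k
  proof -
    have "\<exists>z. path_component C (p k) z \<and> path_component C (p (Suc k)) z"
    proof (cases "even k")
      case True
      let ?R = "{0..3 ^ Suc k * r} \<times> {0..3 ^ Suc (Suc k) * r}"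
      have sub: "{0..3 ^ k * r} \<subseteq> {0..3 ^ Suc (Suc k) * r}" using le[of k] le[of "Suc k"] by auto
      have 1: "path_component (C \<inter> ?R) (p k) (q k)" "fst (p k) = 0" "fst (q k) = 3 ^ Suc k * r"
        using pq[of k] True sub by (auto elim!: path_component_of_subset[rotated] simp del: power_Suc)
      have 2: "path_component (C \<inter> ?R) (p (Suc k)) (q (Suc k))" "snd (p (Suc k)) = 0" "snd (q (Suc k)) = 3 ^ Suc (Suc k) * r"
        using pq[of "Suc k"] True by (auto simp del: power_Suc)
      from crossings_meet[OF 1 2] show ?thesis using path_component_of_subset[OF Int_lower1] by metis
    next
      case False
      let ?R = "{0..3 ^ Suc (Suc k) * r} \<times> {0..3 ^ Suc k * r}"
      have sub: "{0..3 ^ k * r} \<subseteq> {0..3 ^ Suc (Suc k) * r}" using le[of k] le[of "Suc k"] by auto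
      have 1: "path_component (C \<inter> ?R) (p k) (q k)" "snd (p k) = 0" "snd (q k) = 3 ^ Suc k * r"
        using pq[of k] False sub by (auto elim!: path_component_of_subset[rotated] simp del: power_Suc)
      have 2: "path_component (C \<inter> ?R) (p (Suc k)) (q (Suc k))" "fst (p (Suc k)) = 0" "fst (q (Suc k)) = 3 ^ Suc (Suc k) * r"
        using pq[of "Suc k"] False by (auto simp del: power_Suc)
      from crossings_meet[OF 2 1] show ?thesis using path_component_of_subset[OF Int_lower1] by metis
    qed
    then show ?thesis by (meson path_component_sym path_component_trans)
  qed
  have pC: "path_component C (p k) (q k)" for k
    using pq(1)[of k] path_component_of_subset[OF Int_lower1] by metis
  have p0: "path_component C (p 0) (p k)" for k
    using pC[of 0] by (induction k) (auto intro: path_component_trans[OF _ step] path_component_refl dest: path_component_mem)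
  have qn: "3 ^ Suc k * r \<le> norm (q k)" for k
    using pq(2)[of k] norm_fst_le[of "fst (q k)" "snd (q k)"] norm_snd_le[of "snd (q k)" "fst (q k)"] r
    by (auto split: if_splits)
  have "unbounded_from C (p 0)" unfolding unbounded_from_def
  proof
    fix R
    obtain k where "(R + norm (p 0)) / r < 3 ^ k" using real_arch_pow[of 3] by auto
    then have "R + norm (p 0) \<le> 3 ^ Suc k * r"
      using r le[of k] by (simp only: pos_divide_less_eq)
    then have "R \<le> dist (p 0) (q k)"
      using qn[of k] norm_triangle_ineq2[of "q k" "p 0"] by (simp add: dist_norm norm_minus_commute)
    moreover have "path_component C (p 0) (q k)" using p0 pC path_component_trans by blast
    ultimately show "\<exists>q. path_component C (p 0) q \<and> R \<le> dist (p 0) q" by blast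
  qed
  then show ?thesis by blast
qed

lemma countable_of_locally_finite:
  assumes "\<omega> \<in> lf_configs" shows "countable \<omega>"
proof -
  have "\<omega> \<subseteq> (\<Union>n::nat. \<omega> \<inter> reach (- real n) n (- real n) n)"
  proof
    fix p assume p: "p \<in> \<omega>"
    then have "0 \<le> snd p" using assms by (auto simp: lf_configs_def)
    obtain n :: nat where "max \<bar>fst (fst p)\<bar> \<bar>snd (fst p)\<bar> \<le> n" using real_arch_simple by blast
    then have "p \<in> reach (- real n) n (- real n) n" using \<open>0 \<le> snd p\<close> by (auto simp: reach_def)
    then show "p \<in> (\<Union>n::nat. \<omega> \<inter> reach (- real n) n (- real n) n)" using p by blast
  qed
  moreover have "countable (\<Union>n::nat. \<omega> \<inter> reach (- real n) n (- real n) n)"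
    using assms by (intro countable_UN) (auto simp: lf_configs_def locally_finite_def countable_finite)
  ultimately show ?thesis using countable_subset by blast
qed

text \<open>A disc of radius 0 may miss \<open>D\<close>, so \<open>x\<close> cannot simply be moved
  within its own disc. A path has uncountably many points and there are countably many centres, so
  it visits a point of some disc other than a centre; that disc has positive radius and contains a
  point of \<open>D\<close>.\<close>

lemma unbounded_occupied_dense:
  assumes \<omega>: "\<omega> \<in> lf_configs" and x: "unbounded_from (occupied \<omega>) x"
    and D: "\<And>X. open X \<Longrightarrow> X \<noteq> {} \<Longrightarrow> \<exists>d\<in>D. d \<in> X"
  shows "\<exists>d\<in>D. unbounded_from (occupied \<omega>) d"
proof -
  obtain q g where g: "1 \<le> dist x q" "path g" "path_image g \<subseteq> occupied \<omega>" "pathstart g = x" "pathfinish g = q"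
    using x unfolding unbounded_from_def path_component_def by blast
  have "uncountable (path_image g)"
    using g by (intro connected_uncountable[of _ x q] connected_path_image) auto
  moreover have "countable (fst ` \<omega>)" using countable_of_locally_finite[OF \<omega>] by simp
  ultimately obtain y where y: "y \<in> path_image g" "y \<notin> fst ` \<omega>"
    by (meson countable_subset subsetI)
  obtain p where p: "p \<in> \<omega>" "y \<in> cball (fst p) (snd p)" using y(1) g(3) unfolding occupied_eq by blast
  have "fst p \<noteq> y" using y(2) p(1) by auto
  then have "0 < dist (fst p) y" by simp
  also have "dist (fst p) y \<le> snd p" using p(2) by simp
  finally have "0 < snd p" .
  then obtain d where d: "d \<in> D" "d \<in> ball (fst p) (snd p)" using D[of "ball (fst p) (snd p)"] by auto
  have "path_component (cball (fst p) (snd p)) d y"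
    using d(2) p(2) convex_imp_path_connected[OF convex_cball, of "fst p" "snd p"]
    by (auto simp: path_connected_component)
  moreover have "cball (fst p) (snd p) \<subseteq> occupied \<omega>" using p(1) by (auto simp: occupied_eq)
  ultimately have "path_component (occupied \<omega>) d y" using path_component_of_subset by blast
  moreover have "path_component (occupied \<omega>) x y"
    using path_component_path_image_pathstart[OF g(2) y(1)] g path_component_of_subset by metis
  ultimately have "path_component (occupied \<omega>) d x" by (meson path_component_sym path_component_trans)
  with d(1) x show ?thesis using unbounded_from_path_component by blast
qed

text \<open>The vacant set of a locally finite configuration is open, so a ball around
  \<open>x\<close> supplies the point of \<open>D\<close>.\<close>

lemma unbounded_vacant_dense:
  assumes \<omega>: "\<omega> \<in> lf_configs" and x: "unbounded_from (vacant \<omega>) x"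
    and D: "\<And>X. open X \<Longrightarrow> X \<noteq> {} \<Longrightarrow> \<exists>d\<in>D. d \<in> X"
  shows "\<exists>d\<in>D. unbounded_from (vacant \<omega>) d"
proof -
  obtain q where "path_component (vacant \<omega>) x q" using x unfolding unbounded_from_def by blast
  then have "x \<in> vacant \<omega>" using path_component_mem by blast
  moreover have "open (vacant \<omega>)"
    using \<omega> closed_occupied unfolding vacant_def lf_configs_def by (auto simp: open_Compl)
  ultimately obtain e where e: "0 < e" "ball x e \<subseteq> vacant \<omega>" by (meson openE)
  obtain d where d: "d \<in> D" "d \<in> ball x e" using D[of "ball x e"] e(1) by auto
  have "path_component (ball x e) d x"
    using d(2) e(1) convex_imp_path_connected[OF convex_ball, of x e] by (auto simp: path_connected_component)
  then have "path_component (vacant \<omega>) d x" using e(2) by (rule path_component_of_subset[rotated])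
  with d(1) x show ?thesis using unbounded_from_path_component by blast
qed

lemma vacant_vcross_of_no_hcross:
  assumes \<omega>: "locally_finite \<omega>" and ab: "a < b" "c \<le> d" and no: "\<not> hcross (occupied \<omega>) a b c d"
  shows "vcross (vacant \<omega>) a b c d"
proof -
  let ?R = "{a..b} \<times> {c..d}"
  define F where "F = \<omega> \<inter> reach a b c d"
  define C where "C = (\<lambda>p. cball (fst p) (snd p) \<inter> ?R)"
  have UC: "(\<Union>p\<in>F. C p) = occupied \<omega> \<inter> ?R"
    using occupied_local[of ?R a b c d \<omega>] unfolding F_def C_def occupied_eq by blast
  have "vcross (- (\<Union>p\<in>F. C p)) a b c d"
  proof (rule vacant_vcross)
    show "finite F" unfolding F_def by (rule locally_finite_reach[OF \<omega>])
    show "compact (C p)" "convex (C p)" "C p \<subseteq> ?R" for p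
      unfolding C_def by (auto intro!: convex_Int convex_Times closed_Int_compact compact_Times)
    show "\<not> hcross (\<Union>p\<in>F. C p) a b c d"
      using no hcross_mono[of "\<Union>p\<in>F. C p" a b c d "occupied \<omega>" c d] unfolding UC by blast
  qed (use ab in auto)
  then show ?thesis unfolding UC by (rule vcross_mono) (auto simp: vacant_def)
qed

context poisson_boolean
begin

section \<open>Percolation at the origin and unbounded components\<close>

text \<open>By translation invariance the points of a countable dense set almost surely do not
  percolate either, which excludes unbounded components altogether. \<open>F\<close> stands for the
  occupied or the vacant set.\<close>

lemma pr_zero_translates:
  assumes \<rho>: "0 \<le> \<rho>" and F: "\<And>v \<omega>. F (translation v \<omega>) = (+) v ` F \<omega>"
    and m: "Measurable.pred V (\<lambda>\<omega>. origin_to_infinity (F \<omega>))"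
    and z: "pr \<rho> (\<lambda>\<omega>. origin_to_infinity (F \<omega>)) = 0"
    and dense: "\<And>\<omega> x D. \<omega> \<in> lf_configs \<Longrightarrow> unbounded_from (F \<omega>) x \<Longrightarrow>
      (\<And>X. open X \<Longrightarrow> X \<noteq> {} \<Longrightarrow> \<exists>d\<in>D. d \<in> X) \<Longrightarrow> \<exists>d\<in>D. unbounded_from (F \<omega>) d"
    and U: "\<And>\<omega>. \<omega> \<in> lf_configs \<Longrightarrow> U \<omega> \<Longrightarrow> \<exists>x. unbounded_from (F \<omega>) x"
  shows "pr \<rho> U = 0"
proof -
  obtain D :: "(real \<times> real) set" where D: "countable D"
    "\<And>X. open X \<Longrightarrow> X \<noteq> {} \<Longrightarrow> \<exists>d\<in>D. d \<in> X"
    using countable_dense_exists by blast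
  let ?Q = "\<lambda>d \<omega>. origin_to_infinity (F (translation (- d) \<omega>))"
  have mQ: "Measurable.pred V (?Q d)" for d by (rule pred_translation[OF m])
  have "pr \<rho> U \<le> pr \<rho> (\<lambda>\<omega>. \<exists>d\<in>D. ?Q d \<omega>)"
  proof (rule pr_mono[OF \<rho>])
    show "Measurable.pred V (\<lambda>\<omega>. \<exists>d\<in>D. ?Q d \<omega>)"
      using mQ D(1) unfolding pred_def by (intro sets.sets_Collect_countable_Ex') auto
    fix \<omega> assume "\<omega> \<in> lf_configs" "U \<omega>"
    then obtain d where "d \<in> D" "unbounded_from (F \<omega>) d" using U dense D(2) by metis
    then show "\<exists>d\<in>D. ?Q d \<omega>"
      unfolding origin_to_infinity_iff_unbounded_from F using unbounded_from_translate by blast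
  qed
  also have "\<dots> = 0"
    using pr_translation[OF \<rho> m] z by (intro pr_ex_null[OF \<rho> D(1) mQ]) auto
  finally show ?thesis using pr_bounds[OF \<rho>, of U] by simp
qed

lemma vacant_translation: "vacant (translation v \<omega>) = (+) v ` vacant \<omega>"
  unfolding vacant_def translation_props(1) by (simp add: bij_image_Compl_eq bij_plus)

lemma fail_geometric:
  assumes \<rho>: "0 \<le> \<rho>" and r: "0 < r" "4 * s \<le> r" and small: "fail s \<rho> r \<le> 1 / 98"
  shows "fail s \<rho> (3 ^ k * r) \<le> fail s \<rho> r * (1 / 2) ^ k"
proof (induction k)
  case (Suc k)
  have "fail s \<rho> r * (1 / 2) ^ k \<le> fail s \<rho> r * 1"
    using fail_bounds[OF \<rho>] by (intro mult_left_mono power_le_one) auto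
  with Suc small have "fail s \<rho> (3 ^ k * r) \<le> 1 / 98" by linarith
  moreover have "1 * r \<le> 3 ^ k * r" using r by (intro mult_right_mono) auto
  then have "4 * s \<le> 3 ^ k * r" using r by linarith
  ultimately have "fail s \<rho> (3 * (3 ^ k * r)) \<le> fail s \<rho> (3 ^ k * r) / 2"
    using r by (intro fail_half[OF \<rho>]) auto
  with Suc show ?case by (simp add: mult.assoc)
qed simp

text \<open>The failures at the scales \<open>3 ^ k * r\<close> have total probability at most
  \<open>2 * fail s \<rho> r\<close>, hence at most 1/49. So all alternating crossings exist with
  positive probability, which is impossible if unbounded components are null.\<close>

lemma percolates_of_fail_small:
  assumes \<rho>: "0 \<le> \<rho>" and r: "0 < r" "4 * s \<le> r" and small: "fail s \<rho> r \<le> 1 / 98"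
  shows "pr \<rho> (\<lambda>\<omega>. origin_to_infinity (occupied \<omega>)) \<noteq> 0"
proof
  assume z: "pr \<rho> (\<lambda>\<omega>. origin_to_infinity (occupied \<omega>)) = 0"
  define B where "B = (\<lambda>k \<omega>. if even k then \<not> hcross (occupied (\<omega> \<inter> short s)) 0 (3 ^ Suc k * r) 0 (3 ^ k * r)
    else \<not> vcross (occupied (\<omega> \<inter> short s)) 0 (3 ^ k * r) 0 (3 ^ Suc k * r))"
  have mh: "Measurable.pred V (\<lambda>\<omega>. \<not> hcross (occupied (\<omega> \<inter> short s)) a b c d)"
    and mv: "Measurable.pred V (\<lambda>\<omega>. \<not> vcross (occupied (\<omega> \<inter> short s)) a b c d)" for a b c d
    by (intro pred_intros_logic pred_short pred_hcross pred_vcross)+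
  have mB: "Measurable.pred V (B k)" for k
    unfolding B_def by (cases "even k") (auto intro: mh mv)
  have prB: "pr \<rho> (B k) = fail s \<rho> (3 ^ k * r)" for k
    unfolding B_def fail_def by (cases "even k") (simp_all add: pr_vcross_short[OF \<rho>] mult.assoc)
  have sums: "(\<lambda>k. fail s \<rho> r * (1 / 2) ^ k) sums (fail s \<rho> r * 2)"
    using sums_mult[OF geometric_sums[of "1 / 2 :: real"], of "fail s \<rho> r"] by simp
  have le: "pr \<rho> (B k) \<le> fail s \<rho> r * (1 / 2) ^ k" for k
    unfolding prB by (rule fail_geometric[OF \<rho> r small])
  have sm: "summable (\<lambda>k. pr \<rho> (B k))"
    using le pr_bounds[OF \<rho>] by (intro summable_comparison_test'[OF sums_summable[OF sums], of 0]) auto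
  have "pr \<rho> (\<lambda>\<omega>. \<exists>k. B k \<omega>) \<le> (\<Sum>k. pr \<rho> (B k))" by (rule pr_ex[OF \<rho> mB sm])
  also have "\<dots> \<le> fail s \<rho> r * 2"
    using suminf_le[OF le sm sums_summable[OF sums]] sums_unique[OF sums] by simp
  finally have lt: "pr \<rho> (\<lambda>\<omega>. \<exists>k. B k \<omega>) < 1" using small by linarith
  have "pr \<rho> (\<lambda>\<omega>. \<not> (\<exists>k. B k \<omega>)) = 0"
  proof (rule pr_zero_translates[OF \<rho> translation_props(1) pred_origin_to_infinity(1) z unbounded_occupied_dense], assumption, assumption, assumption)
    fix \<omega> assume "\<not> (\<exists>k. B k \<omega>)"
    then have nB: "\<not> B k \<omega>" for k by blast
    have "\<exists>x. unbounded_from (occupied (\<omega> \<inter> short s)) x"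
      using nB unfolding B_def by (intro unbounded_of_alternating_crossings[OF r(1)]) metis+
    then show "\<exists>x. unbounded_from (occupied \<omega>) x"
      using unbounded_from_mono occupied_mono[of "\<omega> \<inter> short s" \<omega>] by blast
  qed
  moreover have "Measurable.pred V (\<lambda>\<omega>. \<exists>k. B k \<omega>)" using mB by (intro pred_intros_countable)
  ultimately show False using pr_not[OF \<rho>, of "\<lambda>\<omega>. \<exists>k. B k \<omega>"] lt by simp
qed

definition hard :: "real \<Rightarrow> real \<Rightarrow> real" where
  "hard \<rho> r = pr \<rho> (\<lambda>\<omega>. hcross (occupied \<omega>) 0 (3 * r) 0 r)"

lemma hard_increasing: "0 \<le> a \<Longrightarrow> a \<le> b \<Longrightarrow> hard a r \<le> hard b r"
  unfolding hard_def
  by (rule pr_increasing[OF _ _ pred_hcross]) (auto elim!: hcross_mono dest: occupied_mono)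

lemma easy_increasing: "0 \<le> a \<Longrightarrow> a \<le> b \<Longrightarrow> easy a r \<le> easy b r"
  unfolding easy_def
  by (rule pr_increasing[OF _ _ pred_hcross]) (auto elim!: hcross_mono dest: occupied_mono)

text \<open>With \<open>r = 4 * s\<close> the length is \<open>3 * r = 12 * s\<close>, whence 196 =
  (12 + 2)^2. For large \<open>s\<close> the failure of the full crossing and the error of the cut
  are each below 1/196, together below 1/98.\<close>

lemma percolates_of_hard:
  assumes \<rho>: "0 \<le> \<rho>" and lim: "(hard \<rho> \<longlongrightarrow> 1) at_top"
  shows "pr \<rho> (\<lambda>\<omega>. origin_to_infinity (occupied \<omega>)) \<noteq> 0"
proof -
  have "eventually (\<lambda>r. 1 - 1 / 196 < hard \<rho> r) at_top"
    using order_tendstoD(1)[OF lim, of "1 - 1 / 196"] by simp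
  moreover have "eventually (\<lambda>s. \<rho> * (196 * tail s) < 1 / 196) at_top"
    using order_tendstoD(2)[OF tendsto_mult_right_zero[OF tendsto_mult_right_zero[OF tail_tendsto]], of "1 / 196" \<rho> 196] by simp
  ultimately obtain R where R: "\<And>r. R \<le> r \<Longrightarrow> 1 - 1 / 196 < hard \<rho> r" "\<And>s. R \<le> s \<Longrightarrow> \<rho> * (196 * tail s) < 1 / 196"
    unfolding eventually_at_top_linorder by (metis max.bounded_iff linorder_le_cases)
  define s where "s = max R 1"
  define r where "r = 4 * s"
  have s: "0 < s" "R \<le> s" "R \<le> r" "0 < r" by (auto simp: s_def r_def)
  show ?thesis
  proof (rule percolates_of_fail_small[OF \<rho>])
    show "0 < r" "4 * s \<le> r" using s by (auto simp: r_def)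
    have m: "Measurable.pred V (\<lambda>\<omega>. hcross (occupied (\<omega> \<inter> short s)) 0 (3 * r) 0 r)"
      by (intro pred_short pred_hcross)
    have "hard \<rho> r \<le> pr \<rho> (\<lambda>\<omega>. hcross (occupied (\<omega> \<inter> short s)) 0 (3 * r) 0 r) + \<rho> * ((12 + 2)\<^sup>2 * tail s)"
      unfolding hard_def using s by (intro pr_le_short[OF \<rho> pred_hcross local_in_hcross]) (auto simp: r_def)
    also have "pr \<rho> (\<lambda>\<omega>. hcross (occupied (\<omega> \<inter> short s)) 0 (3 * r) 0 r) = 1 - fail s \<rho> r"
      unfolding fail_def using pr_not[OF \<rho> m] by simp
    finally show "fail s \<rho> r \<le> 1 / 98" using R(1)[OF s(3)] R(2)[OF s(2)] by simp
  qed
qed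

lemma annulus_crossing_of_origin:
  assumes C: "origin_to_infinity C" and r: "0 < r"
  shows "hcross C (r / 2) (3 * r / 2) (- (3 * r / 2)) (3 * r / 2) \<or>
    hcross C (- (3 * r / 2)) (- (r / 2)) (- (3 * r / 2)) (3 * r / 2) \<or>
    vcross C (- (3 * r / 2)) (3 * r / 2) (r / 2) (3 * r / 2) \<or>
    vcross C (- (3 * r / 2)) (3 * r / 2) (- (3 * r / 2)) (- (r / 2))"
proof -
  \<comment> \<open>Distance \<open>3 * r\<close> suffices: the norm is at most the sum of the
    absolute coordinates, so one of them is at least \<open>3 * r / 2\<close>.\<close>
  obtain q where q: "path_component C 0 q" "3 * r \<le> dist 0 q"
    using C unfolding origin_to_infinity_iff_unbounded_from unbounded_from_def by blast
  have "\<not> (\<bar>fst q\<bar> < 3 * r / 2 \<and> \<bar>snd q\<bar> < 3 * r / 2)"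
    using q(2) norm_Pair_le[of "fst q" "snd q"] by (auto simp: dist_norm)
  then show ?thesis using r by (intro annulus_crossing[OF q(1)]) auto
qed

text \<open>The union bound \<open>4 * g r\<close> tends to 0, while the bounded probability does
  not depend on \<open>r\<close>.\<close>

lemma pr_null_of_four_events:
  fixes g :: "real \<Rightarrow> real"
  assumes \<rho>: "0 \<le> \<rho>" and lim: "(g \<longlongrightarrow> 0) at_top"
    and m: "\<And>r. Measurable.pred V (Q1 r)" "\<And>r. Measurable.pred V (Q2 r)"
      "\<And>r. Measurable.pred V (Q3 r)" "\<And>r. Measurable.pred V (Q4 r)"
    and pr: "\<And>r. pr \<rho> (Q1 r) = g r" "\<And>r. pr \<rho> (Q2 r) = g r" "\<And>r. pr \<rho> (Q3 r) = g r" "\<And>r. pr \<rho> (Q4 r) = g r"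
    and Q: "\<And>r \<omega>. 0 < r \<Longrightarrow> Q \<omega> \<Longrightarrow> Q1 r \<omega> \<or> Q2 r \<omega> \<or> Q3 r \<omega> \<or> Q4 r \<omega>"
  shows "pr \<rho> Q = 0"
proof -
  have le: "pr \<rho> Q \<le> 4 * g r" if "0 < r" for r :: real
  proof -
    have "pr \<rho> Q \<le> pr \<rho> (\<lambda>\<omega>. Q1 r \<omega> \<or> Q2 r \<omega> \<or> Q3 r \<omega> \<or> Q4 r \<omega>)"
      using Q[OF that] by (intro pr_mono[OF \<rho>] pred_intros_logic m)
    also have "\<dots> \<le> pr \<rho> (Q1 r) + (pr \<rho> (Q2 r) + (pr \<rho> (Q3 r) + pr \<rho> (Q4 r)))"
      by (intro order.trans[OF pr_disj[OF \<rho>]] add_left_mono pred_intros_logic m order_refl)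
    finally show ?thesis unfolding pr by simp
  qed
  have "eventually (\<lambda>r. pr \<rho> Q \<le> 4 * g r) at_top"
    using eventually_gt_at_top[of 0] by (rule eventually_mono) (rule le)
  moreover have "((\<lambda>r. 4 * g r) \<longlongrightarrow> 4 * 0) at_top" by (intro tendsto_intros lim)
  ultimately have "pr \<rho> Q \<le> 4 * 0" by (intro tendsto_lowerbound[of _ _ at_top]) auto
  then show ?thesis using pr_bounds[OF \<rho>, of Q] by simp
qed

text \<open>A vacant path to infinity crosses one of the four annulus rectangles the short way,
  which excludes an occupied crossing of it the long way.\<close>

lemma vacant_origin_null_of_hard:
  assumes \<rho>: "0 \<le> \<rho>" and lim: "(hard \<rho> \<longlongrightarrow> 1) at_top"
  shows "pr \<rho> (\<lambda>\<omega>. origin_to_infinity (vacant \<omega>)) = 0"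
proof (rule pr_null_of_four_events[OF \<rho>])
  show "((\<lambda>r. 1 - hard \<rho> r) \<longlongrightarrow> 0) at_top" using tendsto_diff[OF tendsto_const lim, of 1] by simp
  fix r :: real
  let ?l = "3 * r / 2"
  show "Measurable.pred V (\<lambda>\<omega>. \<not> vcross (occupied \<omega>) (r / 2) ?l (- ?l) ?l)"
    "Measurable.pred V (\<lambda>\<omega>. \<not> vcross (occupied \<omega>) (- ?l) (- (r / 2)) (- ?l) ?l)"
    "Measurable.pred V (\<lambda>\<omega>. \<not> hcross (occupied \<omega>) (- ?l) ?l (r / 2) ?l)"
    "Measurable.pred V (\<lambda>\<omega>. \<not> hcross (occupied \<omega>) (- ?l) ?l (- ?l) (- (r / 2)))"
    by (intro pred_intros_logic pred_hcross pred_vcross)+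
  show "pr \<rho> (\<lambda>\<omega>. \<not> vcross (occupied \<omega>) (r / 2) ?l (- ?l) ?l) = 1 - hard \<rho> r"
    "pr \<rho> (\<lambda>\<omega>. \<not> vcross (occupied \<omega>) (- ?l) (- (r / 2)) (- ?l) ?l) = 1 - hard \<rho> r"
    "pr \<rho> (\<lambda>\<omega>. \<not> hcross (occupied \<omega>) (- ?l) ?l (r / 2) ?l) = 1 - hard \<rho> r"
    "pr \<rho> (\<lambda>\<omega>. \<not> hcross (occupied \<omega>) (- ?l) ?l (- ?l) (- (r / 2))) = 1 - hard \<rho> r"
    by (simp_all add: pr_not[OF \<rho>] pr_vcross[OF \<rho>, of "r / 2"] pr_vcross[OF \<rho>, of "- ?l"]
      pr_hcross[OF \<rho>, of "- ?l"] hard_def)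
  fix \<omega> assume "0 < r" "origin_to_infinity (vacant \<omega>)"
  from annulus_crossing_of_origin[OF this(2,1)]
  show "\<not> vcross (occupied \<omega>) (r / 2) ?l (- ?l) ?l \<or> \<not> vcross (occupied \<omega>) (- ?l) (- (r / 2)) (- ?l) ?l \<or>
    \<not> hcross (occupied \<omega>) (- ?l) ?l (r / 2) ?l \<or> \<not> hcross (occupied \<omega>) (- ?l) ?l (- ?l) (- (r / 2))"
    using hcross_disjoint_vcross[of "vacant \<omega>" _ _ _ _ "occupied \<omega>"]
      hcross_disjoint_vcross[of "occupied \<omega>" _ _ _ _ "vacant \<omega>"] by (auto simp: vacant_def)
qed

lemma occupied_origin_null_of_easy:
  assumes \<rho>: "0 \<le> \<rho>" and lim: "(easy \<rho> \<longlongrightarrow> 0) at_top"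
  shows "pr \<rho> (\<lambda>\<omega>. origin_to_infinity (occupied \<omega>)) = 0"
proof (rule pr_null_of_four_events[OF \<rho> lim pred_hcross pred_hcross pred_vcross pred_vcross])
  fix r :: real and \<omega> assume "0 < r" "origin_to_infinity (occupied \<omega>)"
  from annulus_crossing_of_origin[OF this(2,1)]
  show "hcross (occupied \<omega>) (r / 2) (3 * r / 2) (- (3 * r / 2)) (3 * r / 2) \<or>
    hcross (occupied \<omega>) (- (3 * r / 2)) (- (r / 2)) (- (3 * r / 2)) (3 * r / 2) \<or>
    vcross (occupied \<omega>) (- (3 * r / 2)) (3 * r / 2) (r / 2) (3 * r / 2) \<or>
    vcross (occupied \<omega>) (- (3 * r / 2)) (3 * r / 2) (- (3 * r / 2)) (- (r / 2))" .
qed (simp_all add: pr_hcross[OF \<rho>, of "_ / 2"] pr_hcross[OF \<rho>, of "- _"] pr_vcross[OF \<rho>, of "- _"] easy_def)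

end

section \<open>Comparison of the critical parameters\<close>

text \<open>Summing the recursion bounds a partial sum of \<open>u\<close> by \<open>u 0\<close>, a
  partial sum of \<open>e\<close> and half of a partial sum of \<open>u\<close>, which can be
  absorbed.\<close>

lemma summable_of_half_recursion:
  fixes u e :: "nat \<Rightarrow> real"
  assumes u: "\<And>k. 0 \<le> u k" and rec: "\<And>k. u (Suc k) \<le> e k + u k / 2"
    and e: "summable e" "\<And>k. 0 \<le> e k"
  shows "summable u"
proof (rule summableI_nonneg_bounded)
  fix n
  show "0 \<le> u n" by (rule u)
  have "(\<Sum>i<n. u i) \<le> 2 * (u 0 + (\<Sum>i<n. e i))"
  proof (induction n)
    case 0 then show ?case using u[of 0] by simp
  next
    case (Suc n)
    have "(\<Sum>i<Suc n. u i) = u 0 + (\<Sum>i<n. u (Suc i))" by (rule sum.lessThan_Suc_shift)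
    also have "\<dots> \<le> u 0 + (\<Sum>i<n. e i + u i / 2)" by (intro add_left_mono sum_mono rec)
    also have "\<dots> = u 0 + (\<Sum>i<n. e i) + (\<Sum>i<n. u i) / 2"
      by (simp add: sum.distrib sum_divide_distrib)
    also have "\<dots> \<le> 2 * (u 0 + (\<Sum>i<Suc n. e i))" using Suc e(2)[of n] by simp
    finally show ?case .
  qed
  also have "\<dots> \<le> 2 * (u 0 + suminf e)" using e by (intro mult_left_mono add_left_mono sum_le_suminf) auto
  finally show "(\<Sum>i<n. u i) \<le> 2 * (u 0 + suminf e)" .
qed

text \<open>Only exponents with \<open>3 ^ k < 4 * z\<close> count, so their number is logarithmic
  in \<open>z\<close>; \<open>ln 3 \<ge> 1\<close> and \<open>ln 4 \<le> 3\<close> give the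
  constants.\<close>

lemma sum_indicator_scales_le:
  fixes z :: real
  assumes "0 \<le> z"
  shows "(\<Sum>k<n. indicator {3 ^ k / 4<..} z :: real) \<le> 4 + \<bar>ln z\<bar>"
proof -
  let ?S = "{k \<in> {..<n}. 3 ^ k / 4 < z}"
  have sub: "?S \<subseteq> {..<nat \<lceil>3 + \<bar>ln z\<bar>\<rceil>}"
  proof
    fix k assume "k \<in> ?S"
    then have k: "3 ^ k < 4 * z" by auto
    moreover have "(0::real) < 3 ^ k" by simp
    ultimately have z: "0 < z" by linarith
    have "ln (3 ^ k) < ln (4 * z)" using k z by (subst ln_less_cancel_iff) auto
    then have "real k * ln 3 < ln 4 + ln z" using z by (simp add: ln_realpow ln_mult)
    moreover have "1 \<le> ln (3::real)" using exp_le by (subst ln_ge_iff) auto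
    then have "real k * 1 \<le> real k * ln 3" by (intro mult_left_mono) auto
    moreover have "ln 4 \<le> (3::real)" using ln_le_minus_one[of 4] by simp
    ultimately have "real k < 3 + \<bar>ln z\<bar>" by linarith
    then show "k \<in> {..<nat \<lceil>3 + \<bar>ln z\<bar>\<rceil>}" by (simp add: zless_nat_eq_int_zless less_ceiling_iff)
  qed
  have "(\<Sum>k<n. indicator {3 ^ k / 4<..} z :: real) = (\<Sum>k\<in>?S. 1)"
    by (intro sum.mono_neutral_cong_right) (auto simp: indicator_def)
  also have "\<dots> = real (card ?S)" by simp
  also have "\<dots> \<le> real (nat \<lceil>3 + \<bar>ln z\<bar>\<rceil>)" using card_mono[OF _ sub]
    by (simp only: of_nat_le_iff card_lessThan finite_lessThan)
  also have "\<dots> \<le> 4 + \<bar>ln z\<bar>" using of_int_ceiling_le_add_one[of "3 + \<bar>ln z\<bar>"] by simp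
  finally show ?thesis .
qed

context poisson_boolean
begin

text \<open>Exchanging sum and integral weighs each radius \<open>z\<close> by
  \<open>z\<^sup>2\<close> times the number of scales below \<open>4 * z\<close>.\<close>

lemma summable_tail:
  assumes int: "integrable \<mu> (\<lambda>x. x\<^sup>2 * ln x)"
  shows "summable (\<lambda>k. tail (3 ^ k / 4))"
proof (rule summableI_nonneg_bounded)
  fix n
  show "0 \<le> tail (3 ^ n / 4)" by (rule tail_nonneg)
  have "(\<Sum>k<n. tail (3 ^ k / 4)) = (LINT z|\<mu>. (\<Sum>k<n. indicator {3 ^ k / 4<..} z * z\<^sup>2))"
    unfolding tail_def by (rule Bochner_Integration.integral_sum[symmetric]) (rule integrable_tail)
  also have "\<dots> \<le> (LINT z|\<mu>. 4 * z\<^sup>2 + \<bar>z\<^sup>2 * ln z\<bar>)"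
  proof (rule integral_mono)
    show "integrable \<mu> (\<lambda>z. \<Sum>k<n. indicator {3 ^ k / 4<..} z * z\<^sup>2)"
      by (intro Bochner_Integration.integrable_sum integrable_tail)
    show "integrable \<mu> (\<lambda>z. 4 * z\<^sup>2 + \<bar>z\<^sup>2 * ln z\<bar>)"
      using int second_moment by (intro Bochner_Integration.integrable_add integrable_abs) auto
    fix z assume "z \<in> space \<mu>"
    then have "(\<Sum>k<n. indicator {3 ^ k / 4<..} z * z\<^sup>2) \<le> (4 + \<bar>ln z\<bar>) * z\<^sup>2"
      unfolding sum_distrib_right[symmetric]
      by (intro mult_right_mono sum_indicator_scales_le) (auto simp: space_\<mu>)
    then show "(\<Sum>k<n. indicator {3 ^ k / 4<..} z * z\<^sup>2) \<le> 4 * z\<^sup>2 + \<bar>z\<^sup>2 * ln z\<bar>"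
      by (simp add: algebra_simps abs_mult)
  qed
  finally show "(\<Sum>k<n. tail (3 ^ k / 4)) \<le> (LINT z|\<mu>. 4 * z\<^sup>2 + \<bar>z\<^sup>2 * ln z\<bar>)" .
qed

lemma vacant_hcross_of_no_vcross:
  assumes \<omega>: "\<omega> \<in> lf_configs" and ab: "a \<le> b" "c < d" and no: "\<not> vcross (occupied \<omega>) a b c d"
  shows "hcross (vacant \<omega>) a b c d"
proof -
  let ?\<eta> = "move prod.swap ` \<omega>"
  have "\<not> hcross (occupied ?\<eta>) c d a b" using no by (simp add: vcross_conv_hcross swap_props(1))
  then have "vcross (vacant ?\<eta>) c d a b"
    using swap_props(4)[OF \<omega>] ab by (intro vacant_vcross_of_no_hcross) (auto simp: lf_configs_def)
  moreover have "prod.swap ` vacant ?\<eta> = vacant \<omega>"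
    unfolding vacant_def swap_props(1) by (simp add: bij_image_Compl_eq image_image)
  ultimately show ?thesis by (simp add: vcross_conv_hcross)
qed

text \<open>Cutting radii would enlarge the vacant set, so crossings are controlled in the full
  model at every scale: the recursion with summable errors makes \<open>easy \<rho> (3 ^ k)\<close>
  summable.\<close>

lemma vacant_percolates_of_easy:
  assumes int: "integrable \<mu> (\<lambda>x. x\<^sup>2 * ln x)" and \<rho>: "0 \<le> \<rho>" and lim: "(easy \<rho> \<longlongrightarrow> 0) at_top"
  shows "pr \<rho> (\<lambda>\<omega>. origin_to_infinity (vacant \<omega>)) \<noteq> 0"
proof
  assume z: "pr \<rho> (\<lambda>\<omega>. origin_to_infinity (vacant \<omega>)) = 0"
  have "eventually (\<lambda>r. easy \<rho> r < 1 / 1152) at_top"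
    using order_tendstoD(2)[OF lim, of "1 / 1152"] by simp
  then obtain R0 where R0: "\<And>r. R0 \<le> r \<Longrightarrow> easy \<rho> r < 1 / 1152" by (auto simp: eventually_at_top_linorder)
  obtain k0 where k0: "R0 < 3 ^ k0" using real_arch_pow[of 3 R0] by auto
  have "summable (\<lambda>k. easy \<rho> (3 ^ (k + k0)))"
  proof (rule summable_of_half_recursion)
    show "summable (\<lambda>k. 1444 * \<rho> * tail (3 ^ (k + k0) / 4))"
      using summable_ignore_initial_segment[OF summable_tail[OF int], of k0] by (rule summable_mult)
    fix k
    show "0 \<le> easy \<rho> (3 ^ (k + k0))" using easy_bounds[OF \<rho>] by blast
    show "0 \<le> 1444 * \<rho> * tail (3 ^ (k + k0) / 4)" using \<rho> tail_nonneg by simp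
    have "(3::real) ^ k0 \<le> 3 ^ (k + k0)" by (intro power_increasing) auto
    with k0 have "R0 \<le> 3 ^ (k + k0)" by linarith
    then have "easy \<rho> (3 ^ (k + k0)) \<le> 1 / 1152" using R0 less_imp_le by blast
    from easy_half[OF \<rho> _ this]
    show "easy \<rho> (3 ^ (Suc k + k0)) \<le> 1444 * \<rho> * tail (3 ^ (k + k0) / 4) + easy \<rho> (3 ^ (k + k0)) / 2" by simp
  qed
  then have "summable (\<lambda>k. easy \<rho> (3 ^ k))" by (simp add: summable_iff_shift[of "\<lambda>k. easy \<rho> (3 ^ k)" k0])
  \<comment> \<open>Starting from a late scale brings the total failure probability below 1.\<close>
  from suminf_exist_split[OF zero_less_one this]
  obtain k1 where k1: "norm (\<Sum>k. easy \<rho> (3 ^ (k + k1))) < 1" by blast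
  have sm: "summable (\<lambda>k. easy \<rho> (3 ^ (k + k1)))"
    by (rule summable_ignore_initial_segment[OF \<open>summable (\<lambda>k. easy \<rho> (3 ^ k))\<close>])
  define R :: real where "R = 3 ^ k1"
  have R: "0 < R" "3 ^ k * R = 3 ^ (k + k1)" for k by (auto simp: R_def power_add)
  \<comment> \<open>The bad event is an occupied crossing the short way of the rectangle in which a
    vacant crossing the long way is wanted.\<close>
  define B where "B = (\<lambda>k \<omega>. if even k then vcross (occupied \<omega>) 0 (3 ^ Suc k * R) 0 (3 ^ k * R)
    else hcross (occupied \<omega>) 0 (3 ^ k * R) 0 (3 ^ Suc k * R))"
  have mB: "Measurable.pred V (B k)" for k
    unfolding B_def by (cases "even k") (auto intro: pred_hcross pred_vcross)
  have prB: "pr \<rho> (B k) = easy \<rho> (3 ^ (k + k1))" for k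
    unfolding R(2)[symmetric] B_def easy_def by (cases "even k") (simp_all add: pr_vcross[OF \<rho>] mult.assoc)
  have "pr \<rho> (\<lambda>\<omega>. \<exists>k. B k \<omega>) \<le> (\<Sum>k. pr \<rho> (B k))" by (rule pr_ex[OF \<rho> mB]) (use sm in \<open>simp add: prB\<close>)
  with k1 have lt: "pr \<rho> (\<lambda>\<omega>. \<exists>k. B k \<omega>) < 1" unfolding prB by simp
  have "pr \<rho> (\<lambda>\<omega>. \<not> (\<exists>k. B k \<omega>)) = 0"
  proof (rule pr_zero_translates[OF \<rho> vacant_translation pred_origin_to_infinity(2) z unbounded_vacant_dense], assumption, assumption, assumption)
    fix \<omega> assume \<omega>: "\<omega> \<in> lf_configs" "\<not> (\<exists>k. B k \<omega>)"
    then have nB: "\<not> B k \<omega>" for k by blast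
    show "\<exists>x. unbounded_from (vacant \<omega>) x"
    proof (rule unbounded_of_alternating_crossings[OF R(1)])
      fix k :: nat
      have pos: "0 < 3 ^ k * R" "0 \<le> 3 ^ Suc k * R" using R(1) by auto
      show "hcross (vacant \<omega>) 0 (3 ^ Suc k * R) 0 (3 ^ k * R)" if "even k"
        using nB[of k] that pos \<omega>(1) unfolding B_def by (intro vacant_hcross_of_no_vcross) auto
      show "vcross (vacant \<omega>) 0 (3 ^ k * R) 0 (3 ^ Suc k * R)" if "odd k"
        using nB[of k] that pos \<omega>(1) unfolding B_def
        by (intro vacant_vcross_of_no_hcross) (auto simp: lf_configs_def)
    qed
  qed
  moreover have "Measurable.pred V (\<lambda>\<omega>. \<exists>k. B k \<omega>)" using mB by (intro pred_intros_countable)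
  ultimately show False using pr_not[OF \<rho>, of "\<lambda>\<omega>. \<exists>k. B k \<omega>"] lt by simp
qed

section \<open>High intensity\<close>

lemma interval_sets_\<mu>: "0 \<le> a \<Longrightarrow> {a..s} \<in> sets \<mu>"
  unfolding sets_\<mu> by (subst sets_restrict_space_iff) auto

lemma exists_charged_interval:
  assumes "emeasure \<mu> {0<..} > 0"
  obtains a s where "0 < a" "a \<le> s" "0 < measure \<mu> {a..s}"
proof -
  let ?A = "\<lambda>n::nat. {1 / real (Suc n)..real (Suc n)}"
  have "{0<..} \<subseteq> (\<Union>n. ?A n)"
  proof
    fix x :: real assume x: "x \<in> {0<..}"
    obtain n :: nat where n: "max x (1 / x) \<le> real n" using real_arch_simple by blast
    then have "1 / x \<le> real (Suc n)" "x \<le> real (Suc n)" by auto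
    with x have "x \<in> ?A n" by (simp add: field_simps)
    then show "x \<in> (\<Union>n. ?A n)" by blast
  qed
  then have "emeasure \<mu> {0<..} \<le> emeasure \<mu> (\<Union>n. ?A n)"
    by (intro emeasure_mono sets.countable_UN') (auto intro: interval_sets_\<mu>)
  with assms have "emeasure \<mu> (\<Union>n. ?A n) \<noteq> 0" by auto
  then obtain n where "emeasure \<mu> (?A n) \<noteq> 0"
    using emeasure_UN_eq_0[of \<mu> ?A] interval_sets_\<mu> by fastforce
  then have "0 < measure \<mu> (?A n)"
    using finite_measure.emeasure_eq_measure[OF prob_space.finite_measure[OF prob_space_\<mu>], of "?A n"]
    by (simp add: zero_less_measure_iff)
  moreover have "1 / real (Suc n) \<le> 1" "1 \<le> real (Suc n)" by auto
  then have "1 / real (Suc n) \<le> real (Suc n)" by linarith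
  ultimately show ?thesis using that[of "1 / real (Suc n)" "real (Suc n)"] by simp
qed

text \<open>At high intensity every cell along the bottom side is likely to contain the centre of a
  disc that covers the adjacent piece of this side. That makes \<open>fail\<close> small on an
  initial range of scales, and \<open>fail_half\<close> does the rest.\<close>

lemma hard_tendsto_large_intensity:
  assumes "emeasure \<mu> {0<..} > 0"
  shows "\<exists>\<rho>\<ge>0. (hard \<rho> \<longlongrightarrow> 1) at_top"
proof -
  obtain a s where as: "0 < a" "a \<le> s" "0 < measure \<mu> {a..s}"
    using exists_charged_interval[OF assms] by blast
  \<comment> \<open>A centre in a cell of side \<open>l\<close> is within \<open>2 * l\<close> of
    every point on the bottom of the cell, which is below the smallest radius
    \<open>a = 4 * l\<close>.\<close>
  define l where "l = a / 4"
  have l: "0 < l" using as by (simp add: l_def)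
  define A where "A = (\<lambda>i::nat. ({real i * l..real (Suc i) * l} \<times> {0..l}) \<times> {a..s})"
  define c where "c = l * l * measure \<mu> {a..s}"
  have c: "0 < c" unfolding c_def using l as by simp
  have A: "A i \<in> sets E" "emeasure E (A i) = ennreal c" for i
  proof -
    interpret sigma_finite_measure \<mu> by (rule prob_space_imp_sigma_finite[OF prob_space_\<mu>])
    have S: "{a..s} \<in> sets \<mu>" using as by (intro interval_sets_\<mu>) auto
    have S': "{real i * l..real (Suc i) * l} \<times> {0..l} \<in> sets lborel"
      by (simp add: borel_closed closed_Times)
    show "A i \<in> sets E" unfolding A_def E_def by (intro pair_measureI S S')
    have "emeasure E (A i) = emeasure lborel ({real i * l..real (Suc i) * l} \<times> {0..l}) * emeasure \<mu> {a..s}"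
      unfolding A_def E_def by (rule emeasure_pair_measure_Times[OF S' S])
    also have "\<dots> = ennreal (l * l) * ennreal (measure \<mu> {a..s})"
      using l finite_measure.emeasure_eq_measure[OF prob_space.finite_measure[OF prob_space_\<mu>]]
      by (subst emeasure_lborel_square) (auto simp: algebra_simps)
    finally show "emeasure E (A i) = ennreal c" using l by (simp add: c_def ennreal_mult)
  qed
  \<comment> \<open>Enough cells for the longest initial rectangle, of length
    \<open>3 * r \<le> 36 * s\<close>.\<close>
  obtain N :: nat where N: "36 * s / l \<le> N" using real_arch_simple by blast
  \<comment> \<open>Solves \<open>real (Suc N) * exp (- (\<rho> * c)) = 1 / 98\<close>, the union
    bound over empty cells.\<close>
  define \<rho> where "\<rho> = ln (98 * real (Suc N)) / c"
  have \<rho>: "0 \<le> \<rho>" unfolding \<rho>_def using c by (intro divide_nonneg_pos ln_ge_zero) auto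
  \<comment> \<open>The range from \<open>4 * s\<close> to \<open>12 * s\<close> spans a factor 3,
    so tripling reaches all larger scales.\<close>
  have start: "fail s \<rho> r \<le> 1 / 98" if r: "4 * s \<le> r" "r \<le> 12 * s" for r
  proof -
    have r0: "0 < r" using r as by auto
    have mA: "Measurable.pred V (\<lambda>\<omega>. \<omega> \<inter> A i = {})" for i
      using A[of i] by (intro void_pred) auto
    have "fail s \<rho> r \<le> pr \<rho> (\<lambda>\<omega>. \<exists>i\<in>{..N}. \<omega> \<inter> A i = {})"
      unfolding fail_def
    proof (rule pr_mono[OF \<rho>])
      show "Measurable.pred V (\<lambda>\<omega>. \<exists>i\<in>{..N}. \<omega> \<inter> A i = {})"
        using mA by (intro pred_intros_finite) auto
      fix \<omega> assume no: "\<not> hcross (occupied (\<omega> \<inter> short s)) 0 (3 * r) 0 r"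
      show "\<exists>i\<in>{..N}. \<omega> \<inter> A i = {}"
      proof (rule ccontr)
        assume all: "\<not> ?thesis"
        have "(t, 0) \<in> occupied (\<omega> \<inter> short s)" if t: "0 \<le> t" "t \<le> 3 * r" for t
        proof -
          define i where "i = nat \<lfloor>t / l\<rfloor>"
          have "real i = of_int \<lfloor>t / l\<rfloor>" using t(1) l by (simp add: i_def)
          then have i: "real i \<le> t / l" "t / l \<le> real (Suc i)" by linarith+
          have "t \<le> 36 * s" using t(2) r(2) by simp
          then have "t / l \<le> real N" using N divide_right_mono[of t "36 * s" l] l by simp
          with i(1) have "i \<le> N" by linarith
          with all obtain p where p: "p \<in> \<omega>" "p \<in> A i" by blast
          have "real i * l \<le> t" "t \<le> real (Suc i) * l"
            using i l by (simp_all only: pos_le_divide_eq pos_divide_le_eq)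
          moreover have "real (Suc i) * l = real i * l + l" by (simp add: algebra_simps)
          ultimately have "\<bar>fst (fst p) - t\<bar> \<le> l" "\<bar>snd (fst p)\<bar> \<le> l" "a \<le> snd p" "snd p \<le> s"
            using p(2) by (auto simp: A_def)
          moreover have "dist (fst p) (t, 0) \<le> \<bar>fst (fst p) - t\<bar> + \<bar>snd (fst p)\<bar>"
            using norm_Pair_le[of "fst (fst p) - t" "snd (fst p)"] by (cases "fst p") (simp add: dist_norm)
          ultimately have "(t, 0) \<in> cball (fst p) (snd p)" "p \<in> short s"
            using l by (auto simp: l_def short_def)
          with p(1) show ?thesis unfolding occupied_eq by blast
        qed
        then have sub: "{0..3 * r} \<times> {0} \<subseteq> occupied (\<omega> \<inter> short s) \<inter> ({0..3 * r} \<times> {0..r})"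
          using r0 by auto
        have "path_component ({0..3 * r} \<times> {0}) (0, 0) (3 * r, 0::real)"
        proof -
          have "convex ({0..3 * r} \<times> {0::real})" by (intro convex_Times) auto
          from convex_imp_path_connected[OF this] show ?thesis
            using r0 unfolding path_connected_component by auto
        qed
        then have "hcross (occupied (\<omega> \<inter> short s)) 0 (3 * r) 0 r"
          unfolding hcross_def using path_component_of_subset[OF sub] by (metis fst_conv)
        with no show False by blast
      qed
    qed
    also have "\<dots> \<le> (\<Sum>i\<le>N. pr \<rho> (\<lambda>\<omega>. \<omega> \<inter> A i = {}))" by (rule pr_bex[OF \<rho> _ mA]) auto
    also have "\<dots> = real (Suc N) * exp (- (\<rho> * c))"
    proof -
      have "pr \<rho> (\<lambda>\<omega>. \<omega> \<inter> A i = {}) = exp (- (\<rho> * c))" for i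
        using pr_void[OF \<rho> A(1)[of i]] A(2)[of i] c by (simp add: measure_def)
      then show ?thesis by simp
    qed
    also have "\<dots> = 1 / 98" using c by (simp add: \<rho>_def exp_minus field_simps)
    finally show ?thesis .
  qed
  have s: "0 < s" using as by simp
  have small: "fail s \<rho> r \<le> 1 / 98" if "4 * s \<le> r" "r \<le> 3 ^ n * (4 * s)" for n r
    using that
  proof (induction n arbitrary: r)
    case 0 then show ?case using start s by simp
  next
    case (Suc n)
    show ?case
    proof (cases "r \<le> 12 * s")
      case True then show ?thesis using start Suc by simp
    next
      case False
      then have IH: "fail s \<rho> (r / 3) \<le> 1 / 98" using Suc by (intro Suc.IH) auto
      have "fail s \<rho> (3 * (r / 3)) \<le> fail s \<rho> (r / 3) / 2"
        using False s IH by (intro fail_half[OF \<rho>]) auto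
      with IH show ?thesis by simp
    qed
  qed
  have small: "fail s \<rho> r \<le> 1 / 98" if "4 * s \<le> r" for r
  proof -
    obtain n where "r / (4 * s) < 3 ^ n" using real_arch_pow[of 3] by auto
    then have "r \<le> 3 ^ n * (4 * s)" using s by (simp add: pos_divide_less_eq)
    with small that show ?thesis by blast
  qed
  have "(fail s \<rho> \<longlongrightarrow> 0) at_top"
  proof (rule tendsto_zero_of_recursion[of "4 * s" _ "\<lambda>_. 0"])
    show "fail s \<rho> (3 * r) \<le> 0 + fail s \<rho> r / 2" if "4 * s \<le> r" for r
      using fail_half[OF \<rho> _ that small[OF that]] s that by simp
    show "0 \<le> fail s \<rho> r \<and> fail s \<rho> r \<le> 1" for r by (rule fail_bounds[OF \<rho>])
  qed (use s in auto)
  then have "((\<lambda>r. 1 - fail s \<rho> r) \<longlongrightarrow> 1 - 0) at_top" by (intro tendsto_intros)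
  moreover have "1 - fail s \<rho> r \<le> hard \<rho> r" for r
  proof -
    have "1 - fail s \<rho> r = pr \<rho> (\<lambda>\<omega>. hcross (occupied (\<omega> \<inter> short s)) 0 (3 * r) 0 r)"
      unfolding fail_def using pr_not[OF \<rho> pred_short[OF pred_hcross]] by simp
    also have "\<dots> \<le> hard \<rho> r" unfolding hard_def
      by (intro pr_mono[OF \<rho> pred_hcross]) (auto elim!: hcross_mono dest: subsetD[OF occupied_mono, rotated])
    finally show ?thesis .
  qed
  moreover have "hard \<rho> r \<le> 1" for r unfolding hard_def using pr_bounds[OF \<rho>] by blast
  ultimately have "(hard \<rho> \<longlongrightarrow> 1) at_top"
    by (intro tendsto_sandwich[of "\<lambda>r. 1 - fail s \<rho> r" "hard \<rho>" at_top "\<lambda>_. 1"]) auto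
  with \<rho> show ?thesis by blast
qed

section \<open>The critical parameters\<close>

lemma event_prob_Cross:
  assumes "0 \<le> \<rho>"
  shows "event_prob (P \<rho>) (Cross r (3 * r)) = easy \<rho> r" "event_prob (P \<rho>) (Cross (3 * r) r) = hard \<rho> r"
proof -
  have "Cross r h = (\<lambda>\<omega>. hcross (occupied \<omega>) 0 r 0 h)" for r h by (rule ext) (rule Cross_iff)
  then show "event_prob (P \<rho>) (Cross r (3 * r)) = easy \<rho> r" "event_prob (P \<rho>) (Cross (3 * r) r) = hard \<rho> r"
    using event_prob_eq[OF assms pred_hcross] by (simp_all add: easy_def hard_def)
qed

lemma lambda_0_eq: "lambda_0 P = Sup (ennreal ` {\<rho>. \<rho> \<ge> 0 \<and> (easy \<rho> \<longlongrightarrow> 0) at_top})"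
  unfolding lambda_0_def by (intro arg_cong[of _ _ Sup] image_cong Collect_cong conj_cong refl) (simp_all add: event_prob_Cross)

lemma lambda_1_eq: "lambda_1 P = Inf (ennreal ` {\<rho>. \<rho> \<ge> 0 \<and> (hard \<rho> \<longlongrightarrow> 1) at_top})"
  unfolding lambda_1_def by (intro arg_cong[of _ _ Inf] image_cong Collect_cong conj_cong refl) (simp_all add: event_prob_Cross)

lemma lambda_c_eq: "lambda_c P = Sup (ennreal ` {\<rho>. \<rho> \<ge> 0 \<and> pr \<rho> (\<lambda>\<omega>. origin_to_infinity (occupied \<omega>)) = 0})"
  unfolding lambda_c_def
  by (intro arg_cong[of _ _ Sup] image_cong Collect_cong conj_cong refl) (simp_all add: event_prob_eq pred_origin_to_infinity)

lemma lambda_c_star_eq: "lambda_c_star P = Inf (ennreal ` {\<rho>. \<rho> \<ge> 0 \<and> pr \<rho> (\<lambda>\<omega>. origin_to_infinity (vacant \<omega>)) = 0})"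
  unfolding lambda_c_star_def
  by (intro arg_cong[of _ _ Inf] image_cong Collect_cong conj_cong refl) (simp_all add: event_prob_eq pred_origin_to_infinity)

lemma easy_tendsto_mono: "0 \<le> a \<Longrightarrow> a \<le> b \<Longrightarrow> (easy b \<longlongrightarrow> 0) at_top \<Longrightarrow> (easy a \<longlongrightarrow> 0) at_top"
  using easy_bounds[of a] easy_increasing[of a b]
  by (intro tendsto_sandwich[of "\<lambda>_. 0" "easy a" at_top "easy b"]) auto

lemma hard_tendsto_mono:
  assumes "0 \<le> a" "a \<le> b" "(hard a \<longlongrightarrow> 1) at_top" shows "(hard b \<longlongrightarrow> 1) at_top"
proof (rule tendsto_sandwich[of "hard a" "hard b" at_top "\<lambda>_. 1"])
  have "hard b r \<le> 1" for r unfolding hard_def using pr_bounds[of b] assms by auto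
  then show "\<forall>\<^sub>F r in at_top. hard b r \<le> 1" by simp
  show "\<forall>\<^sub>F r in at_top. hard a r \<le> hard b r"
    using hard_increasing[OF assms(1,2)] by (rule always_eventually[OF allI])
  show "(hard a \<longlongrightarrow> 1) at_top" by (rule assms(3))
qed simp

lemma lambda_0_pos: "0 < lambda_0 P"
proof -
  obtain \<rho> where \<rho>: "0 < \<rho>" "(easy \<rho> \<longlongrightarrow> 0) at_top" using easy_tendsto_small_intensity by blast
  then have "ennreal \<rho> \<le> lambda_0 P" unfolding lambda_0_eq by (intro Sup_upper) auto
  moreover have "0 < ennreal \<rho>" using \<rho> by simp
  ultimately show ?thesis by (rule less_le_trans[rotated])
qed

lemma lambda_0_le_lambda_c: "lambda_0 P \<le> lambda_c P"
  unfolding lambda_0_eq lambda_c_eq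
  by (intro Sup_subset_mono image_mono) (auto intro: occupied_origin_null_of_easy)

text \<open>The intensities at which \<open>hard\<close> tends to 1 form an up-set on which the
  occupied set percolates, so an intensity without percolation lies below all of them.\<close>

lemma lambda_c_le_lambda_1: "lambda_c P \<le> lambda_1 P"
  unfolding lambda_1_eq lambda_c_eq
proof (intro Sup_least Inf_greatest, elim imageE CollectE conjE)
  fix x y :: ennreal and \<rho> \<sigma> :: real
  assume *: "0 \<le> \<rho>" "pr \<rho> (\<lambda>\<omega>. origin_to_infinity (occupied \<omega>)) = 0" "0 \<le> \<sigma>" "(hard \<sigma> \<longlongrightarrow> 1) at_top"
    and xy: "x = ennreal \<rho>" "y = ennreal \<sigma>"
  have "\<rho> \<le> \<sigma>"
  proof (rule ccontr)
    assume "\<not> \<rho> \<le> \<sigma>"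
    then have "(hard \<rho> \<longlongrightarrow> 1) at_top" using hard_tendsto_mono[OF *(3) _ *(4)] by simp
    from percolates_of_hard[OF *(1) this] *(2) show False by blast
  qed
  then show "x \<le> y" unfolding xy by (rule ennreal_leI)
qed

lemma lambda_1_finite: "emeasure \<mu> {0<..} > 0 \<Longrightarrow> lambda_1 P < \<infinity>"
proof -
  assume "emeasure \<mu> {0<..} > 0"
  then obtain \<rho> where "0 \<le> \<rho>" "(hard \<rho> \<longlongrightarrow> 1) at_top" using hard_tendsto_large_intensity by blast
  then have "lambda_1 P \<le> ennreal \<rho>" unfolding lambda_1_eq by (intro Inf_lower) auto
  then show ?thesis by (rule le_less_trans) simp
qed

text \<open>Convergence of \<open>easy\<close> to 0 passes to smaller intensities, and there the
  vacant set percolates.\<close>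

lemma lambda_0_le_lambda_c_star:
  assumes "integrable \<mu> (\<lambda>x. x\<^sup>2 * ln x)" shows "lambda_0 P \<le> lambda_c_star P"
  unfolding lambda_0_eq lambda_c_star_eq
proof (intro Sup_least Inf_greatest, elim imageE CollectE conjE)
  fix x y :: ennreal and \<rho> \<sigma> :: real
  assume *: "0 \<le> \<rho>" "(easy \<rho> \<longlongrightarrow> 0) at_top" "0 \<le> \<sigma>" "pr \<sigma> (\<lambda>\<omega>. origin_to_infinity (vacant \<omega>)) = 0"
    and xy: "x = ennreal \<rho>" "y = ennreal \<sigma>"
  have "\<rho> \<le> \<sigma>"
  proof (rule ccontr)
    assume "\<not> \<rho> \<le> \<sigma>"
    then have "(easy \<sigma> \<longlongrightarrow> 0) at_top" using easy_tendsto_mono[OF *(3) _ *(2)] by simp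
    from vacant_percolates_of_easy[OF assms *(3) this] *(4) show False by blast
  qed
  then show "x \<le> y" unfolding xy by (rule ennreal_leI)
qed

lemma lambda_c_star_le_lambda_1: "lambda_c_star P \<le> lambda_1 P"
  unfolding lambda_1_eq lambda_c_star_eq
  by (intro Inf_superset_mono image_mono) (auto intro: vacant_origin_null_of_hard)

end

text \<open>Above 3 the logarithm is at least 1; below 3 the square is at most 9.\<close>

lemma second_moment_of_log_moment:
  assumes "prob_space \<mu>" "sets \<mu> = sets (restrict_space borel {0..})"
    and int: "integrable \<mu> (\<lambda>x::real. x\<^sup>2 * ln x)"
  shows "integrable \<mu> (\<lambda>x. x\<^sup>2)"
proof (rule Bochner_Integration.integrable_bound)
  interpret prob_space \<mu> by fact
  show "integrable \<mu> (\<lambda>x. 9 + \<bar>x\<^sup>2 * ln x\<bar>)"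
    using int by (intro Bochner_Integration.integrable_add integrable_abs) auto
  show "(\<lambda>x. x\<^sup>2) \<in> borel_measurable \<mu>"
    by (rule measurable_compose[OF borel_measurable_half_line[OF assms(2)]]) measurable
  have "x\<^sup>2 \<le> 9 + \<bar>x\<^sup>2 * ln x\<bar>" if "0 \<le> x" for x :: real
  proof (cases "x \<le> 3")
    case True
    then have "x\<^sup>2 \<le> 3\<^sup>2" using that by (intro power_mono) auto
    then show ?thesis using abs_ge_zero[of "x\<^sup>2 * ln x"] by simp
  next
    case False
    then have "1 \<le> ln x" using exp_le by (subst ln_ge_iff) auto
    then have "x\<^sup>2 * 1 \<le> x\<^sup>2 * ln x" by (intro mult_left_mono) auto
    then show ?thesis by simp
  qed
  then show "AE x in \<mu>. norm (x\<^sup>2) \<le> norm (9 + \<bar>x\<^sup>2 * ln x\<bar>)"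
    using sets_eq_imp_space_eq[OF assms(2)] by (intro AE_I2) (simp add: space_restrict_space)
qed

text \<open>If \<open>\<mu>\<close> is concentrated at 0, the occupied set is almost surely
  countable and contains no crossing, so \<open>lambda_1 P\<close> is infinite; finiteness is
  therefore claimed when positive radii have positive mass. Since \<open>x\<^sup>2 * ln x\<close> is
  bounded on the unit interval, its integrability means that its integral is finite.\<close>

theorem corollary3p4:
  fixes \<mu> :: "real measure" and P :: "real \<Rightarrow> config measure"
  assumes "prob_space \<mu>" and "sets \<mu> = sets (restrict_space borel {0..})"
    and "\<And>\<rho>. \<rho> \<ge> 0 \<Longrightarrow> poisson_process_law (boolean_intensity \<mu> \<rho>) (P \<rho>)"
  shows "(integrable \<mu> (\<lambda>x. x\<^sup>2) \<longrightarrow>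
            0 < lambda_0 P \<and> lambda_0 P \<le> lambda_c P \<and> lambda_c P \<le> lambda_1 P \<and>
            (emeasure \<mu> {0<..} > 0 \<longrightarrow> lambda_1 P < \<infinity>)) \<and>
         (integrable \<mu> (\<lambda>x. x\<^sup>2 * ln x) \<longrightarrow>
            lambda_0 P \<le> lambda_c_star P \<and> lambda_c_star P \<le> lambda_1 P)"
proof (intro conjI impI)
  assume int: "integrable \<mu> (\<lambda>x. x\<^sup>2)"
  interpret poisson_boolean \<mu> P
    by (intro poisson_boolean.intro boolean_model.intro poisson_boolean_axioms.intro assms int)
  show "0 < lambda_0 P" by (rule lambda_0_pos)
  show "lambda_0 P \<le> lambda_c P" by (rule lambda_0_le_lambda_c)
  show "lambda_c P \<le> lambda_1 P" by (rule lambda_c_le_lambda_1)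
  show "lambda_1 P < \<infinity>" if "emeasure \<mu> {0<..} > 0" using that by (rule lambda_1_finite)
next
  assume int: "integrable \<mu> (\<lambda>x. x\<^sup>2 * ln x)"
  interpret poisson_boolean \<mu> P
    by (intro poisson_boolean.intro boolean_model.intro poisson_boolean_axioms.intro assms
      second_moment_of_log_moment[OF assms(1,2) int])
  show "lambda_0 P \<le> lambda_c_star P" using int by (rule lambda_0_le_lambda_c_star)
  show "lambda_c_star P \<le> lambda_1 P" by (rule lambda_c_star_le_lambda_1)
qed

end
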